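(* Let $C_1,C_2$ be gapped filtered $A_\infty$-algebras over $\Lambda_{0,nov}$, and let $f:C_1\to C_2$ be a gapped filtered $A_\infty$-homomorphism such that $\overline f_1$ induces an isomorphism on $\overline m_1$-homologies. Then $f$ induces an isomorphism on bar cohomology of $C_1$ and $C_2$; that is, $\widehat f$ induces isomorphisms on the cohomologies of $$(\widehat BC_i,\widehat d),\qquad(\widehat B^{cyc}C_i,\widehat d),\qquad(\widehat EC_i,\widehat d).$$
   Context: $R=\mathbb R$; $\Lambda_{0,nov}=\{\sum_{i\ge0}a_iT^{\lambda_i}e^{q_i}:a_i\in R,\lambda_i\in\mathbb R_{\ge0},q_i\in\mathbb Z,\lambda_i\to\infty\}$, $\deg T=0$, $\deg e=2$; $\Lambda_{0,nov}^+$ is the ideal with all $\lambda_i>0$; $\tau$ is the minimal exponent of $T$ and $F^\lambda=\{\tau\ge\lambda\}$ is the energy filtration. **Filtered $A_\infty$-algebra.** $\overline C$ is a graded $R$-vector space, $C$ the energy completion of $\overline C\otimes_R\Lambda_{0,nov}$, $C[1]^m=C^{m+1}$, $|x|'=|x|-1$, $B_kC=C[1]^{\otimes k}$, $B_0C=\Lambda_{0,nov}$, $\widehat BC=\widehat\bigoplus_{k\ge0}B_kC$ (energy completion). Degree one $\Lambda_{0,nov}$-linear maps $m_k:B_kC\to C[1]$, $k\ge0$, with $m_k(F^{\lambda_1}C\otimes\cdots\otimes F^{\lambda_k}C)\subset F^{\lambda_1+\cdots+\lambda_k}C$, $m_0(1)\in F^{\lambda'}C$ for some $\lambda'>0$,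 such that $\widehat d=\sum_k\widehat m_k$ satisfies $\widehat d\circ\widehat d=0$, where $\widehat m_k(x_1\otimes\cdots\otimes x_n)=\sum_i(-1)^{|x_1|'+\cdots+|x_{i-1}|'}x_1\otimes\cdots\otimes m_k(x_i,\dots,x_{i+k-1})\otimes\cdots\otimes x_n$ (for $k=0$ insert $m_0(1)$ in all $n+1$ positions). Modulo $\Lambda^+_{0,nov}$ the $m_k$ are induced by $\overline m_k:B_k\overline C\to\overline C[1]$ (with $\overline m_0=0$). **Homomorphism.** Degree $0$ maps $f_k:B_kC_1\to C_2[1]$, $k\ge0$, preserving energy, $f_0(1)\in F^{\lambda'}C_2$ for some $\lambda'>0$, whose induced map $\widehat f$ (sum over all cuttings of a word into consecutive, possibly empty, pieces, applying $f$ to each piece) commutes with $\widehat d$; the reductions modulo $\Lambda_{0,nov}^+$ are induced by maps $\overline f_k$ on $B_k\overline C_1$. **Gapped.** There is a submonoid $G\subset\mathbb R_{\ge0}\times2\mathbb Z$ with discrete projection to $\mathbb R_{\ge0}$, finite fibres, and $G\cap(\{0\}\times2\mathbb Z)=\{(0,0)\}$, such that $m_k=\sum_{\beta=(\lambda,\mu)\in G}T^{\lambda}e^{\mu/2}m_{k,\beta}$ with $m_{k,\beta}$ defined on $\overline C$ over $R$; similarly for $f_k$. **Subcomplexes.** $S_k$ acts on $B_kC$ by permutations with Koszul signs for $|\cdot|'$. $B_k^{cyc}C$ is the submodule fixed by the cyclic generator, $E_kC$ the submodule fixed by $S_k$; $\widehat B^{cyc}C=\widehat\bigoplus_{k\ge0}B_k^{cyc}C$,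 $\widehat EC=\widehat\bigoplus_{k\ge0}E_kC$; they are preserved by $\widehat d$ and $\widehat f$. "Bar cohomology" refers to the cohomology of any of the three complexes. *)

theory Defs
  imports "HOL-Analysis.Analysis" "HOL-Analysis.Finite_Function_Topology"
begin

section \<open>Energy completions over the universal Novikov ring\<close>

text \<open>
  For a real vector space \<open>V\<close> the energy completion of \<open>V \<otimes> \<Lambda>\<^sub>0\<^sub>,\<^sub>n\<^sub>o\<^sub>v\<close> is the space of formal sums
  \<open>\<Sum> v\<^sub>i T^\<lambda>\<^sub>i e^q\<^sub>i\<close> with \<open>v\<^sub>i \<in> V\<close>, \<open>\<lambda>\<^sub>i \<ge> 0\<close> and \<open>\<lambda>\<^sub>i \<rightarrow> \<infinity>\<close>; such a sum is recorded by its
  coefficient function \<open>(\<lambda>, q) \<mapsto> v\<close>. Thus \<open>real nov\<close> is \<open>\<Lambda>\<^sub>0\<^sub>,\<^sub>n\<^sub>o\<^sub>v\<close> itself, \<open>'a nov\<close> is the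
  completion \<open>C\<close> of \<open>'a \<otimes> \<Lambda>\<^sub>0\<^sub>,\<^sub>n\<^sub>o\<^sub>v\<close>, and, with \<open>'a tensor\<close> the tensor algebra below, \<open>'a tensor nov\<close> is
  the completed bar complex: modulo energy \<open>\<ge> E\<close> the tensor power of \<open>C\<close> over \<open>\<Lambda>\<^sub>0\<^sub>,\<^sub>n\<^sub>o\<^sub>v\<close> is the tensor
  power of \<open>'a\<close> over the reals tensored with \<open>\<Lambda>\<^sub>0\<^sub>,\<^sub>n\<^sub>o\<^sub>v\<close>, so both direct sums have the same completion.
\<close>

typedef (overloaded) 'v nov =
  "{x :: real \<Rightarrow> int \<Rightarrow> 'v::zero. (\<forall>s q. s < 0 \<longrightarrow> x s q = 0) \<and>
     (\<forall>E. finite {(s, q). s \<le> E \<and> x s q \<noteq> 0})}"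
  morphisms ncoeff Abs_nov
  by (rule exI[of _ "\<lambda>_ _. 0"]) simp

setup_lifting type_definition_nov

type_synonym novikov = "real nov"

lemma nov_eqI: "(\<And>s q. ncoeff x s q = ncoeff y s q) \<Longrightarrow> x = y"
  by (simp add: ncoeff_inject[symmetric] fun_eq_iff)

lemma ncoeff_neg: "s < 0 \<Longrightarrow> ncoeff x s q = 0"
  using ncoeff[of x] by simp

lemma finite_ncoeff: "finite {(s, q). s \<le> E \<and> ncoeff x s q \<noteq> 0}"
  using ncoeff[of x] by simp

instantiation nov :: (real_vector) real_vector
begin

lift_definition zero_nov :: "'a nov" is "\<lambda>_ _. 0" by simp

lift_definition plus_nov :: "'a nov \<Rightarrow> 'a nov \<Rightarrow> 'a nov" is "\<lambda>x y s q. x s q + y s q"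
proof -
  fix x y :: "real \<Rightarrow> int \<Rightarrow> 'a"
  assume a: "(\<forall>s q. s < 0 \<longrightarrow> x s q = 0) \<and> (\<forall>E. finite {(s, q). s \<le> E \<and> x s q \<noteq> 0})"
     and b: "(\<forall>s q. s < 0 \<longrightarrow> y s q = 0) \<and> (\<forall>E. finite {(s, q). s \<le> E \<and> y s q \<noteq> 0})"
  have "finite {(s, q). s \<le> E \<and> x s q + y s q \<noteq> 0}" for E
    by (rule finite_subset[of _ "{(s, q). s \<le> E \<and> x s q \<noteq> 0} \<union> {(s, q). s \<le> E \<and> y s q \<noteq> 0}"])
       (use a b in auto)
  with a b show "(\<forall>s q. s < 0 \<longrightarrow> x s q + y s q = 0) \<and>
      (\<forall>E. finite {(s, q). s \<le> E \<and> x s q + y s q \<noteq> 0})" by simp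
qed

lift_definition uminus_nov :: "'a nov \<Rightarrow> 'a nov" is "\<lambda>x s q. - x s q" by simp

definition minus_nov :: "'a nov \<Rightarrow> 'a nov \<Rightarrow> 'a nov" where "minus_nov x y = x + - y"

lift_definition scaleR_nov :: "real \<Rightarrow> 'a nov \<Rightarrow> 'a nov" is "\<lambda>r x s q. r *\<^sub>R x s q"
proof -
  fix r :: real and x :: "real \<Rightarrow> int \<Rightarrow> 'a"
  assume a: "(\<forall>s q. s < 0 \<longrightarrow> x s q = 0) \<and> (\<forall>E. finite {(s, q). s \<le> E \<and> x s q \<noteq> 0})"
  have "finite {(s, q). s \<le> E \<and> r *\<^sub>R x s q \<noteq> 0}" for E
    by (rule finite_subset[of _ "{(s, q). s \<le> E \<and> x s q \<noteq> 0}"]) (use a in auto)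
  with a show "(\<forall>s q. s < 0 \<longrightarrow> r *\<^sub>R x s q = 0) \<and>
      (\<forall>E. finite {(s, q). s \<le> E \<and> r *\<^sub>R x s q \<noteq> 0})" by simp
qed

instance
  by standard (rule nov_eqI, simp add: zero_nov.rep_eq plus_nov.rep_eq uminus_nov.rep_eq
      minus_nov_def scaleR_nov.rep_eq algebra_simps)+

end

lemma ncoeff_simps [simp]:
  "ncoeff 0 s q = 0"
  "ncoeff (x + y) s q = ncoeff x s q + ncoeff y s q"
  "ncoeff (- x) s q = - ncoeff x s q"
  "ncoeff (x - y) s q = ncoeff x s q - ncoeff y s q"
  "ncoeff (r *\<^sub>R x) s q = r *\<^sub>R ncoeff x s q"
  by (simp_all only: zero_nov.rep_eq plus_nov.rep_eq uminus_nov.rep_eq minus_nov_def scaleR_nov.rep_eq)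
    simp

text \<open>The inclusion of \<open>V\<close> as the coefficients of \<open>T\<^sup>0 e\<^sup>0\<close>.\<close>

lift_definition nov_const :: "'v::zero \<Rightarrow> 'v nov" is "\<lambda>v s q. if s = 0 \<and> q = 0 then v else 0"
proof -
  fix v :: 'v
  have "finite {(s::real, q::int). s \<le> E \<and> (if s = 0 \<and> q = 0 then v else 0) \<noteq> 0}" for E
    by (rule finite_subset[of _ "{(0, 0)}"]) (auto split: if_splits)
  then show "(\<forall>s (q::int). s < (0::real) \<longrightarrow> (if s = 0 \<and> q = 0 then v else 0) = 0) \<and>
    (\<forall>E. finite {(s::real, q::int). s \<le> E \<and> (if s = 0 \<and> q = 0 then v else 0) \<noteq> 0})" by simp
qed

text \<open>The energy filtration \<open>F^E\<close>.\<close>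

definition energy_ge :: "real \<Rightarrow> 'v::zero nov set" where
  "energy_ge E = {x. \<forall>s q. s < E \<longrightarrow> ncoeff x s q = 0}"

text \<open>
  The \<open>\<Lambda>\<^sub>0\<^sub>,\<^sub>n\<^sub>o\<^sub>v\<close>-linear, energy-continuous extension of \<open>D\<close> from \<open>V\<close> to its completion:
  \<open>\<Sum> v\<^sub>i T^\<lambda>\<^sub>i e^q\<^sub>i \<mapsto> \<Sum> T^\<lambda>\<^sub>i e^q\<^sub>i D(v\<^sub>i)\<close>.
\<close>

lift_definition nov_extend :: "('v::real_vector \<Rightarrow> 'w::real_vector nov) \<Rightarrow> 'v nov \<Rightarrow> 'w nov" is
  "\<lambda>D x s q. \<Sum>(s', q') | s' \<le> s \<and> x s' q' \<noteq> 0. D (x s' q') (s - s') (q - q')"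
proof -
  fix D :: "'v \<Rightarrow> real \<Rightarrow> int \<Rightarrow> 'w" and x :: "real \<Rightarrow> int \<Rightarrow> 'v"
  assume D: "\<And>v. (\<forall>s q. s < 0 \<longrightarrow> D v s q = 0) \<and> (\<forall>E. finite {(s, q). s \<le> E \<and> D v s q \<noteq> 0})"
     and x: "(\<forall>s q. s < 0 \<longrightarrow> x s q = 0) \<and> (\<forall>E. finite {(s, q). s \<le> E \<and> x s q \<noteq> 0})"
  let ?S = "\<lambda>s q. \<Sum>(s', q') | s' \<le> s \<and> x s' q' \<noteq> 0. D (x s' q') (s - s') (q - q')"
  have neg: "?S s q = 0" if "s < 0" for s q
  proof -
    have "{(s', q'). s' \<le> s \<and> x s' q' \<noteq> 0} = {}"
      using that x by (auto dest: order.strict_trans1)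
    then show ?thesis by (simp only: sum.empty)
  qed
  have "finite {(s, q). s \<le> E \<and> ?S s q \<noteq> 0}" for E
  proof (rule finite_subset)
    let ?A = "{(s', q'). s' \<le> E \<and> x s' q' \<noteq> 0}"
    let ?B = "\<lambda>(s', q'). (\<lambda>(s, q). (s + s', q + q')) ` {(s, q). s \<le> E \<and> D (x s' q') s q \<noteq> 0}"
    show "{(s, q). s \<le> E \<and> ?S s q \<noteq> 0} \<subseteq> (\<Union>a\<in>?A. ?B a)"
    proof clarify
      fix s q assume "s \<le> E" "?S s q \<noteq> 0"
      from this(2) obtain a where "a \<in> {(s', q'). s' \<le> s \<and> x s' q' \<noteq> 0}"
        "(case a of (s', q') \<Rightarrow> D (x s' q') (s - s') (q - q')) \<noteq> 0"
        by (rule sum.not_neutral_contains_not_neutral)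
      then obtain s' q' where *: "s' \<le> s" "x s' q' \<noteq> 0" "D (x s' q') (s - s') (q - q') \<noteq> 0"
        by (cases a) auto
      from * x have "0 \<le> s'" by (meson not_le)
      then have "(s, q) \<in> ?B (s', q')"
        using * \<open>s \<le> E\<close> by (auto intro!: image_eqI[of _ _ "(s - s', q - q')"])
      moreover have "(s', q') \<in> ?A" using * \<open>s \<le> E\<close> by simp
      ultimately show "(s, q) \<in> (\<Union>a\<in>?A. ?B a)" by blast
    qed
    show "finite (\<Union>a\<in>?A. ?B a)"
      using x D by (intro finite_UN_I) (auto intro!: finite_imageI)
  qed
  with neg show "(\<forall>s q. s < 0 \<longrightarrow> ?S s q = 0) \<and> (\<forall>E. finite {(s, q). s \<le> E \<and> ?S s q \<noteq> 0})"
    by (intro conjI allI impI)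
qed

definition nov_map :: "('v::real_vector \<Rightarrow> 'w::real_vector) \<Rightarrow> 'v nov \<Rightarrow> 'w nov" where
  "nov_map g = nov_extend (\<lambda>v. nov_const (g v))"

definition nov_smult :: "novikov \<Rightarrow> 'v::real_vector nov \<Rightarrow> 'v nov" where
  "nov_smult a x = nov_extend (\<lambda>r. r *\<^sub>R x) a"

text \<open>Sums of families that converge in the energy topology (by convention 0 otherwise).\<close>

definition nov_summable :: "('i \<Rightarrow> 'v::real_vector nov) \<Rightarrow> 'i set \<Rightarrow> bool" where
  "nov_summable x I \<longleftrightarrow> (\<forall>E. finite {i\<in>I. x i \<notin> energy_ge E})"

definition nov_sum :: "('i \<Rightarrow> 'v::real_vector nov) \<Rightarrow> 'i set \<Rightarrow> 'v nov" where
  "nov_sum x I = (if nov_summable x I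
     then Abs_nov (\<lambda>s q. \<Sum>i | i \<in> I \<and> ncoeff (x i) s q \<noteq> 0. ncoeff (x i) s q) else 0)"

lemma ncoeff_nov_sum:
  assumes "nov_summable x I"
  shows "ncoeff (nov_sum x I) s q = (\<Sum>i | i \<in> I \<and> ncoeff (x i) s q \<noteq> 0. ncoeff (x i) s q)"
proof -
  let ?S = "\<lambda>s q. \<Sum>i | i \<in> I \<and> ncoeff (x i) s q \<noteq> 0. ncoeff (x i) s q"
  have nz: "\<exists>i\<in>I. ncoeff (x i) s q \<noteq> 0" if "?S s q \<noteq> 0" for s q
    using sum.not_neutral_contains_not_neutral[OF that] by blast
  have "?S s q = 0" if "s < 0" for s q
    using nz[of s q] ncoeff_neg[OF that] by auto
  moreover have "finite {(s, q). s \<le> E \<and> ?S s q \<noteq> 0}" for E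
  proof (rule finite_subset)
    let ?J = "{i\<in>I. x i \<notin> energy_ge (E + 1)}"
    show "{(s, q). s \<le> E \<and> ?S s q \<noteq> 0} \<subseteq> (\<Union>i\<in>?J. {(s, q). s \<le> E \<and> ncoeff (x i) s q \<noteq> 0})"
      using nz by (fastforce simp: energy_ge_def)
    show "finite (\<Union>i\<in>?J. {(s, q). s \<le> E \<and> ncoeff (x i) s q \<noteq> 0})"
      using assms by (intro finite_UN_I) (auto simp: nov_summable_def finite_ncoeff)
  qed
  ultimately show ?thesis
    using assms by (simp add: nov_sum_def Abs_nov_inverse)
qed


section \<open>The tensor algebra of a real vector space\<close>

text \<open>
  The free vector space on all words, modulo multilinearity in each letter: the direct sum over
  \<open>k \<ge> 0\<close> of the \<open>k\<close>-fold tensor powers over the reals.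
\<close>

type_synonym 'a free_space = "('a list, real) poly_mapping"

definition multilinear_words :: "('a::real_vector list \<Rightarrow> 'w::real_vector) \<Rightarrow> bool" where
  "multilinear_words \<phi> \<longleftrightarrow>
     (\<forall>xs x y ys. \<phi> (xs @ (x + y) # ys) = \<phi> (xs @ x # ys) + \<phi> (xs @ y # ys)) \<and>
     (\<forall>xs r x ys. \<phi> (xs @ (r *\<^sub>R x) # ys) = r *\<^sub>R \<phi> (xs @ x # ys))"

definition free_word :: "'a list \<Rightarrow> 'a free_space" where
  "free_word xs = Poly_Mapping.single xs 1"

definition tensor_relations :: "'a::real_vector free_space set" where
  "tensor_relations =
     {free_word (xs @ (x + y) # ys) - free_word (xs @ x # ys) - free_word (xs @ y # ys) | xs x y ys. True} \<union>
     {free_word (xs @ (r *\<^sub>R x) # ys) - r *\<^sub>R free_word (xs @ x # ys) | xs r x ys. True}"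

definition tensor_eq :: "'a::real_vector free_space \<Rightarrow> 'a free_space \<Rightarrow> bool" where
  "tensor_eq p q \<longleftrightarrow> p - q \<in> span tensor_relations"

quotient_type (overloaded) 'a tensor = "'a::real_vector free_space" / tensor_eq
proof (rule equivpI)
  show "reflp (tensor_eq :: 'a free_space \<Rightarrow> _)"
    by (simp add: reflp_def tensor_eq_def span_zero)
  show "symp (tensor_eq :: 'a free_space \<Rightarrow> _)"
    unfolding symp_def tensor_eq_def by (metis minus_diff_eq span_neg)
  show "transp (tensor_eq :: 'a free_space \<Rightarrow> _)"
    unfolding transp_def tensor_eq_def
  proof (intro allI impI)
    fix p q r :: "'a free_space"
    assume "p - q \<in> span tensor_relations" "q - r \<in> span tensor_relations"
    from span_add[OF this] show "p - r \<in> span tensor_relations" by simp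
  qed
qed

instantiation tensor :: (real_vector) real_vector
begin

lift_definition zero_tensor :: "'a tensor" is 0 .

lift_definition plus_tensor :: "'a tensor \<Rightarrow> 'a tensor \<Rightarrow> 'a tensor" is "(+)"
  unfolding tensor_eq_def by (metis add_diff_add span_add)

lift_definition uminus_tensor :: "'a tensor \<Rightarrow> 'a tensor" is uminus
  unfolding tensor_eq_def by (metis minus_diff_minus span_neg)

lift_definition minus_tensor :: "'a tensor \<Rightarrow> 'a tensor \<Rightarrow> 'a tensor" is "(-)"
proof -
  fix p p' q q' :: "'a free_space"
  assume "tensor_eq p p'" "tensor_eq q q'"
  then have "(p - p') - (q - q') \<in> span tensor_relations"
    unfolding tensor_eq_def by (rule span_diff)
  also have "(p - p') - (q - q') = (p - q) - (p' - q')" by simp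
  finally show "tensor_eq (p - q) (p' - q')" unfolding tensor_eq_def .
qed

lift_definition scaleR_tensor :: "real \<Rightarrow> 'a tensor \<Rightarrow> 'a tensor" is "scaleR"
  unfolding tensor_eq_def by (metis scaleR_diff_right span_scale)

instance
  by standard (transfer, simp add: tensor_eq_def span_zero algebra_simps)+

end

lift_definition tword :: "'a::real_vector list \<Rightarrow> 'a tensor" is free_word .

lemma multilinear_words_tword: "multilinear_words tword"
  unfolding multilinear_words_def
proof (intro conjI allI; transfer)
  fix xs ys :: "'a list" and x y :: 'a and r :: real
  show "tensor_eq (free_word (xs @ (x + y) # ys)) (free_word (xs @ x # ys) + free_word (xs @ y # ys))"
    unfolding tensor_eq_def by (rule span_base) (auto simp: tensor_relations_def diff_diff_eq)
  show "tensor_eq (free_word (xs @ (r *\<^sub>R x) # ys)) (r *\<^sub>R free_word (xs @ x # ys))"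
    unfolding tensor_eq_def by (rule span_base) (unfold tensor_relations_def, blast)
qed

definition tensor_lift :: "('a::real_vector list \<Rightarrow> 'w::real_vector) \<Rightarrow> 'a tensor \<Rightarrow> 'w" where
  "tensor_lift \<phi> t =
     (let p = rep_tensor t in \<Sum>xs\<in>Poly_Mapping.keys p. Poly_Mapping.lookup p xs *\<^sub>R \<phi> xs)"

text \<open>The universal property: multilinear maps factor through \<open>tword\<close>.\<close>

lemma tensor_lift_tword:
  assumes "multilinear_words \<phi>"
  shows "tensor_lift \<phi> (tword xs) = \<phi> xs"
proof -
  define L where "L = (\<lambda>p. \<Sum>xs\<in>Poly_Mapping.keys p. Poly_Mapping.lookup p xs *\<^sub>R \<phi> xs)"
  have L: "L p = (\<Sum>xs\<in>S. Poly_Mapping.lookup p xs *\<^sub>R \<phi> xs)"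
    if "finite S" "Poly_Mapping.keys p \<subseteq> S" for p S
    unfolding L_def using that by (intro sum.mono_neutral_left) (auto simp: in_keys_iff)
  have add: "L (p + q) = L p + L q" for p q
  proof -
    let ?S = "Poly_Mapping.keys p \<union> Poly_Mapping.keys q"
    have "Poly_Mapping.keys (p + q) \<subseteq> ?S" by (rule Poly_Mapping.keys_add)
    then show ?thesis
      by (simp add: L[of ?S] lookup_add scaleR_add_left sum.distrib)
  qed
  have lookup_scale: "Poly_Mapping.lookup (r *\<^sub>R p) ys = r * Poly_Mapping.lookup p ys"
    for r and p :: "'a free_space" and ys
  proof -
    have "finite {i. r *\<^sub>R Poly_Mapping.lookup p i \<noteq> 0}"
      by (rule finite_subset[OF _ finite_keys[of p]]) (auto simp: in_keys_iff)
    then show ?thesis by (simp add: scaleR_poly_mapping_def Abs_poly_mapping_inverse)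
  qed
  have scale: "L (r *\<^sub>R p) = r *\<^sub>R L p" for r p
  proof -
    have "Poly_Mapping.keys (r *\<^sub>R p) \<subseteq> Poly_Mapping.keys p"
      by (auto simp: in_keys_iff lookup_scale)
    then show ?thesis
      by (simp add: L[of "Poly_Mapping.keys p"] lookup_scale scaleR_sum_right)
  qed
  have lin: "linear L" by (rule linearI) (simp_all add: add scale)
  have word: "L (free_word ys) = \<phi> ys" for ys
    by (simp add: L_def free_word_def)
  have rel: "L p = 0" if "p \<in> tensor_relations" for p
    using that assms
    by (auto simp: tensor_relations_def multilinear_words_def linear_diff[OF lin] scale word)
  have "tensor_eq (rep_tensor (tword xs)) (free_word xs)"
    by (metis Quotient3_abs_rep Quotient3_tensor tword.abs_eq tensor.abs_eq_iff)
  then have "rep_tensor (tword xs) - free_word xs \<in> span tensor_relations"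
    by (simp add: tensor_eq_def)
  then have "L (rep_tensor (tword xs) - free_word xs) = 0"
    using linear_eq_0_on_span[OF lin] rel by blast
  then show ?thesis
    by (simp add: linear_diff[OF lin] word) (simp add: tensor_lift_def L_def Let_def)
qed

text \<open>The tensor \<open>x\<^sub>1 \<otimes> \<dots> \<otimes> x\<^sub>k\<close> of elements of the completion.\<close>

definition tensor_cons :: "'a::real_vector \<Rightarrow> 'a tensor \<Rightarrow> 'a tensor" where
  "tensor_cons v = tensor_lift (\<lambda>xs. tword (v # xs))"

primrec nov_word :: "'a::real_vector nov list \<Rightarrow> 'a tensor nov" where
  "nov_word [] = nov_const (tword [])"
| "nov_word (x # xs) = nov_extend (\<lambda>v. nov_map (tensor_cons v) (nov_word xs)) x"


section \<open>Gradings\<close>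

definition graded_space :: "(int \<Rightarrow> 'a::real_vector set) \<Rightarrow> bool" where
  "graded_space gr \<longleftrightarrow> (\<forall>n. subspace (gr n)) \<and>
     (\<forall>x. \<exists>!u. finite {n. u n \<noteq> 0} \<and> (\<forall>n. u n \<in> gr n) \<and> x = (\<Sum>n | u n \<noteq> 0. u n))"

definition hcomp :: "(int \<Rightarrow> 'a::real_vector set) \<Rightarrow> int \<Rightarrow> 'a \<Rightarrow> 'a" where
  "hcomp gr n x =
     (THE u. finite {n. u n \<noteq> 0} \<and> (\<forall>n. u n \<in> gr n) \<and> x = (\<Sum>n | u n \<noteq> 0. u n)) n"

text \<open>
  A formula \<open>F ns xs\<close> for words \<open>xs\<close> of homogeneous letters of (unshifted) degrees \<open>ns\<close>, possibly with
  signs depending on \<open>ns\<close>, extended multilinearly to all words.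
\<close>

definition homogeneous_extension ::
  "(int \<Rightarrow> 'a::real_vector set) \<Rightarrow> (int list \<Rightarrow> 'a list \<Rightarrow> 'w::real_vector) \<Rightarrow> 'a list \<Rightarrow> 'w" where
  "homogeneous_extension gr F xs =
     (\<Sum>ns | list_all2 (\<lambda>n x. hcomp gr n x \<noteq> 0) ns xs. F ns (map2 (hcomp gr) ns xs))"

text \<open>Since \<open>e\<close> has degree 2, the coefficient of \<open>T^s e^q\<close> in an element of degree \<open>n\<close> has degree \<open>n - 2q\<close>.\<close>

definition nov_degree :: "(int \<Rightarrow> 'v::zero set) \<Rightarrow> int \<Rightarrow> 'v nov set" where
  "nov_degree gr n = {x. \<forall>s q. ncoeff x s q \<in> gr (n - 2 * q)}"

definition tensor_degree :: "(int \<Rightarrow> 'a::real_vector set) \<Rightarrow> int \<Rightarrow> 'a tensor set" where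
  "tensor_degree gr n =
     span {tword xs | xs ns. list_all2 (\<lambda>n x. x \<in> gr n) ns xs \<and> (\<Sum>n\<leftarrow>ns. n - 1) = n}"

definition bar_degree :: "(int \<Rightarrow> 'a::real_vector set) \<Rightarrow> int \<Rightarrow> 'a tensor nov set" where
  "bar_degree gr = nov_degree (tensor_degree gr)"


section \<open>Filtered A-infinity algebras and homomorphisms\<close>

text \<open>
  A map \<open>f\<close> on lists over \<open>'a nov\<close> encodes the family \<open>f\<^sub>k\<close>, \<open>k \<ge> 0\<close>: \<open>f\<^sub>k\<close> is the restriction to lists of
  length \<open>k\<close>, and a linear map on the \<open>k\<close>-fold tensor power over \<open>\<Lambda>\<^sub>0\<^sub>,\<^sub>n\<^sub>o\<^sub>v\<close> is a multilinear map on such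
  lists; \<open>f []\<close> is \<open>f\<^sub>0(1)\<close>.
\<close>

definition nov_multilinear :: "('a::real_vector nov list \<Rightarrow> 'b::real_vector nov) \<Rightarrow> bool" where
  "nov_multilinear f \<longleftrightarrow>
     (\<forall>xs x y ys. f (xs @ (x + y) # ys) = f (xs @ x # ys) + f (xs @ y # ys)) \<and>
     (\<forall>xs a x ys. f (xs @ nov_smult a x # ys) = nov_smult a (f (xs @ x # ys)))"

text \<open>
  The conditions common to the operations (\<open>d = 1\<close>) and to homomorphisms (\<open>d = 0\<close>): linearity, degree \<open>d\<close>
  with respect to the shifted degrees, preservation of energy, positive energy of \<open>f\<^sub>0(1)\<close>, and that
  modulo \<open>\<Lambda>\<^sup>+\<close> the \<open>f\<^sub>k\<close> are induced by maps over the reals, i.e. no power of \<open>e\<close> occurs at energy 0.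
\<close>

definition filtered_maps ::
  "(int \<Rightarrow> 'a::real_vector set) \<Rightarrow> (int \<Rightarrow> 'b::real_vector set) \<Rightarrow> int \<Rightarrow> ('a nov list \<Rightarrow> 'b nov) \<Rightarrow> bool" where
  "filtered_maps gr1 gr2 d f \<longleftrightarrow>
     nov_multilinear f \<and>
     (\<forall>ns xs. list_all2 (\<lambda>n x. x \<in> nov_degree gr1 n) ns xs \<longrightarrow>
        f xs \<in> nov_degree gr2 ((\<Sum>n\<leftarrow>ns. n - 1) + d + 1)) \<and>
     (\<forall>Es xs. list_all2 (\<lambda>E x. x \<in> energy_ge E) Es xs \<longrightarrow> f xs \<in> energy_ge (sum_list Es)) \<and>
     (\<exists>E>0. f [] \<in> energy_ge E) \<and>
     (\<forall>xs q. q \<noteq> 0 \<longrightarrow> ncoeff (f (map nov_const xs)) 0 q = 0)"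

definition reduction :: "('a::real_vector nov list \<Rightarrow> 'b::real_vector nov) \<Rightarrow> 'a list \<Rightarrow> 'b" where
  "reduction f xs = ncoeff (f (map nov_const xs)) 0 0"

text \<open>
  The maps on the completed bar complex are determined, by linearity and continuity, by their values on
  words over the real space; \<open>m_hat_word m k\<close> is the \<open>k\<close>-th summand of the differential on homogeneous words.
\<close>

definition m_hat_word ::
  "('a::real_vector nov list \<Rightarrow> 'a nov) \<Rightarrow> nat \<Rightarrow> int list \<Rightarrow> 'a list \<Rightarrow> 'a tensor nov" where
  "m_hat_word m k ns xs =
     (\<Sum>i | i + k \<le> length xs. ((-1) powi (\<Sum>j<i. ns ! j - 1)) *\<^sub>R
        nov_word (map nov_const (take i xs) @
                  m (map nov_const (take k (drop i xs))) #
                  map nov_const (drop (i + k) xs)))"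

definition bar_differential ::
  "(int \<Rightarrow> 'a::real_vector set) \<Rightarrow> ('a nov list \<Rightarrow> 'a nov) \<Rightarrow> 'a tensor nov \<Rightarrow> 'a tensor nov" where
  "bar_differential gr m = nov_extend (tensor_lift (homogeneous_extension gr
     (\<lambda>ns xs. \<Sum>k\<le>length xs. m_hat_word m k ns xs)))"

text \<open>
  A cutting of \<open>xs\<close> into consecutive, possibly empty, pieces is a list \<open>ps\<close> with \<open>concat ps = xs\<close>. There
  are infinitely many, and the sum converges because \<open>f\<^sub>0(1)\<close> has positive energy.
\<close>

definition bar_map :: "('a::real_vector nov list \<Rightarrow> 'b::real_vector nov) \<Rightarrow> 'a tensor nov \<Rightarrow> 'b tensor nov" where
  "bar_map f = nov_extend (tensor_lift (\<lambda>xs.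
     nov_sum (\<lambda>ps. nov_word (map (\<lambda>p. f (map nov_const p)) ps)) {ps. concat ps = xs}))"

definition filtered_Ainf_algebra ::
  "(int \<Rightarrow> 'a::real_vector set) \<Rightarrow> ('a nov list \<Rightarrow> 'a nov) \<Rightarrow> bool" where
  "filtered_Ainf_algebra gr m \<longleftrightarrow> graded_space gr \<and> filtered_maps gr gr 1 m \<and>
     (\<forall>x. bar_differential gr m (bar_differential gr m x) = 0)"

definition filtered_Ainf_hom ::
  "(int \<Rightarrow> 'a::real_vector set) \<Rightarrow> ('a nov list \<Rightarrow> 'a nov) \<Rightarrow>
   (int \<Rightarrow> 'b::real_vector set) \<Rightarrow> ('b nov list \<Rightarrow> 'b nov) \<Rightarrow> ('a nov list \<Rightarrow> 'b nov) \<Rightarrow> bool" where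
  "filtered_Ainf_hom gr1 m1 gr2 m2 f \<longleftrightarrow> filtered_maps gr1 gr2 0 f \<and>
     (\<forall>x. bar_map f (bar_differential gr1 m1 x) = bar_differential gr2 m2 (bar_map f x))"

definition gapping_monoid :: "(real \<times> int) set \<Rightarrow> bool" where
  "gapping_monoid G \<longleftrightarrow>
     (\<forall>(s, \<mu>)\<in>G. 0 \<le> s \<and> even \<mu>) \<and>
     0 \<in> G \<and> (\<forall>\<beta>\<in>G. \<forall>\<gamma>\<in>G. \<beta> + \<gamma> \<in> G) \<and>
     discrete (fst ` G) \<and> (\<forall>s. finite {\<mu>. (s, \<mu>) \<in> G}) \<and>
     G \<inter> {0} \<times> UNIV = {(0, 0)}"

text \<open>
  \<open>f\<^sub>k = \<Sum> T^s e^(\<mu>/2) f\<^sub>k\<^sub>,\<^sub>\<beta>\<close>, summed over \<open>\<beta> = (s, \<mu>)\<close> in \<open>G\<close>, as an identity of coefficients on words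
  over the real space.
\<close>

definition gapped :: "('a::real_vector nov list \<Rightarrow> 'b::real_vector nov) \<Rightarrow> bool" where
  "gapped f \<longleftrightarrow> (\<exists>G fb. gapping_monoid G \<and> (\<forall>\<beta>\<in>G. multilinear_words (fb \<beta>)) \<and>
     (\<forall>xs s q. ncoeff (f (map nov_const xs)) s q =
        (if (s, 2 * q) \<in> G then fb (s, 2 * q) xs else 0)))"


section \<open>The cyclic and symmetric subcomplexes\<close>

definition koszul_sign :: "(nat \<Rightarrow> nat) \<Rightarrow> int list \<Rightarrow> real" where
  "koszul_sign \<pi> ns = (\<Prod>(i, j) | i < j \<and> j < length ns \<and> \<pi> j < \<pi> i.
     (-1) powi ((ns ! \<pi> i - 1) * (ns ! \<pi> j - 1)))"

text \<open>
  For a family \<open>\<pi> k\<close> of permutations of \<open>{..<k}\<close>, acting on the words of length \<open>k\<close> for all \<open>k\<close> at once: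
  \<open>x\<^sub>0 \<otimes> \<dots> \<otimes> x\<^sub>k\<^sub>-\<^sub>1 \<mapsto> \<plusminus> x\<^bsub>\<pi> k 0\<^esub> \<otimes> \<dots> \<otimes> x\<^bsub>\<pi> k (k-1)\<^esub>\<close>.
\<close>

definition bar_permute ::
  "(int \<Rightarrow> 'a::real_vector set) \<Rightarrow> (nat \<Rightarrow> nat \<Rightarrow> nat) \<Rightarrow> 'a tensor nov \<Rightarrow> 'a tensor nov" where
  "bar_permute gr \<pi> = nov_map (tensor_lift (homogeneous_extension gr
     (\<lambda>ns xs. koszul_sign (\<pi> (length xs)) ns *\<^sub>R tword (permute_list (\<pi> (length xs)) xs))))"

text \<open>\<open>x\<^sub>0 \<otimes> \<dots> \<otimes> x\<^sub>k\<^sub>-\<^sub>1 \<mapsto> \<plusminus> x\<^sub>k\<^sub>-\<^sub>1 \<otimes> x\<^sub>0 \<otimes> \<dots> \<otimes> x\<^sub>k\<^sub>-\<^sub>2\<close>\<close>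

definition cyclic_generator :: "nat \<Rightarrow> nat \<Rightarrow> nat" where
  "cyclic_generator k i = (if i < k then (i + k - 1) mod k else i)"

text \<open>
  \<open>bar_permute\<close> preserves word length and acts coefficientwise, so an element is fixed iff all its
  coefficients and all their length components are: the fixed elements are the energy completion of the
  direct sum of the fixed submodules of the tensor powers. In \<open>bar_sym\<close> the permutations for different
  lengths are chosen independently, so each length component is fixed by the full symmetric group.
\<close>

definition bar_cyc :: "(int \<Rightarrow> 'a::real_vector set) \<Rightarrow> 'a tensor nov set" where
  "bar_cyc gr = {x. bar_permute gr cyclic_generator x = x}"

definition bar_sym :: "(int \<Rightarrow> 'a::real_vector set) \<Rightarrow> 'a tensor nov set" where
  "bar_sym gr = {x. \<forall>\<pi>. (\<forall>k. \<pi> k permutes {..<k}) \<longrightarrow> bar_permute gr \<pi> x = x}"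


section \<open>Cohomology\<close>

text \<open>
  Cocycles in \<open>A\<close> modulo \<open>d ` B\<close>. With \<open>A = B\<close> this is the total cohomology; with \<open>A\<close>, \<open>B\<close> the parts of
  degrees \<open>n\<close>, \<open>n - 1\<close> it is the cohomology in degree \<open>n\<close>.
\<close>

definition cocycles :: "'x set \<Rightarrow> ('x \<Rightarrow> 'x::ab_group_add) \<Rightarrow> 'x set" where
  "cocycles A d = {x\<in>A. d x = 0}"

definition cohomologous :: "'x set \<Rightarrow> 'x set \<Rightarrow> ('x \<Rightarrow> 'x::ab_group_add) \<Rightarrow> ('x \<times> 'x) set" where
  "cohomologous A B d = {(x, y). x \<in> cocycles A d \<and> y \<in> cocycles A d \<and> x - y \<in> d ` B}"

definition cohomology :: "'x set \<Rightarrow> 'x set \<Rightarrow> ('x \<Rightarrow> 'x::ab_group_add) \<Rightarrow> 'x set set" where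
  "cohomology A B d = cocycles A d // cohomologous A B d"

text \<open>
  The induced map \<open>[x] \<mapsto> [f x]\<close> is well defined and bijective; being induced by a linear map it is then
  an isomorphism.
\<close>

definition induces_cohomology_iso ::
  "'x set \<Rightarrow> 'x set \<Rightarrow> ('x \<Rightarrow> 'x::ab_group_add) \<Rightarrow>
   'y set \<Rightarrow> 'y set \<Rightarrow> ('y \<Rightarrow> 'y::ab_group_add) \<Rightarrow> ('x \<Rightarrow> 'y) \<Rightarrow> bool" where
  "induces_cohomology_iso A1 B1 d1 A2 B2 d2 f \<longleftrightarrow>
     d1 ` B1 \<subseteq> A1 \<and> d2 ` B2 \<subseteq> A2 \<and> f ` A1 \<subseteq> A2 \<and> f ` B1 \<subseteq> B2 \<and>
     (\<exists>\<Phi>. bij_betw \<Phi> (cohomology A1 B1 d1) (cohomology A2 B2 d2) \<and>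
       (\<forall>x\<in>cocycles A1 d1. \<Phi> (cohomologous A1 B1 d1 `` {x}) = cohomologous A2 B2 d2 `` {f x}))"

text \<open>
  For subcomplexes \<open>X1\<close>, \<open>X2\<close> of the two completed bar complexes: \<open>bar_map f\<close> induces isomorphisms of the
  total cohomologies and of the cohomologies in each degree.
\<close>

definition induces_bar_cohomology_iso ::
  "(int \<Rightarrow> 'a::real_vector set) \<Rightarrow> ('a nov list \<Rightarrow> 'a nov) \<Rightarrow> 'a tensor nov set \<Rightarrow>
   (int \<Rightarrow> 'b::real_vector set) \<Rightarrow> ('b nov list \<Rightarrow> 'b nov) \<Rightarrow> 'b tensor nov set \<Rightarrow>
   ('a nov list \<Rightarrow> 'b nov) \<Rightarrow> bool" where
  "induces_bar_cohomology_iso gr1 m1 X1 gr2 m2 X2 f \<longleftrightarrow>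
     induces_cohomology_iso X1 X1 (bar_differential gr1 m1) X2 X2 (bar_differential gr2 m2) (bar_map f) \<and>
     (\<forall>n. induces_cohomology_iso
        (X1 \<inter> bar_degree gr1 n) (X1 \<inter> bar_degree gr1 (n - 1)) (bar_differential gr1 m1)
        (X2 \<inter> bar_degree gr2 n) (X2 \<inter> bar_degree gr2 (n - 1)) (bar_differential gr2 m2) (bar_map f))"

end

theory Submission
  imports Defs "HOL-Combinatorics.Permutations"
begin

text \<open>
  The mapping cone of \<open>bar_map f\<close> is contracted by successive approximation. At energy 0 and up to
  tensors of smaller length the differential is the derivation extending \<open>\<delta> = m\<^sub>1\<close> on letters and
  \<open>bar_map f\<close> is the functorial extension of \<open>f\<^sub>1\<close>. Over the reals \<open>f\<^sub>1\<close> has a homotopy inverse \<open>g\<close>; the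
  derivation extending a homotopy \<open>\<delta> h + h \<delta> = 1 - p\<close>, with \<open>p\<close> an idempotent, has graded commutator with the
  differential equal to the number of non-harmonic letters, so dividing it by that number gives a homotopy
  for tensors that commutes with all signed permutations. It therefore restricts to the cyclic and
  symmetric tensors, and no averaging over groups is needed. The error of the resulting approximate
  contraction of the cone first lowers the word length and then, gappedness bounding the energy gaps away
  from 0, raises the energy by a fixed amount, so that the iteration converges.
\<close>

text \<open>Exactness of the cone gives injectivity and surjectivity from one computation, and its
  proof by a convergent series stays inside every subspace that the correction operators respect. No
  homotopy inverse of \<open>f\<close> as an A-infinity homomorphism is built: the tensor power of
  \<open>g\<close> is a chain map only up to shorter words and higher energy. The obstacle is
  equivariance. The usual homotopy on a tensor power, with \<open>p\<close> on the letters to one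
  side of the homotopy and the identity on the other side, depends on the order of the letters; a
  derivation does not. Counting non-harmonic letters requires idempotents on both sides,
  \<open>g f\<close> and \<open>f g\<close>, with zero differential on their images. Over a field
  \<open>g\<close> can be chosen with \<open>g f g = g\<close>, \<open>d1 g = 0\<close> and
  \<open>g d2 = 0\<close>. The homotopies of the two sides are unrelated to each other, so the entry
  of the error from the first algebra to the second need not shorten words. The opposite entry does.
  The length bounds on the two components are therefore staggered, and two rounds of the iteration
  shorten both.\<close>

lemma neg_one_powi: "(-1::real) powi k = (if even k then 1 else -1)"
  by (simp add: power_int_minus_left)

abbreviation sdeg :: "int list \<Rightarrow> int" where
  "sdeg ns \<equiv> (\<Sum>n\<leftarrow>ns. n - 1)"

section \<open>Calculus of multilinear functions of words\<close>

lemma multilinear_words_linear: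
  assumes "multilinear_words \<phi>"
  shows "linear (\<lambda>x. \<phi> (xs @ x # ys))"
  using assms by (auto intro!: linearI simp: multilinear_words_def)

lemma multilinear_words_linear_hd:
  assumes "multilinear_words \<phi>"
  shows "linear (\<lambda>x. \<phi> (x # ys))"
  using multilinear_words_linear[OF assms, of "[]"] by simp

lemma multilinear_words_context:
  assumes "multilinear_words \<phi>"
  shows "multilinear_words (\<lambda>xs. \<phi> (us @ xs @ vs))"
proof -
  have [simp]: "us @ (xs @ x # ys) @ vs = (us @ xs) @ x # (ys @ vs)" for xs x ys by simp
  show ?thesis using assms unfolding multilinear_words_def by (simp del: append_assoc)
qed

lemma multilinear_words_tl:
  assumes "multilinear_words \<phi>"
  shows "multilinear_words (\<lambda>xs. \<phi> (x # xs))"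
  using multilinear_words_context[OF assms, of "[x]" "[]"] by simp

lemma multilinear_words_compose:
  assumes "multilinear_words \<phi>" "linear A"
  shows "multilinear_words (\<lambda>xs. A (\<phi> xs))"
  using assms by (auto simp: multilinear_words_def linear_add linear_scale)

lemma multilinear_words_scale:
  assumes "multilinear_words \<phi>"
  shows "multilinear_words (\<lambda>xs. c (length xs) *\<^sub>R \<phi> xs)"
  using assms by (auto simp: multilinear_words_def algebra_simps)

lemma multilinear_words_sum:
  assumes "\<And>i. i \<in> I \<Longrightarrow> multilinear_words (\<phi> i)"
  shows "multilinear_words (\<lambda>xs. \<Sum>i\<in>I. \<phi> i xs)"
  using assms by (simp add: multilinear_words_def sum.distrib scaleR_sum_right)

text \<open>Multilinearity compares words of one length only, so a formula may depend on the length
  in any way. This handles sums whose index set is determined by the length of the word.\<close>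

lemma multilinear_words_length_cong:
  assumes "\<And>n. multilinear_words (\<phi> n)" "\<And>xs. \<psi> xs = \<phi> (length xs) xs"
  shows "multilinear_words \<psi>"
  using assms by (simp add: multilinear_words_def)

lemma multilinear_words_if:
  assumes "multilinear_words \<phi>"
  shows "multilinear_words (\<lambda>xs. if P (length xs) then \<phi> xs else 0)"
  using assms by (auto simp: multilinear_words_def)

lemma multilinear_words_zero:
  assumes "multilinear_words \<phi>" "0 \<in> set xs"
  shows "\<phi> xs = 0"
proof -
  obtain us vs where "xs = us @ 0 # vs" using assms(2) by (meson split_list)
  then show ?thesis using linear_0[OF multilinear_words_linear[OF assms(1)]] by simp
qed

lemma multilinear_words_map:
  assumes "multilinear_words \<phi>" "linear A"
  shows "multilinear_words (\<lambda>xs. \<phi> (map A xs))"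
  using assms by (auto simp: multilinear_words_def linear_add linear_scale)

text \<open>Naming the varied letter by its position, instead of splitting the word around it, is
  the form that is stable under permuting and cutting words.\<close>

lemma multilinear_words_iff_update:
  "multilinear_words \<phi> \<longleftrightarrow> (\<forall>xs. \<forall>i<length xs. linear (\<lambda>x. \<phi> (xs[i := x])))"
proof
  assume *: "multilinear_words \<phi>"
  show "\<forall>xs. \<forall>i<length xs. linear (\<lambda>x. \<phi> (xs[i := x]))"
  proof (intro allI impI)
    fix xs :: "'a list" and i assume "i < length xs"
    then show "linear (\<lambda>x. \<phi> (xs[i := x]))"
      using multilinear_words_linear[OF *, of "take i xs" "drop (Suc i) xs"]
      by (simp add: upd_conv_take_nth_drop)
  qed
next
  assume *: "\<forall>xs. \<forall>i<length xs. linear (\<lambda>x. \<phi> (xs[i := x]))"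
  have "linear (\<lambda>x. \<phi> (xs @ x # ys))" for xs ys
    using *[rule_format, of "length xs" "xs @ undefined # ys"] by simp
  note lin = this
  show "multilinear_words \<phi>"
    by (simp add: multilinear_words_def linear_add[OF lin] linear_scale[OF lin])
qed

lemma permute_list_update:
  assumes "\<pi> permutes {..<length xs}" "i < length xs"
  shows "permute_list \<pi> (xs[i := x]) = (permute_list \<pi> xs)[inv \<pi> i := x]"
proof (rule nth_equalityI)
  fix k assume "k < length (permute_list \<pi> (xs[i := x]))"
  then have k: "k < length xs" by simp
  have "\<pi> k < length xs" using k assms(1) permutes_in_image[of \<pi> "{..<length xs}" k] by simp
  moreover have "\<pi> k = i \<longleftrightarrow> inv \<pi> i = k" using assms(1) by (metis permutes_inverses)
  ultimately show "permute_list \<pi> (xs[i := x]) ! k = (permute_list \<pi> xs)[inv \<pi> i := x] ! k"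
    using k assms by (auto simp: permute_list_nth nth_list_update)
qed simp

lemma multilinear_words_permute:
  assumes "multilinear_words \<phi>" "\<And>k. \<pi> k permutes {..<k}"
  shows "multilinear_words (\<lambda>xs. \<phi> (permute_list (\<pi> (length xs)) xs))"
  unfolding multilinear_words_iff_update
proof (intro allI impI)
  fix xs :: "'a list" and i assume i: "i < length xs"
  have "inv (\<pi> (length xs)) i < length xs"
    using permutes_in_image[OF permutes_inv[OF assms(2)], of "length xs" i] i by simp
  then show "linear (\<lambda>x. \<phi> (permute_list (\<pi> (length (xs[i := x]))) (xs[i := x])))"
    using i assms(1) permute_list_update[OF assms(2), of i xs]
    by (simp add: multilinear_words_iff_update)
qed

section \<open>Linear maps on the tensor algebra\<close>

lemma lookup_scaleR:
  fixes p :: "'a \<Rightarrow>\<^sub>0 real"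
  shows "Poly_Mapping.lookup (r *\<^sub>R p) ys = r * Poly_Mapping.lookup p ys"
proof -
  have "finite {i. r *\<^sub>R Poly_Mapping.lookup p i \<noteq> 0}"
    by (rule finite_subset[OF _ finite_keys[of p]]) (auto simp: in_keys_iff)
  then show ?thesis by (simp add: scaleR_poly_mapping_def Abs_poly_mapping_inverse)
qed

lemma free_space_expand:
  fixes p :: "'a free_space"
  shows "p = (\<Sum>xs\<in>Poly_Mapping.keys p. Poly_Mapping.lookup p xs *\<^sub>R free_word xs)"
proof (rule poly_mapping_eqI)
  fix ys
  show "Poly_Mapping.lookup p ys =
    Poly_Mapping.lookup (\<Sum>xs\<in>Poly_Mapping.keys p. Poly_Mapping.lookup p xs *\<^sub>R free_word xs) ys"
    by (simp add: lookup_sum lookup_scaleR free_word_def lookup_single when_def in_keys_iff if_distrib sum.delta cong: if_cong)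
qed

text \<open>\<open>tensor_lift\<close> evaluates this extension at a chosen representative of a
  tensor. For multilinear \<open>\<phi>\<close> it kills the relations, so the choice does not
  matter.\<close>

definition free_lift :: "('a list \<Rightarrow> 'w::real_vector) \<Rightarrow> 'a free_space \<Rightarrow> 'w" where
  "free_lift \<phi> p = (\<Sum>xs\<in>Poly_Mapping.keys p. Poly_Mapping.lookup p xs *\<^sub>R \<phi> xs)"

lemma free_lift_superset:
  assumes "finite S" "Poly_Mapping.keys p \<subseteq> S"
  shows "free_lift \<phi> p = (\<Sum>xs\<in>S. Poly_Mapping.lookup p xs *\<^sub>R \<phi> xs)"
  unfolding free_lift_def using assms by (intro sum.mono_neutral_left) (auto simp: in_keys_iff)

lemma linear_free_lift: "linear (free_lift \<phi>)"
proof (rule linearI)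
  fix p q :: "'a free_space" and r :: real
  show "free_lift \<phi> (p + q) = free_lift \<phi> p + free_lift \<phi> q"
    using Poly_Mapping.keys_add[of p q]
    by (simp add: free_lift_superset[of "Poly_Mapping.keys p \<union> Poly_Mapping.keys q"]
        lookup_add scaleR_add_left sum.distrib)
  have "Poly_Mapping.keys (r *\<^sub>R p) \<subseteq> Poly_Mapping.keys p"
    by (auto simp: in_keys_iff lookup_scaleR)
  then show "free_lift \<phi> (r *\<^sub>R p) = r *\<^sub>R free_lift \<phi> p"
    by (simp add: free_lift_superset[of "Poly_Mapping.keys p"] lookup_scaleR scaleR_sum_right)
qed

lemma free_lift_relations:
  assumes "multilinear_words \<phi>" "p \<in> span tensor_relations"
  shows "free_lift \<phi> p = 0"
proof -
  have word: "free_lift \<phi> (free_word xs) = \<phi> xs" for xs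
    by (simp add: free_lift_def free_word_def)
  note [simp] = linear_diff[OF linear_free_lift] linear_scale[OF linear_free_lift] word
  have "free_lift \<phi> p = 0" if "p \<in> tensor_relations" for p
    using that assms(1) by (auto simp: tensor_relations_def multilinear_words_def)
  then show ?thesis using linear_eq_0_on_span[OF linear_free_lift _ assms(2)] by blast
qed

lemma tensor_lift_conv: "tensor_lift \<phi> t = free_lift \<phi> (rep_tensor t)"
  by (simp add: tensor_lift_def free_lift_def Let_def)

lemma tensor_eq_rep_abs: "tensor_eq (rep_tensor (abs_tensor p)) p"
  by (metis Quotient3_abs_rep Quotient3_tensor tensor.abs_eq_iff)

lemma tensor_lift_abs:
  assumes "multilinear_words \<phi>"
  shows "tensor_lift \<phi> (abs_tensor p) = free_lift \<phi> p"
proof -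
  have "free_lift \<phi> (rep_tensor (abs_tensor p) - p) = 0"
    using free_lift_relations[OF assms] tensor_eq_rep_abs by (auto simp: tensor_eq_def)
  then show ?thesis by (simp add: tensor_lift_conv linear_diff[OF linear_free_lift])
qed

lemma linear_abs_tensor: "linear abs_tensor"
  by (rule linearI) (simp_all add: plus_tensor.abs_eq scaleR_tensor.abs_eq)

lemma tensor_abs_cases: obtains p where "t = abs_tensor p"
  by (metis Quotient3_abs_rep Quotient3_tensor)

lemma linear_tensor_lift:
  assumes "multilinear_words \<phi>"
  shows "linear (tensor_lift \<phi>)"
proof (rule linearI)
  fix t u :: "'a tensor" and r :: real
  obtain p q where pq: "t = abs_tensor p" "u = abs_tensor q" by (metis tensor_abs_cases)
  show "tensor_lift \<phi> (t + u) = tensor_lift \<phi> t + tensor_lift \<phi> u"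
    using assms by (simp add: pq plus_tensor.abs_eq tensor_lift_abs linear_add[OF linear_free_lift])
  show "tensor_lift \<phi> (r *\<^sub>R t) = r *\<^sub>R tensor_lift \<phi> t"
    using assms by (simp add: pq scaleR_tensor.abs_eq tensor_lift_abs linear_scale[OF linear_free_lift])
qed

lemma span_tword: "t \<in> span (range tword)"
proof -
  obtain p where "t = abs_tensor p" by (rule tensor_abs_cases)
  then have "t = abs_tensor (\<Sum>xs\<in>Poly_Mapping.keys p. Poly_Mapping.lookup p xs *\<^sub>R free_word xs)"
    using free_space_expand[of p] by (rule back_subst)
  also have "\<dots> = (\<Sum>xs\<in>Poly_Mapping.keys p. Poly_Mapping.lookup p xs *\<^sub>R tword xs)"
    by (simp only: linear_sum[OF linear_abs_tensor] linear_scale[OF linear_abs_tensor] tword.abs_eq)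
  finally show ?thesis
    by (elim ssubst) (intro span_sum span_scale span_base rangeI)
qed

text \<open>One letter at a time is expanded in its spanning set, by multilinearity. The prefix
  \<open>us\<close> collects the letters that have already been replaced.\<close>

lemma tword_in_span_letters:
  assumes "list_all2 (\<lambda>A x. x \<in> span A) As xs"
  shows "tword (us @ xs) \<in> span {tword (us @ ys) |ys. list_all2 (\<lambda>A y. y \<in> A) As ys}"
  using assms
proof (induction As xs arbitrary: us rule: list_all2_induct)
  case Nil
  then show ?case by (auto intro: span_base)
next
  case (Cons A As x xs)
  let ?S = "span {tword (us @ ys) |ys. list_all2 (\<lambda>A y. y \<in> A) (A # As) ys}"
  have lin: "linear (\<lambda>y. tword (us @ y # xs))"
    by (rule multilinear_words_linear[OF multilinear_words_tword])
  have "tword (us @ y # xs) \<in> ?S" if "y \<in> A" for y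
  proof -
    have "tword ((us @ [y]) @ xs) \<in> span {tword ((us @ [y]) @ ys) |ys. list_all2 (\<lambda>A y. y \<in> A) As ys}"
      by (rule Cons.IH)
    moreover have "{tword ((us @ [y]) @ ys) |ys. list_all2 (\<lambda>A y. y \<in> A) As ys} \<subseteq>
      {tword (us @ ys) |ys. list_all2 (\<lambda>A y. y \<in> A) (A # As) ys}"
    proof clarify
      fix ys assume "list_all2 (\<lambda>A y. y \<in> A) As ys"
      with that show "\<exists>zs. tword ((us @ [y]) @ ys) = tword (us @ zs) \<and> list_all2 (\<lambda>A y. y \<in> A) (A # As) zs"
        by (intro exI[of _ "y # ys"]) simp
    qed
    ultimately show ?thesis using span_mono by (simp, blast)
  qed
  then have "(\<lambda>y. tword (us @ y # xs)) ` span A \<subseteq> ?S"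
    unfolding linear_span_image[OF lin, symmetric] by (intro span_minimal) auto
  then show ?case using Cons.hyps by blast
qed

lemma linear_eq_on_words:
  assumes "linear A" "linear B" "\<And>xs. A (tword xs) = B (tword xs)"
  shows "A t = B t"
  by (rule linear_eq_on_span[OF assms(1,2) _ span_tword]) (auto simp: assms(3))

section \<open>Gradings\<close>

context
  fixes gr :: "int \<Rightarrow> 'a::real_vector set"
  assumes gr: "graded_space gr"
begin

private definition "dec x u \<longleftrightarrow>
  finite {n. u n \<noteq> 0} \<and> (\<forall>n. u n \<in> gr n) \<and> x = (\<Sum>n | u n \<noteq> 0. u n)"

lemma graded_subspace: "subspace (gr n)"
  using gr by (simp add: graded_space_def)

private lemma dec_hcomp: "dec x (\<lambda>n. hcomp gr n x)"
proof -
  have "\<exists>!u. dec x u" using gr by (simp add: graded_space_def dec_def)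
  from theI'[OF this] show ?thesis by (simp add: hcomp_def dec_def)
qed

private lemma dec_unique: "dec x u \<Longrightarrow> hcomp gr n x = u n"
proof -
  assume "dec x u"
  moreover have "\<exists>!u. dec x u" using gr by (simp add: graded_space_def dec_def)
  ultimately show ?thesis using dec_hcomp by (metis (mono_tags))
qed

lemma finite_hcomp: "finite {n. hcomp gr n x \<noteq> 0}"
  and hcomp_in: "hcomp gr n x \<in> gr n"
  and sum_hcomp: "(\<Sum>n | hcomp gr n x \<noteq> 0. hcomp gr n x) = x"
  using dec_hcomp[of x] by (auto simp: dec_def)

lemma sum_hcomp_superset:
  assumes "finite S" "{n. hcomp gr n x \<noteq> 0} \<subseteq> S"
  shows "(\<Sum>n\<in>S. hcomp gr n x) = x"
  using sum.mono_neutral_left[OF assms, of "\<lambda>n. hcomp gr n x"] sum_hcomp[of x] by auto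

lemma hcomp_unique:
  assumes "finite S" "\<And>n. u n \<in> gr n" "\<And>n. n \<notin> S \<Longrightarrow> u n = 0" "x = (\<Sum>n\<in>S. u n)"
  shows "hcomp gr n x = u n"
proof -
  have sub: "{n. u n \<noteq> 0} \<subseteq> S" using assms(3) by auto
  have "(\<Sum>n\<in>S. u n) = (\<Sum>n | u n \<noteq> 0. u n)"
    by (rule sum.mono_neutral_right[OF assms(1) sub]) auto
  then have "dec x u" using assms finite_subset[OF sub] by (auto simp: dec_def)
  then show ?thesis by (rule dec_unique)
qed

lemma linear_hcomp: "linear (hcomp gr n)"
proof (rule linearI)
  fix x y :: 'a and r :: real
  let ?S = "{n. hcomp gr n x \<noteq> 0} \<union> {n. hcomp gr n y \<noteq> 0}"
  have fin: "finite ?S" using finite_hcomp by simp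
  show "hcomp gr n (x + y) = hcomp gr n x + hcomp gr n y"
    by (rule hcomp_unique[OF fin])
      (auto simp: sum.distrib sum_hcomp_superset[OF fin] intro: subspace_add[OF graded_subspace] hcomp_in)
  show "hcomp gr n (r *\<^sub>R x) = r *\<^sub>R hcomp gr n x"
    by (rule hcomp_unique[OF fin])
      (auto simp: scaleR_sum_right[symmetric] sum_hcomp_superset[OF fin]
        intro: subspace_scale[OF graded_subspace] hcomp_in)
qed

lemma hcomp_homogeneous:
  assumes "x \<in> gr n"
  shows "hcomp gr m x = (if m = n then x else 0)"
  by (rule hcomp_unique[of "{n}"]) (auto simp: assms subspace_0[OF graded_subspace])

lemma hcomp_support_homogeneous: "x \<in> gr n \<Longrightarrow> {m. hcomp gr m x \<noteq> 0} = (if x = 0 then {} else {n})"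
  by (auto simp: hcomp_homogeneous)

lemma homogeneous_extension_Cons:
  "homogeneous_extension gr F (x # xs) =
    (\<Sum>n | hcomp gr n x \<noteq> 0. homogeneous_extension gr (\<lambda>ns ys. F (n # ns) (hcomp gr n x # ys)) xs)"
proof -
  let ?Z = "\<lambda>xs. {ns. list_all2 (\<lambda>n x. hcomp gr n x \<noteq> 0) ns xs}"
  have fin: "finite (?Z xs)" for xs
  proof (induction xs)
    case (Cons x xs)
    have "?Z (x # xs) = (\<lambda>(n, ns). n # ns) ` ({n. hcomp gr n x \<noteq> 0} \<times> ?Z xs)"
      by (auto simp: list_all2_Cons2 image_iff)
    then show ?case using Cons finite_hcomp by simp
  qed simp
  have "?Z (x # xs) = (\<lambda>(n, ns). n # ns) ` ({n. hcomp gr n x \<noteq> 0} \<times> ?Z xs)"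
    by (auto simp: list_all2_Cons2 image_iff)
  then have "homogeneous_extension gr F (x # xs) =
    (\<Sum>(n, ns)\<in>{n. hcomp gr n x \<noteq> 0} \<times> ?Z xs. F (n # ns) (hcomp gr n x # map2 (hcomp gr) ns xs))"
    unfolding homogeneous_extension_def
    by (subst \<open>?Z (x # xs) = _\<close>, subst sum.reindex) (auto simp: inj_on_def intro!: sum.cong)
  also have "\<dots> = (\<Sum>n | hcomp gr n x \<noteq> 0. \<Sum>ns\<in>?Z xs. F (n # ns) (hcomp gr n x # map2 (hcomp gr) ns xs))"
    by (rule sum.cartesian_product[symmetric])
  finally show ?thesis by (simp add: homogeneous_extension_def)
qed

lemma homogeneous_extension_Nil: "homogeneous_extension gr F [] = F [] []"
  by (simp add: homogeneous_extension_def)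

text \<open>The range of summation depends on \<open>x\<close>; both sides are compared over a
  common finite set of degrees, the extra terms being zero since each \<open>G n\<close> is
  linear.\<close>

lemma linear_sum_hcomp:
  assumes "\<And>n. linear (G n)"
  shows "linear (\<lambda>x. \<Sum>n | hcomp gr n x \<noteq> 0. G n (hcomp gr n x))"
proof -
  have *: "(\<Sum>n | hcomp gr n x \<noteq> 0. G n (hcomp gr n x)) = (\<Sum>n\<in>S. G n (hcomp gr n x))"
    if "finite S" "{n. hcomp gr n x \<noteq> 0} \<subseteq> S" for S x
    using that by (intro sum.mono_neutral_left) (auto simp: linear_0[OF assms])
  show ?thesis
  proof (rule linearI)
    fix x y :: 'a and r :: real
    let ?S = "{n. hcomp gr n x \<noteq> 0} \<union> {n. hcomp gr n y \<noteq> 0}"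
    have fin: "finite ?S" using finite_hcomp by simp
    note [simp] = linear_add[OF linear_hcomp] linear_scale[OF linear_hcomp]
      linear_add[OF assms] linear_scale[OF assms]
    show "(\<Sum>n | hcomp gr n (x + y) \<noteq> 0. G n (hcomp gr n (x + y))) =
      (\<Sum>n | hcomp gr n x \<noteq> 0. G n (hcomp gr n x)) + (\<Sum>n | hcomp gr n y \<noteq> 0. G n (hcomp gr n y))"
      by (subst (1 2 3) *[OF fin]) (auto simp: sum.distrib)
    show "(\<Sum>n | hcomp gr n (r *\<^sub>R x) \<noteq> 0. G n (hcomp gr n (r *\<^sub>R x))) =
      r *\<^sub>R (\<Sum>n | hcomp gr n x \<noteq> 0. G n (hcomp gr n x))"
      by (subst (1 2) *[OF fin]) (auto simp: scaleR_sum_right)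
  qed
qed

lemma multilinear_homogeneous_extension:
  assumes "\<And>ns. multilinear_words (F ns)"
  shows "multilinear_words (homogeneous_extension gr F)"
proof -
  have "homogeneous_extension gr F (xs @ (x + y) # ys) =
      homogeneous_extension gr F (xs @ x # ys) + homogeneous_extension gr F (xs @ y # ys)
    \<and> homogeneous_extension gr F (xs @ (r *\<^sub>R x) # ys) = r *\<^sub>R homogeneous_extension gr F (xs @ x # ys)"
    for xs x y ys r
    using assms
  proof (induction xs arbitrary: F)
    case Nil
    have "linear (\<lambda>x. homogeneous_extension gr (\<lambda>ns zs. F (n # ns) (x # zs)) ys)" for n
      unfolding homogeneous_extension_def
      by (rule linear_compose_sum) (use multilinear_words_linear_hd[OF Nil] in auto)
    then have "linear (\<lambda>x. homogeneous_extension gr F (x # ys))"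
      unfolding homogeneous_extension_Cons by (rule linear_sum_hcomp)
    note lin = this
    show ?case by (simp add: linear_add[OF lin] linear_scale[OF lin])
  next
    case (Cons z xs)
    have "multilinear_words (\<lambda>zs. F (n # ns) (hcomp gr n z # zs))" for n ns
      by (rule multilinear_words_tl[OF Cons.prems])
    from Cons.IH[OF this] show ?case
      by (simp add: homogeneous_extension_Cons sum.distrib scaleR_sum_right)
  qed
  then show ?thesis by (simp add: multilinear_words_def)
qed

lemma homogeneous_extension_homogeneous:
  assumes "list_all2 (\<lambda>n x. x \<in> gr n) ns xs" "\<And>ns. multilinear_words (F ns)"
  shows "homogeneous_extension gr F xs = F ns xs"
  using assms
proof (induction ns xs arbitrary: F rule: list_all2_induct)
  case Nil
  then show ?case by (simp add: homogeneous_extension_Nil)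
next
  case (Cons n ns x xs)
  have "multilinear_words (\<lambda>zs. F (m # ns) (hcomp gr m x # zs))" for m ns
    by (rule multilinear_words_tl[OF Cons.prems])
  note IH = Cons.IH[OF this]
  have "homogeneous_extension gr F (x # xs) =
      (\<Sum>m\<in>(if x = 0 then {} else {n}). F (m # ns) (hcomp gr m x # xs))"
    unfolding homogeneous_extension_Cons IH hcomp_support_homogeneous[OF Cons.hyps(1)] ..
  \<comment> \<open>The letter 0 lies in every degree but has empty support, so the sum is empty;
    the right-hand side vanishes as well, by multilinearity of \<open>F\<close>.\<close>
  then show ?case using multilinear_words_zero[OF Cons.prems, of "0 # xs"] Cons.hyps
    by (simp add: hcomp_homogeneous)
qed

lemma graded_span: "x \<in> span (\<Union>n. gr n)"
proof -
  have "(\<Sum>n | hcomp gr n x \<noteq> 0. hcomp gr n x) \<in> span (\<Union>n. gr n)"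
    using hcomp_in by (intro span_sum span_base) auto
  then show ?thesis by (simp only: sum_hcomp)
qed

end

abbreviation hom_word :: "(int \<Rightarrow> 'a set) \<Rightarrow> int list \<Rightarrow> 'a list \<Rightarrow> bool" where
  "hom_word gr ns xs \<equiv> list_all2 (\<lambda>n x. x \<in> gr n) ns xs"

lemma span_hom_words:
  assumes "graded_space gr"
  shows "tword xs \<in> span {tword ys |ns ys. hom_word gr ns ys \<and> length ys = length xs}"
proof -
  have "list_all2 (\<lambda>A x. x \<in> span A) (replicate (length xs) (\<Union>n. gr n)) xs"
    by (auto simp: list_all2_conv_all_nth graded_span[OF assms])
  from tword_in_span_letters[OF this, of "[]"]
  have "tword xs \<in> span {tword ys |ys. list_all2 (\<lambda>A y. y \<in> A) (replicate (length xs) (\<Union>n. gr n)) ys}"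
    by simp
  also have "\<dots> \<subseteq> span {tword ys |ns ys. hom_word gr ns ys \<and> length ys = length xs}"
  proof (rule span_mono, clarify)
    fix ys assume *: "list_all2 (\<lambda>A y. y \<in> A) (replicate (length xs) (\<Union>n. gr n)) ys"
    then have "\<forall>y\<in>set ys. \<exists>n. y \<in> gr n" by (auto simp: list_all2_conv_all_nth in_set_conv_nth)
    then obtain d where "\<forall>y\<in>set ys. y \<in> gr (d y)" by metis
    then have "hom_word gr (map d ys) ys" by (auto simp: list_all2_conv_all_nth)
    then show "\<exists>ns zs. tword ys = tword zs \<and> hom_word gr ns zs \<and> length zs = length xs"
      using list_all2_lengthD[OF *] by (intro exI[of _ "map d ys"] exI[of _ ys]) simp
  qed
  finally show ?thesis .
qed

lemma linear_eq_on_hom_words: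
  assumes "graded_space gr" "linear A" "linear B"
    "\<And>ns xs. hom_word gr ns xs \<Longrightarrow> A (tword xs) = B (tword xs)"
  shows "A t = B t"
proof (rule linear_eq_on_words[OF assms(2,3)])
  fix xs
  show "A (tword xs) = B (tword xs)"
    by (rule linear_eq_on_span[OF assms(2,3) _ span_hom_words[OF assms(1), of xs]]) (auto simp: assms(4))
qed

definition hext :: "(int \<Rightarrow> 'a::real_vector set) \<Rightarrow> (int list \<Rightarrow> 'a list \<Rightarrow> 'w::real_vector) \<Rightarrow> 'a tensor \<Rightarrow> 'w" where
  "hext gr F = tensor_lift (homogeneous_extension gr F)"

lemma linear_hext:
  assumes "graded_space gr" "\<And>ns. multilinear_words (F ns)"
  shows "linear (hext gr F)"
  unfolding hext_def by (intro linear_tensor_lift multilinear_homogeneous_extension assms)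

lemma hext_tword:
  assumes "graded_space gr" "\<And>ns. multilinear_words (F ns)" "hom_word gr ns xs"
  shows "hext gr F (tword xs) = F ns xs"
  using assms by (simp add: hext_def tensor_lift_tword multilinear_homogeneous_extension
      homogeneous_extension_homogeneous)

section \<open>Maps between energy completions\<close>

lemma ncoeff_nov_const: "ncoeff (nov_const v) s q = (if s = 0 \<and> q = 0 then v else 0)"
  by (simp add: nov_const.rep_eq)

lemma energy_ge_0: "x \<in> energy_ge 0"
  by (simp add: energy_ge_def ncoeff_neg)

lemma energy_ge_eqI:
  assumes "\<And>E. x - y \<in> energy_ge E"
  shows "x = y"
proof (rule nov_eqI)
  fix s q
  have "x - y \<in> energy_ge (s + 1)" by (rule assms)
  then show "ncoeff x s q = ncoeff y s q" by (simp add: energy_ge_def)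
qed

lemma subspace_energy_ge: "subspace (energy_ge E)"
  by (auto simp: subspace_def energy_ge_def)

lemma energy_ge_mono: "E \<le> E' \<Longrightarrow> energy_ge E' \<subseteq> energy_ge E"
  by (auto simp: energy_ge_def)

lemma ncoeff_sum: "ncoeff (\<Sum>i\<in>I. x i) s q = (\<Sum>i\<in>I. ncoeff (x i) s q)"
  by (induction I rule: infinite_finite_induct) auto

lemma linear_ncoeff: "linear (\<lambda>x. ncoeff x s q)"
  by (rule linearI) simp_all

lemma ncoeff_nov_extend:
  assumes "D 0 = 0" "finite A" "{(s', q'). s' \<le> s \<and> ncoeff x s' q' \<noteq> 0} \<subseteq> A"
  shows "ncoeff (nov_extend D x) s q = (\<Sum>(s', q')\<in>A. ncoeff (D (ncoeff x s' q')) (s - s') (q - q'))"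
  unfolding nov_extend.rep_eq
proof (rule sum.mono_neutral_left[OF assms(2,3)])
  have "ncoeff (D (ncoeff x a b)) (s - a) (q - b) = 0" if "a \<le> s \<longrightarrow> ncoeff x a b = 0" for a b
    using that assms(1) by (cases "a \<le> s") (simp_all add: ncoeff_neg)
  then show "\<forall>i\<in>A - {(s', q'). s' \<le> s \<and> ncoeff x s' q' \<noteq> 0}.
      (case i of (s', q') \<Rightarrow> ncoeff (D (ncoeff x s' q')) (s - s') (q - q')) = 0"
    by (simp add: split_beta)
qed

lemma linear_nov_extend:
  assumes "linear D"
  shows "linear (nov_extend D)"
proof (rule linearI)
  fix x y :: "'a nov" and r :: real
  note D0 = linear_0[OF assms]
  show "nov_extend D (x + y) = nov_extend D x + nov_extend D y"
  proof (rule nov_eqI)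
    fix s q
    let ?A = "{(s', q'). s' \<le> s \<and> ncoeff x s' q' \<noteq> 0} \<union> {(s', q'). s' \<le> s \<and> ncoeff y s' q' \<noteq> 0}"
    have "finite ?A" by (intro finite_UnI finite.insertI finite_ncoeff)
    note * = ncoeff_nov_extend[where D = D and A = ?A, OF D0 this]
    show "ncoeff (nov_extend D (x + y)) s q = ncoeff (nov_extend D x + nov_extend D y) s q"
      by (subst ncoeff_simps, subst (1 2 3) *)
        (auto simp: linear_add[OF assms] sum.distrib[symmetric] intro!: sum.cong)
  qed
  show "nov_extend D (r *\<^sub>R x) = r *\<^sub>R nov_extend D x"
  proof (rule nov_eqI)
    fix s q
    note * = ncoeff_nov_extend[where D = D and A = "{(s', q'). s' \<le> s \<and> ncoeff x s' q' \<noteq> 0}", OF D0 finite_ncoeff]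
    show "ncoeff (nov_extend D (r *\<^sub>R x)) s q = ncoeff (r *\<^sub>R nov_extend D x) s q"
      by (subst ncoeff_simps, subst (1 2) *)
        (auto simp: linear_scale[OF assms] scaleR_sum_right intro!: sum.cong)
  qed
qed

lemma nov_extend_const:
  assumes "D 0 = 0"
  shows "nov_extend D (nov_const v) = D v"
proof (rule nov_eqI)
  fix s q
  show "ncoeff (nov_extend D (nov_const v)) s q = ncoeff (D v) s q"
    by (subst ncoeff_nov_extend[of _ "{(0, 0)}"])
      (auto simp: assms ncoeff_nov_const split: if_splits)
qed

lemma ncoeff_nov_map:
  assumes "linear g"
  shows "ncoeff (nov_map g x) s q = g (ncoeff x s q)"
proof -
  let ?A = "insert (s, q) {(s', q'). s' \<le> s \<and> ncoeff x s' q' \<noteq> 0}"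
  have fin: "finite ?A" by (intro finite_UnI finite.insertI finite_ncoeff)
  have z: "(\<lambda>v. nov_const (g v)) 0 = 0"
    by (auto intro!: nov_eqI simp: linear_0[OF assms] ncoeff_nov_const)
  have "ncoeff (nov_map g x) s q =
      (\<Sum>(s', q')\<in>?A. ncoeff (nov_const (g (ncoeff x s' q'))) (s - s') (q - q'))"
    unfolding nov_map_def by (rule ncoeff_nov_extend[where D = "\<lambda>v. nov_const (g v)", OF z fin]) auto
  also have "\<dots> = (\<Sum>a\<in>{(s, q)}. case a of (s', q') \<Rightarrow>
      ncoeff (nov_const (g (ncoeff x s' q'))) (s - s') (q - q'))"
    by (rule sum.mono_neutral_right[OF fin]) (auto simp: ncoeff_nov_const split: if_splits)
  finally show ?thesis by (simp add: ncoeff_nov_const)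
qed

lemma linear_nov_map:
  assumes "linear g"
  shows "linear (nov_map g)"
  by (rule linearI; rule nov_eqI) (simp_all add: ncoeff_nov_map[OF assms] linear_add[OF assms] linear_scale[OF assms])

text \<open>All spaces of the proof have this form. \<open>U\<close> is constant in \<open>q\<close>
  for the full, cyclic and symmetric complexes; the part of degree \<open>n\<close> requires degree
  \<open>n - 2 * q\<close> at \<open>e^q\<close>, whence the dependence on \<open>q\<close>.\<close>

definition coeffs_in :: "(int \<Rightarrow> 'v::real_vector set) \<Rightarrow> 'v nov set" where
  "coeffs_in U = {x. \<forall>s q. ncoeff x s q \<in> U q}"

lemma subspace_coeffs_in:
  assumes "\<And>q. subspace (U q)"
  shows "subspace (coeffs_in U)"
  using assms by (auto simp: coeffs_in_def subspace_def)

lemma nov_extend_coeffs_in: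
  assumes "\<And>q. subspace (U' q)" "\<And>q v. v \<in> U q \<Longrightarrow> D v \<in> coeffs_in (\<lambda>q'. U' (q + q'))" "x \<in> coeffs_in U"
  shows "nov_extend D x \<in> coeffs_in U'"
proof -
  have "ncoeff (D (ncoeff x s' q')) (s - s') (q - q') \<in> U' q" for s s' q q'
  proof -
    have "D (ncoeff x s' q') \<in> coeffs_in (\<lambda>q''. U' (q' + q''))"
      using assms(2,3) by (simp add: coeffs_in_def)
    then have "ncoeff (D (ncoeff x s' q')) (s - s') (q - q') \<in> U' (q' + (q - q'))"
      unfolding coeffs_in_def by blast
    then show ?thesis by simp
  qed
  then show ?thesis
    unfolding coeffs_in_def mem_Collect_eq nov_extend.rep_eq
    by (intro allI subspace_sum[OF assms(1)]) (simp add: split_beta)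
qed

text \<open>A principal symbol for the energy filtration: \<open>A\<close> differs from the
  coefficientwise action of \<open>A0\<close> by terms that gain energy at least
  \<open>e\<close>.\<close>

definition leading_part :: "real \<Rightarrow> ('u::real_vector nov \<Rightarrow> 'v::real_vector nov) \<Rightarrow> ('u \<Rightarrow> 'v) \<Rightarrow> bool" where
  "leading_part e A A0 \<longleftrightarrow>
     (\<forall>E x s q. x \<in> energy_ge E \<longrightarrow> s < E + e \<longrightarrow> ncoeff (A x) s q = A0 (ncoeff x s q))"

lemma leading_partD:
  "leading_part e A A0 \<Longrightarrow> x \<in> energy_ge E \<Longrightarrow> s < E + e \<Longrightarrow> ncoeff (A x) s q = A0 (ncoeff x s q)"
  unfolding leading_part_def by blast

lemma leading_part_energy:
  assumes "leading_part e A A0" "0 < e" "A0 0 = 0" "x \<in> energy_ge E"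
  shows "A x \<in> energy_ge E"
proof -
  have "ncoeff (A x) s q = 0" if "s < E" for s q
    using leading_partD[OF assms(1,4), of s q] that assms(2-4) by (simp add: energy_ge_def)
  then show ?thesis by (simp add: energy_ge_def)
qed

lemma leading_part_compose:
  fixes A :: "'b::real_vector nov \<Rightarrow> 'a::real_vector nov" and B :: "'c::real_vector nov \<Rightarrow> 'b nov"
  assumes "leading_part e A A0" "leading_part e B B0" "0 < e" "B0 0 = 0"
  shows "leading_part e (\<lambda>x. A (B x)) (\<lambda>v. A0 (B0 v))"
  unfolding leading_part_def
proof (intro allI impI)
  fix E :: real and x :: "'c nov" and s q assume *: "x \<in> energy_ge E" "s < E + e"
  have "B x \<in> energy_ge E" by (rule leading_part_energy[OF assms(2-4) *(1)])
  from leading_partD[OF assms(1) this *(2)] leading_partD[OF assms(2) *]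
  show "ncoeff (A (B x)) s q = A0 (B0 (ncoeff x s q))" by simp
qed

lemma leading_part_nov_map: "linear g \<Longrightarrow> leading_part e (nov_map g) g"
  by (simp add: leading_part_def ncoeff_nov_map)

text \<open>All coefficients of \<open>x\<close> have energy at least \<open>E\<close>, so they
  reach energies below \<open>E + e\<close> only through the part of \<open>D\<close> below
  \<open>e\<close>, and there \<open>D\<close> has nothing but its \<open>T^0 e^0\<close>
  coefficient.\<close>

lemma leading_part_nov_extend:
  fixes D :: "'a::real_vector \<Rightarrow> 'b::real_vector nov"
  assumes "linear D" "\<And>v s q. s < e \<Longrightarrow> (s, q) \<noteq> (0, 0) \<Longrightarrow> ncoeff (D v) s q = 0" "0 < e"
  shows "leading_part e (nov_extend D) (\<lambda>v. ncoeff (D v) 0 0)"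
  unfolding leading_part_def
proof (intro allI impI)
  fix E :: real and x :: "'a nov" and s q assume x: "x \<in> energy_ge E" and s: "s < E + e"
  let ?A = "insert (s, q) {(s', q'). s' \<le> s \<and> ncoeff x s' q' \<noteq> 0}"
  have fin: "finite ?A" by (intro finite_UnI finite.insertI finite_ncoeff)
  have "ncoeff (nov_extend D x) s q = (\<Sum>(s', q')\<in>?A. ncoeff (D (ncoeff x s' q')) (s - s') (q - q'))"
    by (rule ncoeff_nov_extend[where D = D, OF linear_0[OF assms(1)] fin]) auto
  also have "\<dots> = (\<Sum>(s', q')\<in>{(s, q)}. ncoeff (D (ncoeff x s' q')) (s - s') (q - q'))"
  proof (rule sum.mono_neutral_right[OF fin])
    show "\<forall>i\<in>?A - {(s, q)}. (case i of (s', q') \<Rightarrow> ncoeff (D (ncoeff x s' q')) (s - s') (q - q')) = 0"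
    proof
      fix i assume i: "i \<in> ?A - {(s, q)}"
      obtain s' q' where [simp]: "i = (s', q')" by (cases i)
      have *: "\<not> (s' = s \<and> q' = q)" "s' \<le> s" "ncoeff x s' q' \<noteq> 0" using i by auto
      then have "E \<le> s'" using x by (cases "s' < E") (auto simp: energy_ge_def)
      then have "ncoeff (D (ncoeff x s' q')) (s - s') (q - q') = 0"
        using * s by (intro assms(2)) auto
      then show "(case i of (s', q') \<Rightarrow> ncoeff (D (ncoeff x s' q')) (s - s') (q - q')) = 0" by simp
    qed
  qed simp
  finally show "ncoeff (nov_extend D x) s q = ncoeff (D (ncoeff x s q)) 0 0" by simp
qed

section \<open>Contracting a mapping cone by successive approximation\<close>

text \<open>Completeness of the energy filtration. Every coefficient of the limit is a finite sum of
  coefficients of the terms, so linear conditions on coefficients pass to the limit.\<close>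

lemma energy_series_limit:
  fixes w :: "nat \<Rightarrow> 'v::real_vector nov"
  assumes "\<And>E. \<exists>K. \<forall>k\<ge>K. w k \<in> energy_ge E" "\<And>q. subspace (U q)" "\<And>k. w k \<in> coeffs_in U"
  shows "\<exists>l\<in>coeffs_in U. \<forall>E. \<exists>K. \<forall>k\<ge>K. l - (\<Sum>i<k. w i) \<in> energy_ge E"
proof -
  have sm: "nov_summable w UNIV"
    unfolding nov_summable_def
  proof
    fix E
    obtain K where K: "\<forall>k\<ge>K. w k \<in> energy_ge E" using assms(1)[of E] ..
    have "i < K" if "w i \<notin> energy_ge E" for i using K that not_le_imp_less by blast
    then have "{i \<in> UNIV. w i \<notin> energy_ge E} \<subseteq> {..<K}" by blast
    then show "finite {i \<in> UNIV. w i \<notin> energy_ge E}" by (rule finite_subset) simp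
  qed
  let ?l = "nov_sum w UNIV"
  have "?l \<in> coeffs_in U"
    using assms(3) by (auto simp: coeffs_in_def ncoeff_nov_sum[OF sm] intro!: subspace_sum[OF assms(2)])
  moreover have "\<exists>K. \<forall>k\<ge>K. ?l - (\<Sum>i<k. w i) \<in> energy_ge E" for E
  proof -
    obtain K where K: "\<forall>k\<ge>K. w k \<in> energy_ge E" using assms(1)[of E] ..
    have "ncoeff ?l s q = (\<Sum>i<k. ncoeff (w i) s q)" if "k \<ge> K" "s < E" for k s q
      unfolding ncoeff_nov_sum[OF sm]
    proof (rule sum.mono_neutral_left)
      show "{i \<in> UNIV. ncoeff (w i) s q \<noteq> 0} \<subseteq> {..<k}"
      proof
        fix i assume "i \<in> {i \<in> UNIV. ncoeff (w i) s q \<noteq> 0}"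
        then have nz: "ncoeff (w i) s q \<noteq> 0" by simp
        have "i < k"
        proof (rule ccontr)
          assume "\<not> i < k"
          then have "w i \<in> energy_ge E" using K that(1) by simp
          with nz that(2) show False by (simp add: energy_ge_def)
        qed
        then show "i \<in> {..<k}" by simp
      qed
    qed auto
    then have "\<forall>k\<ge>K. ?l - (\<Sum>i<k. w i) \<in> energy_ge E"
      unfolding energy_ge_def mem_Collect_eq by (intro allI impI) (simp add: ncoeff_sum)
    then show ?thesis ..
  qed
  ultimately show ?thesis by (intro bexI[of _ ?l] allI)
qed

text \<open>The cone consists of pairs \<open>(y, x)\<close> with differential
  \<open>(D2 y + F x, - D1 x)\<close>; the last line of hypotheses says that \<open>(y, x)\<close>
  is a cocycle, and the conclusion that it is a coboundary. \<open>L1\<close> and \<open>L2\<close>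
  are abstract length filtrations. \<open>n1\<close> to \<open>n4\<close> bound the four entries of
  the error of the contraction built from \<open>h1\<close>, \<open>h2\<close>, \<open>g\<close>.
  The spaces \<open>P\<close> and \<open>Q\<close> carry the degree and symmetry conditions through
  the iteration, so that the same series solves the problem in every subcomplex.\<close>

lemma filtered_cone_acyclic:
  fixes D1 :: "'u::real_vector nov \<Rightarrow> 'u nov" and D2 :: "'v::real_vector nov \<Rightarrow> 'v nov"
  assumes lin: "linear D1" "linear D2" "linear F" "linear d1" "linear d2" "linear f"
      "linear h1" "linear h2" "linear g"
    and e: "0 < e"
    and lead: "leading_part e D1 d1" "leading_part e D2 d2" "leading_part e F f"
    and chain: "\<And>x. D1 (D1 x) = 0" "\<And>y. D2 (D2 y) = 0" "\<And>x. F (D1 x) = D2 (F x)"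
    and L: "\<And>n. subspace (L1 n)" "\<And>n. subspace (L2 n)" "\<And>n. L1 n \<subseteq> L1 (Suc n)" "\<And>n. L2 n \<subseteq> L2 (Suc n)"
      "\<And>v. \<exists>n. v \<in> L1 n" "\<And>v. \<exists>n. v \<in> L2 n" "L1 0 = {0}" "L2 0 = {0}"
    and n1: "\<And>n v. v \<in> L1 (Suc n) \<Longrightarrow> d1 (h1 v) + h1 (d1 v) + g (f v) - v \<in> L1 n"
    and n2: "\<And>n v. v \<in> L2 (Suc n) \<Longrightarrow> d2 (h2 v) + h2 (d2 v) + f (g v) - v \<in> L2 n"
    and n3: "\<And>n v. v \<in> L2 (Suc n) \<Longrightarrow> g (d2 v) - d1 (g v) \<in> L1 n"
    and n4: "\<And>n v. v \<in> L1 n \<Longrightarrow> h2 (f v) - f (h1 v) \<in> L2 n"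
    and sub: "\<And>q. subspace (P1 q)" "\<And>q. subspace (P2 q)" "\<And>q. subspace (Q1 q)" "\<And>q. subspace (Q2 q)"
    and PQ: "\<And>q v. v \<in> P2 q \<Longrightarrow> h2 v \<in> Q2 q" "\<And>q v. v \<in> P2 q \<Longrightarrow> g v \<in> Q1 q"
      "\<And>q v. v \<in> P1 q \<Longrightarrow> h1 v \<in> Q1 q"
    and QP: "D2 ` coeffs_in Q2 \<subseteq> coeffs_in P2" "F ` coeffs_in Q1 \<subseteq> coeffs_in P2" "D1 ` coeffs_in Q1 \<subseteq> coeffs_in P1"
    and yx: "y \<in> coeffs_in P2" "x \<in> coeffs_in P1" "D1 x = 0" "D2 y + F x = 0"
  shows "\<exists>w2\<in>coeffs_in Q2. \<exists>w1\<in>coeffs_in Q1. y = D2 w2 + F w1 \<and> x = - D1 w1"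
proof -
  define H1 H2 G where "H1 = nov_map h1" and "H2 = nov_map h2" and "G = nov_map g"
  note Hdefs = H1_def H2_def G_def
  have linH: "linear H1" "linear H2" "linear G"
    unfolding Hdefs using lin linear_nov_map by blast+
  note zero = lin[THEN linear_0] linH[THEN linear_0]
  note S = linear_add[OF lin(1)] linear_add[OF lin(2)] linear_add[OF lin(3)]
    linear_diff[OF lin(1)] linear_diff[OF lin(2)] linear_diff[OF lin(3)]
    linear_neg[OF lin(1)] linear_neg[OF lin(2)] linear_neg[OF lin(3)]
    linear_add[OF linH(1)] linear_add[OF linH(2)] linear_add[OF linH(3)]
  have leadH: "leading_part e H1 h1" "leading_part e H2 h2" "leading_part e G g"
    unfolding Hdefs by (simp_all add: leading_part_nov_map lin)
  \<comment> \<open>The two components of the approximate contraction of the cone; \<open>T\<close>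
    below removes from a pair the coboundary of its correction.\<close>
  define W2 W1 where "W2 = (\<lambda>z :: 'v nov \<times> 'u nov. H2 (fst z))"
    and "W1 = (\<lambda>z :: 'v nov \<times> 'u nov. G (fst z) - H1 (snd z))"
  define T where "T = (\<lambda>z. (fst z - (D2 (W2 z) + F (W1 z)), snd z + D1 (W1 z)))"
  define coc where "coc = (\<lambda>z. D1 (snd z) = 0 \<and> D2 (fst z) + F (snd z) = 0)"
  have coc_T: "coc (T z)" if "coc z" for z
    using that by (simp add: coc_def T_def S chain algebra_simps)
  \<comment> \<open>On a cocycle the contraction applied to the differential is zero. Subtracting it
    turns \<open>T\<close> into the identity minus the graded commutator of differential and
    contraction, to which \<open>n1\<close> to \<open>n4\<close> apply.\<close>
  have T_fst: "fst (T z) = fst z - D2 (H2 (fst z)) - H2 (D2 (fst z)) - F (G (fst z))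
      + F (H1 (snd z)) - H2 (F (snd z))" if "coc z" for z
  proof -
    have "H2 (D2 (fst z)) + H2 (F (snd z)) = 0"
      using that by (simp add: coc_def S(11)[symmetric] zero)
    then have "H2 (D2 (fst z)) = - H2 (F (snd z))" by (simp add: eq_neg_iff_add_eq_0)
    then show ?thesis by (simp add: T_def W2_def W1_def S)
  qed
  have T_snd: "snd (T z) = snd z - D1 (H1 (snd z)) - H1 (D1 (snd z)) - G (F (snd z))
      + D1 (G (fst z)) - G (D2 (fst z))" if "coc z" for z
  proof -
    have "G (D2 (fst z)) + G (F (snd z)) = 0" "H1 (D1 (snd z)) = 0"
      using that by (simp_all add: coc_def S(12)[symmetric] zero)
    then have "G (D2 (fst z)) = - G (F (snd z))" by (simp add: eq_neg_iff_add_eq_0)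
    then show ?thesis using \<open>H1 (D1 (snd z)) = 0\<close> by (simp add: T_def W2_def W1_def S)
  qed
  have cf: "ncoeff (fst (T z)) s q = f (h1 b) - h2 (f b) - (d2 (h2 a) + h2 (d2 a) + f (g a) - a)"
      "ncoeff (snd (T z)) s q = - (g (d2 a) - d1 (g a)) - (d1 (h1 b) + h1 (d1 b) + g (f b) - b)"
    if "coc z" "fst z \<in> energy_ge E" "snd z \<in> energy_ge E" "s < E + e"
      "a = ncoeff (fst z) s q" "b = ncoeff (snd z) s q" for z E s q a b
  proof -
    note C = leading_part_compose[OF _ _ e]
    note D = leading_partD[OF _ that(2) that(4), of _ _ q] leading_partD[OF _ that(3) that(4), of _ _ q]
    have *: "ncoeff (D2 (H2 (fst z))) s q = d2 (h2 a)" "ncoeff (H2 (D2 (fst z))) s q = h2 (d2 a)"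
      "ncoeff (F (G (fst z))) s q = f (g a)" "ncoeff (F (H1 (snd z))) s q = f (h1 b)"
      "ncoeff (H2 (F (snd z))) s q = h2 (f b)"
      "ncoeff (D1 (H1 (snd z))) s q = d1 (h1 b)" "ncoeff (H1 (D1 (snd z))) s q = h1 (d1 b)"
      "ncoeff (G (F (snd z))) s q = g (f b)" "ncoeff (D1 (G (fst z))) s q = d1 (g a)"
      "ncoeff (G (D2 (fst z))) s q = g (d2 a)"
      unfolding that(5,6)
      by (rule D(1)[OF C[OF lead(2) leadH(2)]] D(1)[OF C[OF leadH(2) lead(2)]]
          D(1)[OF C[OF lead(3) leadH(3)]] D(2)[OF C[OF lead(3) leadH(1)]]
          D(2)[OF C[OF leadH(2) lead(3)]] D(2)[OF C[OF lead(1) leadH(1)]]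
          D(2)[OF C[OF leadH(1) lead(1)]] D(2)[OF C[OF leadH(3) lead(3)]]
          D(1)[OF C[OF lead(1) leadH(3)]] D(1)[OF C[OF leadH(3) lead(2)]]; simp add: zero)+
    show "ncoeff (fst (T z)) s q = f (h1 b) - h2 (f b) - (d2 (h2 a) + h2 (d2 a) + f (g a) - a)"
      "ncoeff (snd (T z)) s q = - (g (d2 a) - d1 (g a)) - (d1 (h1 b) + h1 (d1 b) + g (f b) - b)"
      unfolding T_fst[OF that(1)] T_snd[OF that(1)] by (simp_all add: * that(5,6))
  qed
  \<comment> \<open>The entry bounded by \<open>n4\<close> preserves the length level, while the
    other three lower it. Hence the staggered levels: \<open>r / 2\<close> rounded up in the first
    component and rounded down in the second, so that each application of \<open>T\<close> lowers
    \<open>r\<close> by one. At \<open>r = 0\<close> both levels are 0, so everything below energy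
    \<open>E + e\<close> has vanished.\<close>
  define W where "W = (\<lambda>E r z. fst z \<in> energy_ge E \<and> snd z \<in> energy_ge E \<and>
    (\<forall>s q. s < E + e \<longrightarrow> ncoeff (fst z) s q \<in> L2 (Suc r div 2) \<and> ncoeff (snd z) s q \<in> L1 (r div 2)))"
  have T_energy: "fst (T z) \<in> energy_ge E \<and> snd (T z) \<in> energy_ge E"
    if "coc z" "fst z \<in> energy_ge E" "snd z \<in> energy_ge E" for z E
    using cf[OF that _ refl refl] that(2,3) e by (simp add: energy_ge_def zero)
  have L_mono: "L1 m \<subseteq> L1 n" "L2 m \<subseteq> L2 n" if "m \<le> n" for m n
    using lift_Suc_mono_le[of L1, OF L(3) that] lift_Suc_mono_le[of L2, OF L(4) that] by auto
  have W_step: "W E r (T z)" if "coc z" "W E (Suc r) z" for z E r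
    unfolding W_def
  proof (intro conjI allI impI)
    have z: "fst z \<in> energy_ge E" "snd z \<in> energy_ge E" using that(2) by (auto simp: W_def)
    show "fst (T z) \<in> energy_ge E" "snd (T z) \<in> energy_ge E"
      using T_energy[OF that(1) z] by auto
    fix s q assume s: "s < E + e"
    define a b where "a = ncoeff (fst z) s q" and "b = ncoeff (snd z) s q"
    have ab: "a \<in> L2 (Suc (r div 2))" "b \<in> L1 (Suc r div 2)"
      using that(2) s by (auto simp: W_def a_def b_def)
    note c = cf[OF that(1) z s a_def b_def]
    have "d2 (h2 a) + h2 (d2 a) + f (g a) - a \<in> L2 (Suc r div 2)"
      using n2[OF ab(1)] L_mono(2)[of "r div 2" "Suc r div 2"] by (auto simp: div_le_mono)
    moreover have "f (h1 b) - h2 (f b) \<in> L2 (Suc r div 2)"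
      using subspace_neg[OF L(2) n4[OF ab(2)]] by simp
    ultimately show "ncoeff (fst (T z)) s q \<in> L2 (Suc r div 2)"
      unfolding c by (rule subspace_diff[OF L(2), rotated])
    \<comment> \<open>\<open>n1\<close> speaks of positive levels only; at level 0 the coefficient
      \<open>b\<close> is zero.\<close>
    have "d1 (h1 b) + h1 (d1 b) + g (f b) - b \<in> L1 (r div 2)"
    proof (cases "Suc r div 2")
      case 0
      then have "b = 0" using ab(2) L(7) by simp
      then show ?thesis using subspace_0[OF L(1)] by (simp add: zero)
    next
      case (Suc m)
      then have "m \<le> r div 2" by simp
      then show ?thesis using n1[of b m] ab(2) Suc L_mono(1)[of m "r div 2"] by auto
    qed
    with n3[OF ab(1)] show "ncoeff (snd (T z)) s q \<in> L1 (r div 2)"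
      unfolding c by (metis subspace_diff[OF L(1)] subspace_neg[OF L(1)])
  qed
  have W_start: "\<exists>r. W E r z" if "fst z \<in> energy_ge E" "snd z \<in> energy_ge E" for E z
  proof -
    \<comment> \<open>Only finitely many coefficients lie below energy \<open>E + e\<close>, so one
      level \<open>M\<close> bounds all of them; \<open>r = 2 * M\<close> gives level
      \<open>M\<close> in both components.\<close>
    let ?A = "{(s, q). s \<le> E + e \<and> ncoeff (fst z) s q \<noteq> 0} \<union> {(s, q). s \<le> E + e \<and> ncoeff (snd z) s q \<noteq> 0}"
    have fin: "finite ?A" by (intro finite_UnI finite.insertI finite_ncoeff)
    have "\<forall>p. \<exists>n. ncoeff (fst z) (fst p) (snd p) \<in> L2 n \<and> ncoeff (snd z) (fst p) (snd p) \<in> L1 n"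
    proof
      fix p
      obtain n m where "ncoeff (fst z) (fst p) (snd p) \<in> L2 n" "ncoeff (snd z) (fst p) (snd p) \<in> L1 m"
        using L(5,6) by metis
      then show "\<exists>n. ncoeff (fst z) (fst p) (snd p) \<in> L2 n \<and> ncoeff (snd z) (fst p) (snd p) \<in> L1 n"
        using L_mono[of n "max n m"] L_mono[of m "max n m"] by (intro exI[of _ "max n m"]) auto
    qed
    then obtain N where N: "\<And>p. ncoeff (fst z) (fst p) (snd p) \<in> L2 (N p) \<and> ncoeff (snd z) (fst p) (snd p) \<in> L1 (N p)"
      by metis
    define M where "M = Max (insert 0 (N ` ?A))"
    have M: "N p \<le> M" if "p \<in> ?A" for p
      using that fin by (auto simp: M_def)
    have "ncoeff (fst z) s q \<in> L2 M \<and> ncoeff (snd z) s q \<in> L1 M" if "s < E + e" for s q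
    proof (cases "(s, q) \<in> ?A")
      case True
      then show ?thesis using N[of "(s, q)"] L_mono[OF M[OF True]] by auto
    next
      case False
      then show ?thesis using that subspace_0[OF L(1)] subspace_0[OF L(2)] by auto
    qed
    then have "W E (2 * M) z" using that by (simp add: W_def)
    then show ?thesis ..
  qed
  define z where "z = (\<lambda>k. (T ^^ k) (y, x))"
  have z_Suc: "z (Suc k) = T (z k)" and z_0: "z 0 = (y, x)" for k by (simp_all add: z_def)
  have coc_z: "coc (z k)" for k
    by (induction k) (use yx coc_T in \<open>auto simp: z_0 z_Suc coc_def\<close>)
  have W_iter: "W E 0 (z (r + k))" if "W E r (z k)" for E r k
    using that
  proof (induction r arbitrary: k)
    case (Suc r)
    have "W E r (z (Suc k))" unfolding z_Suc by (rule W_step[OF coc_z Suc.prems])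
    from Suc.IH[OF this] show ?case by simp
  qed simp
  have energy_mono: "fst (z k') \<in> energy_ge E \<and> snd (z k') \<in> energy_ge E"
    if "fst (z k) \<in> energy_ge E" "snd (z k) \<in> energy_ge E" "k \<le> k'" for k k' E
    using that(3) by (induction k' rule: dec_induct) (use that T_energy[OF coc_z] in \<open>auto simp: z_Suc\<close>)
  have reach: "\<exists>k. fst (z k) \<in> energy_ge (real m * e) \<and> snd (z k) \<in> energy_ge (real m * e)" for m
  proof (induction m)
    case 0
    then show ?case by (simp add: energy_ge_0)
  next
    case (Suc m)
    then obtain k where "fst (z k) \<in> energy_ge (real m * e)" "snd (z k) \<in> energy_ge (real m * e)" by blast
    then obtain r where "W (real m * e) r (z k)" using W_start by blast
    then have "W (real m * e) 0 (z (r + k))" by (rule W_iter)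
    then have "fst (z (r + k)) \<in> energy_ge (real m * e + e)" "snd (z (r + k)) \<in> energy_ge (real m * e + e)"
      using L(7,8) by (auto simp: W_def energy_ge_def)
    then show ?case by (auto simp: algebra_simps intro!: exI[of _ "r + k"])
  qed
  have conv: "\<exists>K. \<forall>k\<ge>K. fst (z k) \<in> energy_ge E \<and> snd (z k) \<in> energy_ge E" for E
  proof -
    obtain m :: nat where "E < real m * e" using reals_Archimedean3[OF e] by blast
    obtain k where "fst (z k) \<in> energy_ge (real m * e)" "snd (z k) \<in> energy_ge (real m * e)"
      using reach by blast
    then have "fst (z k) \<in> energy_ge E" "snd (z k) \<in> energy_ge E"
      using \<open>E < real m * e\<close> by (simp_all add: energy_ge_def)
    then show ?thesis using energy_mono by blast
  qed
  have mem: "fst (z k) \<in> coeffs_in P2 \<and> snd (z k) \<in> coeffs_in P1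
      \<and> W2 (z k) \<in> coeffs_in Q2 \<and> W1 (z k) \<in> coeffs_in Q1" for k
  proof (induction k)
    case 0
    have "W2 (z 0) \<in> coeffs_in Q2" "W1 (z 0) \<in> coeffs_in Q1"
      using yx PQ sub by (auto simp: z_0 W2_def W1_def Hdefs coeffs_in_def ncoeff_nov_map lin subspace_diff)
    then show ?case using yx by (simp add: z_0)
  next
    case (Suc k)
    have p: "fst (z (Suc k)) \<in> coeffs_in P2" "snd (z (Suc k)) \<in> coeffs_in P1"
      using Suc QP subspace_coeffs_in[OF sub(1)] subspace_coeffs_in[OF sub(2)]
      unfolding z_Suc T_def by (auto intro!: subspace_diff subspace_add)
    then have "W2 (z (Suc k)) \<in> coeffs_in Q2" "W1 (z (Suc k)) \<in> coeffs_in Q1"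
      using PQ sub by (auto simp: W2_def W1_def Hdefs coeffs_in_def ncoeff_nov_map lin subspace_diff)
    with p show ?case by simp
  qed
  have en: "H1 a \<in> energy_ge E" "H2 b \<in> energy_ge E" "G b \<in> energy_ge E"
    "D1 a \<in> energy_ge E" "D2 b \<in> energy_ge E" "F a \<in> energy_ge E"
    if "a \<in> energy_ge E" "b \<in> energy_ge E" for a b E
    using leading_part_energy[OF lead(1) e zero(4) that(1)] leading_part_energy[OF lead(2) e zero(5) that(2)]
      leading_part_energy[OF lead(3) e zero(6) that(1)] leading_part_energy[OF leadH(1) e zero(7) that(1)]
      leading_part_energy[OF leadH(2) e zero(8) that(2)] leading_part_energy[OF leadH(3) e zero(9) that(2)]
    by auto
  have convW: "\<exists>K. \<forall>k\<ge>K. W2 (z k) \<in> energy_ge E" "\<exists>K. \<forall>k\<ge>K. W1 (z k) \<in> energy_ge E" for E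
    using conv[of E] by (auto simp: W2_def W1_def intro!: en subspace_diff[OF subspace_energy_ge] elim!: ex_forward)
  have "\<exists>l\<in>coeffs_in Q2. \<forall>E. \<exists>K. \<forall>k\<ge>K. l - (\<Sum>i<k. W2 (z i)) \<in> energy_ge E"
    by (rule energy_series_limit[OF convW(1) sub(4)]) (use mem in simp)
  then obtain w2 where w2: "w2 \<in> coeffs_in Q2"
      "\<forall>E. \<exists>K. \<forall>k\<ge>K. w2 - (\<Sum>i<k. W2 (z i)) \<in> energy_ge E" ..
  have "\<exists>l\<in>coeffs_in Q1. \<forall>E. \<exists>K. \<forall>k\<ge>K. l - (\<Sum>i<k. W1 (z i)) \<in> energy_ge E"
    by (rule energy_series_limit[OF convW(2) sub(3)]) (use mem in simp)
  then obtain w1 where w1: "w1 \<in> coeffs_in Q1"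
      "\<forall>E. \<exists>K. \<forall>k\<ge>K. w1 - (\<Sum>i<k. W1 (z i)) \<in> energy_ge E" ..
  define v2 v1 where "v2 k = (\<Sum>i<k. W2 (z i))" and "v1 k = (\<Sum>i<k. W1 (z i))" for k
  \<comment> \<open>Telescoping: consecutive iterates differ by the coboundary of the correction
    made in between.\<close>
  have partial: "y - fst (z k) = D2 (v2 k) + F (v1 k)" "x - snd (z k) = - D1 (v1 k)" for k
  proof (induction k)
    case 0
    { case 1 show ?case by (simp add: z_0 v2_def v1_def zero) }
    { case 2 show ?case by (simp add: z_0 v2_def v1_def zero) }
  next
    case (Suc k)
    { case 1 show ?case using Suc(1) by (simp add: z_Suc T_def v2_def v1_def S algebra_simps) }
    { case 2 show ?case using Suc(2) by (simp add: z_Suc T_def v2_def v1_def S algebra_simps) }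
  qed
  have "y = D2 w2 + F w1 \<and> x = - D1 w1"
  proof (intro conjI energy_ge_eqI)
    fix E
    obtain K1 K2 K3 where K: "\<And>k. k \<ge> K1 \<Longrightarrow> w2 - v2 k \<in> energy_ge E" "\<And>k. k \<ge> K2 \<Longrightarrow> w1 - v1 k \<in> energy_ge E"
      "\<And>k. k \<ge> K3 \<Longrightarrow> fst (z k) \<in> energy_ge E \<and> snd (z k) \<in> energy_ge E"
      using w1(2)[rule_format, of E] w2(2)[rule_format, of E] conv[of E] unfolding v2_def v1_def by metis
    define k where "k = max K1 (max K2 K3)"
    have *: "w2 - v2 k \<in> energy_ge E" "w1 - v1 k \<in> energy_ge E" "fst (z k) \<in> energy_ge E" "snd (z k) \<in> energy_ge E"
      using K[of k] by (auto simp: k_def)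
    have "y - (D2 w2 + F w1) = fst (z k) - D2 (w2 - v2 k) - F (w1 - v1 k)"
      using partial(1)[of k] by (simp add: S algebra_simps)
    then show "y - (D2 w2 + F w1) \<in> energy_ge E"
      using * by (simp add: en subspace_diff[OF subspace_energy_ge])
    have "x - (- D1 w1) = snd (z k) + D1 (w1 - v1 k)"
      using partial(2)[of k] by (simp add: S algebra_simps)
    then show "x - (- D1 w1) \<in> energy_ge E"
      using * by (simp add: en subspace_add[OF subspace_energy_ge])
  qed
  with w1(1) w2(1) show ?thesis by blast
qed

text \<open>The last two hypotheses are injectivity and surjectivity on classes, in the form in
  which exactness of the cone at \<open>(- y, x)\<close> and at \<open>(y, 0)\<close> delivers them.
  \<open>A\<close> and \<open>B\<close> are kept apart because the coboundaries in degree
  \<open>n\<close> come from degree \<open>n - 1\<close>.\<close>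

lemma induces_cohomology_isoI:
  assumes "subspace A1" "subspace B1" "subspace A2" "subspace B2" "linear d1" "linear d2" "linear f"
    and maps: "d1 ` B1 \<subseteq> A1" "d2 ` B2 \<subseteq> A2" "f ` A1 \<subseteq> A2" "f ` B1 \<subseteq> B2"
    and chain: "\<And>x. f (d1 x) = d2 (f x)"
    and inj: "\<And>x y. x \<in> A1 \<Longrightarrow> d1 x = 0 \<Longrightarrow> y \<in> B2 \<Longrightarrow> f x = d2 y \<Longrightarrow> x \<in> d1 ` B1"
    and surj: "\<And>y. y \<in> A2 \<Longrightarrow> d2 y = 0 \<Longrightarrow> \<exists>x\<in>A1. \<exists>w\<in>B2. d1 x = 0 \<and> y = f x + d2 w"
  shows "induces_cohomology_iso A1 B1 d1 A2 B2 d2 f"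
proof -
  let ?R1 = "cohomologous A1 B1 d1" and ?R2 = "cohomologous A2 B2 d2"
  have equivs: "equiv (cocycles A d) (cohomologous A B d)"
    if sub: "subspace A" "subspace B" and lin: "linear d" for A B and d :: "'z::real_vector \<Rightarrow> 'z"
  proof (rule equivI)
    show "cohomologous A B d \<subseteq> cocycles A d \<times> cocycles A d" by (auto simp: cohomologous_def)
    have im: "subspace (d ` B)" by (rule linear_subspace_image[OF lin sub(2)])
    show "refl_on (cocycles A d) (cohomologous A B d)"
      using subspace_0[OF im] by (auto simp: refl_on_def cohomologous_def)
    show "sym (cohomologous A B d)"
    proof (rule symI)
      fix x y assume "(x, y) \<in> cohomologous A B d"
      then show "(y, x) \<in> cohomologous A B d"
        using subspace_neg[OF im, of "x - y"] by (auto simp: cohomologous_def)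
    qed
    show "trans (cohomologous A B d)"
    proof (rule transI)
      fix x y z assume "(x, y) \<in> cohomologous A B d" "(y, z) \<in> cohomologous A B d"
      then show "(x, z) \<in> cohomologous A B d"
        using subspace_add[OF im, of "x - y" "y - z"] by (auto simp: cohomologous_def)
    qed
  qed
  note e1 = equivs[OF assms(1,2,5)] and e2 = equivs[OF assms(3,4,6)]
  have coc: "f x \<in> cocycles A2 d2" if "x \<in> cocycles A1 d1" for x
    using that maps(3) chain[of x] linear_0[OF assms(7)] by (auto simp: cocycles_def)
  have iff: "(f x, f y) \<in> ?R2 \<longleftrightarrow> (x, y) \<in> ?R1" if "x \<in> cocycles A1 d1" "y \<in> cocycles A1 d1" for x y
  proof
    assume "(f x, f y) \<in> ?R2"
    then obtain w where "w \<in> B2" "f (x - y) = d2 w"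
      by (auto simp: cohomologous_def linear_diff[OF assms(7)])
    moreover have "x - y \<in> A1" "d1 (x - y) = 0"
      using that by (auto simp: cocycles_def subspace_diff[OF assms(1)] linear_diff[OF assms(5)])
    ultimately have "x - y \<in> d1 ` B1" using inj by blast
    then show "(x, y) \<in> ?R1" using that by (simp add: cohomologous_def)
  next
    assume "(x, y) \<in> ?R1"
    then obtain w where "w \<in> B1" "x - y = d1 w" by (auto simp: cohomologous_def)
    then have "f x - f y = d2 (f w)" using chain[of w] linear_diff[OF assms(7), of x y] by simp
    then show "(f x, f y) \<in> ?R2"
      using coc that maps(4) \<open>w \<in> B1\<close> by (auto simp: cohomologous_def)
  qed
  \<comment> \<open>The image of a class lies in a single class of the target; its saturation is
    that class, so no representative has to be chosen.\<close>
  define \<Phi> where "\<Phi> = (\<lambda>c. ?R2 `` (f ` c))"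
  have \<Phi>: "\<Phi> (?R1 `` {x}) = ?R2 `` {f x}" if x: "x \<in> cocycles A1 d1" for x
  proof -
    have "?R2 `` {f y} = ?R2 `` {f x}" if "(x, y) \<in> ?R1" for y
    proof -
      have "y \<in> cocycles A1 d1" using that by (simp add: cohomologous_def)
      then have "(f x, f y) \<in> ?R2" using that x iff by blast
      then show ?thesis using equiv_class_eq[OF e2] by simp
    qed
    then have "(\<Union>y\<in>?R1 `` {x}. ?R2 `` {f y}) = ?R2 `` {f x}"
      by (intro UN_constant_eq[OF equiv_class_self[OF e1 x]]) blast
    moreover have "\<Phi> (?R1 `` {x}) = (\<Union>y\<in>?R1 `` {x}. ?R2 `` {f y})" by (auto simp: \<Phi>_def)
    ultimately show ?thesis by simp
  qed
  have "bij_betw \<Phi> (cohomology A1 B1 d1) (cohomology A2 B2 d2)"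
    unfolding bij_betw_def
  proof
    show "inj_on \<Phi> (cohomology A1 B1 d1)"
    proof (rule inj_onI)
      fix c c' assume "c \<in> cohomology A1 B1 d1" "c' \<in> cohomology A1 B1 d1" and eq: "\<Phi> c = \<Phi> c'"
      then obtain x x' where x: "x \<in> cocycles A1 d1" "c = ?R1 `` {x}" "x' \<in> cocycles A1 d1" "c' = ?R1 `` {x'}"
        by (auto simp: cohomology_def elim!: quotientE)
      have "?R2 `` {f x} = ?R2 `` {f x'}"
        using eq \<Phi>[OF x(1)] \<Phi>[OF x(3)] x(2,4) by simp
      then have "(f x, f x') \<in> ?R2" by (rule eq_equiv_class[OF _ e2 coc[OF x(3)]])
      then have "(x, x') \<in> ?R1" using iff[OF x(1,3)] by simp
      then show "c = c'" unfolding x(2,4) by (rule equiv_class_eq[OF e1])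
    qed
    show "\<Phi> ` cohomology A1 B1 d1 = cohomology A2 B2 d2"
    proof (intro equalityI subsetI)
      fix c assume "c \<in> \<Phi> ` cohomology A1 B1 d1"
      then obtain x where "x \<in> cocycles A1 d1" "c = \<Phi> (?R1 `` {x})"
        by (auto simp: cohomology_def elim!: quotientE)
      then show "c \<in> cohomology A2 B2 d2" using \<Phi> coc by (simp add: cohomology_def quotientI)
    next
      fix c assume "c \<in> cohomology A2 B2 d2"
      then obtain y where y: "y \<in> cocycles A2 d2" "c = ?R2 `` {y}"
        by (auto simp: cohomology_def elim!: quotientE)
      then obtain x w where x: "x \<in> A1" "w \<in> B2" "d1 x = 0" "y = f x + d2 w"
        using surj by (force simp: cocycles_def)
      then have xc: "x \<in> cocycles A1 d1" by (simp add: cocycles_def)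
      have "(y, f x) \<in> ?R2" using y x coc[OF xc] by (auto simp: cohomologous_def)
      then have "c = \<Phi> (?R1 `` {x})" unfolding y(2) \<Phi>[OF xc] by (rule equiv_class_eq[OF e2])
      moreover have "?R1 `` {x} \<in> cohomology A1 B1 d1" using xc by (simp add: cohomology_def quotientI)
      ultimately show "c \<in> \<Phi> ` cohomology A1 B1 d1" by blast
    qed
  qed
  then show ?thesis unfolding induces_cohomology_iso_def
    by (intro conjI maps exI[of _ \<Phi>] ballI \<Phi>)
qed

section \<open>Signed permutations of tensors\<close>

definition tensor_permute :: "(int \<Rightarrow> 'a::real_vector set) \<Rightarrow> (nat \<Rightarrow> nat \<Rightarrow> nat) \<Rightarrow> 'a tensor \<Rightarrow> 'a tensor" where
  "tensor_permute gr \<pi> = hext gr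
     (\<lambda>ns xs. koszul_sign (\<pi> (length xs)) ns *\<^sub>R tword (permute_list (\<pi> (length xs)) xs))"

lemma bar_permute_conv: "bar_permute gr \<pi> = nov_map (tensor_permute gr \<pi>)"
  by (simp add: bar_permute_def tensor_permute_def hext_def)

context
  fixes \<pi> :: "nat \<Rightarrow> nat \<Rightarrow> nat"
  assumes \<pi>: "\<And>k. \<pi> k permutes {..<k}"
begin

private lemma multilinear_permute_word:
  "multilinear_words (\<lambda>xs. koszul_sign (\<pi> (length xs)) ns *\<^sub>R tword (permute_list (\<pi> (length xs)) xs))"
  using multilinear_words_scale[OF multilinear_words_permute[OF multilinear_words_tword \<pi>]] .

lemma linear_tensor_permute: "graded_space gr \<Longrightarrow> linear (tensor_permute gr \<pi>)"
  unfolding tensor_permute_def by (rule linear_hext[OF _ multilinear_permute_word])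

lemma tensor_permute_tword:
  assumes "graded_space gr" "hom_word gr ns xs"
  shows "tensor_permute gr \<pi> (tword xs) =
    koszul_sign (\<pi> (length xs)) ns *\<^sub>R tword (permute_list (\<pi> (length xs)) xs)"
  unfolding tensor_permute_def by (rule hext_tword[OF assms(1) multilinear_permute_word assms(2)])

end

section \<open>Adjacent swaps with Koszul signs\<close>

definition adjacent :: "nat \<Rightarrow> nat \<Rightarrow> nat \<Rightarrow> nat" where
  "adjacent j k = (if Suc j < k then Transposition.transpose j (Suc j) else id)"

lemma adjacent_permutes: "adjacent j k permutes {..<k}"
  by (auto simp: adjacent_def permutes_id intro!: permutes_swap_id)

definition tswap :: "(int \<Rightarrow> 'a::real_vector set) \<Rightarrow> nat \<Rightarrow> 'a tensor \<Rightarrow> 'a tensor" where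
  "tswap gr j = tensor_permute gr (adjacent j)"

lemma linear_tswap: "graded_space gr \<Longrightarrow> linear (tswap gr j)"
  unfolding tswap_def by (rule linear_tensor_permute[OF adjacent_permutes])

text \<open>The inversions of \<open>\<rho> \<circ> (j j+1)\<close> and of \<open>\<rho>\<close> correspond, except that \<open>(j, j+1)\<close> is one for exactly one of them.\<close>

lemma koszul_sign_adjacent:
  assumes "\<rho> permutes {..<length ns}" "Suc j < length ns"
  shows "koszul_sign (\<rho> \<circ> Transposition.transpose j (Suc j)) ns =
    koszul_sign \<rho> ns * (-1) powi ((ns ! \<rho> j - 1) * (ns ! \<rho> (Suc j) - 1))"
proof -
  define s where "s = Transposition.transpose j (Suc j)"
  define c where "c = (\<lambda>a b. (-1::real) powi ((ns ! a - 1) * (ns ! b - 1)))"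
  define I where "I = (\<lambda>\<rho>. {(i, k). i < k \<and> k < length ns \<and> \<rho> k < (\<rho> i :: nat)})"
  define p where "p = (j, Suc j)"
  define m where "m = (\<lambda>(i, k). (s i, s k))"
  have fin: "finite (I \<rho>)" for \<rho>
    by (rule finite_subset[of _ "{..<length ns} \<times> {..<length ns}"]) (auto simp: I_def)
  have ks: "koszul_sign \<rho> ns = (\<Prod>(i, k)\<in>I \<rho>. c (\<rho> i) (\<rho> k))" for \<rho>
    by (simp add: koszul_sign_def I_def c_def)
  have ss: "s (s i) = i" for i by (simp add: s_def)
  have mono: "s i < s k" if "i < k" "(i, k) \<noteq> p" for i k
    using that by (auto simp: s_def p_def Transposition.transpose_def)
  have bound: "s k < length ns" if "k < length ns" for k
    using that assms(2) by (auto simp: s_def Transposition.transpose_def)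
  have m_into: "m x \<in> I \<sigma> - {p}" if "x \<in> I (\<sigma> \<circ> s) - {p}" for x \<sigma>
  proof -
    obtain i k where x: "x = (i, k)" by (cases x)
    have *: "i < k" "k < length ns" "\<sigma> (s k) < \<sigma> (s i)" "(i, k) \<noteq> p"
      using that by (auto simp: x I_def)
    have "(s i, s k) \<noteq> p"
    proof
      assume "(s i, s k) = p"
      then have "i = s j" "k = s (Suc j)" using ss[of i] ss[of k] by (auto simp: p_def)
      then show False using *(1) by (simp add: s_def)
    qed
    then show ?thesis using * mono bound by (simp add: x m_def I_def)
  qed
  have rs: "\<rho> \<circ> s \<circ> s = \<rho>" by (simp add: fun_eq_iff ss)
  have bij: "bij_betw m (I (\<rho> \<circ> s) - {p}) (I \<rho> - {p})"
  proof (rule bij_betw_byWitness[where f' = m])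
    show "m ` (I (\<rho> \<circ> s) - {p}) \<subseteq> I \<rho> - {p}" using m_into by (rule image_subsetI)
    show "m ` (I \<rho> - {p}) \<subseteq> I (\<rho> \<circ> s) - {p}"
      using m_into[of _ "\<rho> \<circ> s"] unfolding rs by (rule image_subsetI)
  qed (simp_all add: m_def ss split_beta)
  have "(\<Prod>(i, k)\<in>I \<rho> - {p}. c (\<rho> i) (\<rho> k)) =
      (\<Prod>x\<in>I (\<rho> \<circ> s) - {p}. case m x of (i, k) \<Rightarrow> c (\<rho> i) (\<rho> k))"
    by (rule prod.reindex_bij_betw[OF bij, symmetric])
  also have "\<dots> = (\<Prod>(i, k)\<in>I (\<rho> \<circ> s) - {p}. c ((\<rho> \<circ> s) i) ((\<rho> \<circ> s) k))"
    by (intro prod.cong) (auto simp: m_def)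
  finally have eq: "(\<Prod>(i, k)\<in>I \<rho> - {p}. c (\<rho> i) (\<rho> k)) =
      (\<Prod>(i, k)\<in>I (\<rho> \<circ> s) - {p}. c ((\<rho> \<circ> s) i) ((\<rho> \<circ> s) k))" .
  have split: "(\<Prod>(i, k)\<in>I \<sigma>. c (\<sigma> i) (\<sigma> k)) =
      (if p \<in> I \<sigma> then c (\<sigma> j) (\<sigma> (Suc j)) else 1) * (\<Prod>(i, k)\<in>I \<sigma> - {p}. c (\<sigma> i) (\<sigma> k))" for \<sigma>
    using prod.remove[OF fin, of p \<sigma> "\<lambda>(i, k). c (\<sigma> i) (\<sigma> k)"] by (auto simp: p_def)
  have s_j: "s j = Suc j" "s (Suc j) = j" by (simp_all add: s_def)
  have "\<rho> j \<noteq> \<rho> (Suc j)" using inj_eq[OF permutes_inj[OF assms(1)]] by simp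
  then have ex: "p \<in> I (\<rho> \<circ> s) \<longleftrightarrow> p \<notin> I \<rho>"
    using assms(2) by (auto simp: p_def I_def s_j)
  \<comment> \<open>Each factor is a symmetric sign, so losing it and multiplying by it once more
    amount to the same. This covers both cases, according to which of the two permutations has
    \<open>p\<close> as an inversion.\<close>
  have cc: "c a b * c a b = 1" "c a b = c b a" for a b
    by (auto simp: c_def neg_one_powi mult.commute)
  show ?thesis
  proof -
    have "(if p \<notin> I \<rho> then c ((\<rho> \<circ> s) j) ((\<rho> \<circ> s) (Suc j)) else 1) =
        (if p \<in> I \<rho> then c (\<rho> j) (\<rho> (Suc j)) else 1) * c (\<rho> j) (\<rho> (Suc j))"
      using cc by (simp add: s_j)
    then have "koszul_sign (\<rho> \<circ> s) ns = koszul_sign \<rho> ns * c (\<rho> j) (\<rho> (Suc j))"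
      unfolding ks split[of \<rho>] split[of "\<rho> \<circ> s"] eq ex by (simp only: mult_ac)
    then show ?thesis by (simp add: s_def c_def)
  qed
qed

lemma koszul_sign_id: "koszul_sign id ns = 1"
proof -
  have "{(i, j). i < j \<and> j < length ns \<and> id j < (id i :: nat)} = {}" by auto
  then show ?thesis unfolding koszul_sign_def by (simp only: prod.empty)
qed

lemma hom_word_permute:
  assumes "hom_word gr ns xs" "\<rho> permutes {..<length xs}"
  shows "hom_word gr (permute_list \<rho> ns) (permute_list \<rho> xs)"
  using assms permutes_in_image[OF assms(2)]
  by (simp add: list_all2_conv_all_nth permute_list_nth)

lemma tswap_short:
  assumes "graded_space gr" "hom_word gr ns xs" "length xs \<le> Suc j"
  shows "tswap gr j (tword xs) = tword xs"
  unfolding tswap_def using assms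
  by (simp add: tensor_permute_tword[OF adjacent_permutes] adjacent_def koszul_sign_id)

text \<open>The cocycle property of the Koszul sign for an adjacent transposition: the sign read off
  the permuted degrees is exactly the factor supplied by
  \<open>koszul_sign_adjacent\<close>.\<close>

lemma tswap_permuted:
  assumes gr: "graded_space gr" "hom_word gr ns xs" and \<rho>: "\<rho> permutes {..<length xs}" "Suc j < length xs"
  shows "tswap gr j (koszul_sign \<rho> ns *\<^sub>R tword (permute_list \<rho> xs)) =
    koszul_sign (\<rho> \<circ> Transposition.transpose j (Suc j)) ns *\<^sub>R tword (permute_list (\<rho> \<circ> Transposition.transpose j (Suc j)) xs)"
proof -
  let ?s = "Transposition.transpose j (Suc j)"
  have len: "length ns = length xs" using gr(2) by (rule list_all2_lengthD)
  have s: "?s permutes {..<length xs}" using \<rho>(2) by (intro permutes_swap_id) auto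
  have "koszul_sign ?s (permute_list \<rho> ns) =
      (-1) powi ((ns ! \<rho> j - 1) * (ns ! \<rho> (Suc j) - 1))"
    using koszul_sign_adjacent[of id "permute_list \<rho> ns" j] \<rho> len
    by (simp add: permutes_id koszul_sign_id permute_list_nth)
  moreover have "tswap gr j (tword (permute_list \<rho> xs)) =
      koszul_sign ?s (permute_list \<rho> ns) *\<^sub>R tword (permute_list ?s (permute_list \<rho> xs))"
    unfolding tswap_def using \<rho>(2)
    by (simp add: tensor_permute_tword[OF adjacent_permutes gr(1) hom_word_permute[OF gr(2) \<rho>(1)]] adjacent_def)
  ultimately show ?thesis
    using koszul_sign_adjacent[of \<rho> ns j] \<rho> len
    by (simp add: linear_scale[OF linear_tswap[OF gr(1)]] permute_list_compose[OF s])
qed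

lemma tswap_tword:
  assumes gr: "graded_space gr" and h: "hom_word gr us u" "a \<in> gr n" "b \<in> gr m" "hom_word gr ws w"
  shows "tswap gr (length u) (tword (u @ a # b # w)) = (-1) powi ((n - 1) * (m - 1)) *\<^sub>R tword (u @ b # a # w)"
proof -
  let ?xs = "u @ a # b # w" and ?ns = "us @ n # m # ws" and ?s = "Transposition.transpose (length u) (Suc (length u))"
  have len: "length us = length u" using h(1) by (rule list_all2_lengthD)
  have hom: "hom_word gr ?ns ?xs" using h by (simp add: list_all2_appendI)
  have "permute_list ?s ?xs = u @ b # a # w"
  proof (rule nth_equalityI)
    fix i assume "i < length (permute_list ?s ?xs)"
    then have i: "permute_list ?s ?xs ! i = ?xs ! ?s i" by (simp add: permute_list_def del: upt_Suc)
    consider "i = length u" | "i = Suc (length u)" | "i \<noteq> length u" "i \<noteq> Suc (length u)" by blast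
    then show "permute_list ?s ?xs ! i = (u @ b # a # w) ! i"
      unfolding i by cases (simp_all add: Transposition.transpose_def nth_append nth_Cons')
  qed simp
  moreover have "koszul_sign ?s ?ns = (-1) powi ((n - 1) * (m - 1))"
    using koszul_sign_adjacent[of id ?ns "length u"] len by (simp add: permutes_id koszul_sign_id nth_append)
  moreover have "tswap gr (length u) (tword ?xs) = koszul_sign ?s ?ns *\<^sub>R tword (permute_list ?s ?xs)"
    unfolding tswap_def by (simp add: tensor_permute_tword[OF adjacent_permutes gr hom] adjacent_def)
  ultimately show ?thesis by simp
qed

text \<open>The factor of the head stands on the right, in accordance with
  \<open>foldr (tswap gr) js\<close>, where the head acts last: a transposition acting after
  \<open>permute_list \<rho>\<close> is composed with \<open>\<rho>\<close> on the right.\<close>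

primrec adjacent_product :: "nat list \<Rightarrow> nat \<Rightarrow> nat" where
  "adjacent_product [] = id"
| "adjacent_product (j # js) = adjacent_product js \<circ> Transposition.transpose j (Suc j)"

lemma adjacent_product_append: "adjacent_product (js @ ks) = adjacent_product ks \<circ> adjacent_product js"
  by (induction js) (simp_all add: comp_assoc)

lemma adjacent_product_permutes:
  assumes "\<forall>j\<in>set js. Suc j < n"
  shows "adjacent_product js permutes {..<n}"
  using assms by (induction js) (auto intro!: permutes_compose permutes_swap_id simp: permutes_id)

text \<open>Conjugating the transposition of \<open>a\<close> and \<open>c\<close> by that of
  \<open>c\<close> and \<open>c + 1\<close> yields the transposition of \<open>a\<close> and
  \<open>c + 1\<close>.\<close>

lemma transpose_adjacent_product:
  assumes "a < b"
  shows "\<exists>js. (\<forall>j\<in>set js. Suc j \<le> b) \<and> Transposition.transpose a b = adjacent_product js"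
  using assms
proof (induction b rule: less_induct)
  case (less b)
  then obtain c where b: "b = Suc c" by (cases b) auto
  show ?case
  proof (cases "a = c")
    case True
    then show ?thesis by (intro exI[of _ "[a]"]) (simp add: b)
  next
    case False
    then have "a < c" using less.prems b by simp
    then obtain js where js: "\<forall>j\<in>set js. Suc j \<le> c" "Transposition.transpose a c = adjacent_product js"
      using less.IH[of c] b by auto
    have "Transposition.transpose a (Suc c) = Transposition.transpose c (Suc c) \<circ> Transposition.transpose a c \<circ> Transposition.transpose c (Suc c)"
      using \<open>a < c\<close> by (auto simp: fun_eq_iff Transposition.transpose_def)
    then have "Transposition.transpose a b = adjacent_product (c # js @ [c])"
      by (simp add: b adjacent_product_append js(2) comp_assoc)
    then show ?thesis using js(1) by (intro exI[of _ "c # js @ [c]"]) (auto simp: b)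
  qed
qed

lemma permutes_adjacent_product:
  assumes "\<rho> permutes {..<n}"
  shows "\<exists>js. (\<forall>j\<in>set js. Suc j < n) \<and> \<rho> = adjacent_product js"
proof -
  have "finite {..<n}" by simp
  with assms show ?thesis
  proof (induction rule: permutes_induct)
    case id
    then show ?case by (intro exI[of _ "[]"]) simp
  next
    case (swap a b p)
    obtain js where js: "\<forall>j\<in>set js. Suc j < n" "p = adjacent_product js" using swap by blast
    obtain ks where ks: "\<forall>j\<in>set ks. Suc j < n" "Transposition.transpose a b = adjacent_product ks"
    proof (cases a b rule: linorder_cases)
      case equal
      then show ?thesis by (intro that[of "[]"]) auto
    next
      case less
      then show ?thesis using transpose_adjacent_product[OF less] swap.hyps that
        by (metis lessThan_iff order_le_less_trans)
    next
      case greater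
      then show ?thesis using transpose_adjacent_product[OF greater] swap.hyps that
        by (metis lessThan_iff order_le_less_trans transpose_commute)
    qed
    show ?case using js ks by (intro exI[of _ "js @ ks"]) (auto simp: adjacent_product_append)
  qed
qed

section \<open>Length components and the action of general permutations\<close>

definition tensor_length :: "nat \<Rightarrow> 'a::real_vector tensor set" where
  "tensor_length n = span {tword xs |xs. length xs = n}"

lemma subspace_tensor_length: "subspace (tensor_length n)"
  by (simp add: tensor_length_def subspace_span)

lemma tword_tensor_length: "tword xs \<in> tensor_length (length xs)"
  by (auto simp: tensor_length_def intro: span_base)

lemma tensor_length_hom_span:
  assumes "graded_space gr"
  shows "tensor_length n = span {tword xs |ns xs. hom_word gr ns xs \<and> length xs = n}"
proof
  show "tensor_length n \<subseteq> span {tword xs |ns xs. hom_word gr ns xs \<and> length xs = n}"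
    unfolding tensor_length_def using span_hom_words[OF assms] by (intro span_minimal) auto
  show "span {tword xs |ns xs. hom_word gr ns xs \<and> length xs = n} \<subseteq> tensor_length n"
    unfolding tensor_length_def by (intro span_mono) auto
qed

lemma linear_eq_on_tensor_length:
  assumes "graded_space gr" "linear A" "linear B" "t \<in> tensor_length n"
    "\<And>ns xs. hom_word gr ns xs \<Longrightarrow> length xs = n \<Longrightarrow> A (tword xs) = B (tword xs)"
  shows "A t = B t"
  by (rule linear_eq_on_span[OF assms(2,3) _ assms(4)[unfolded tensor_length_hom_span[OF assms(1)]]])
    (auto simp: assms(5))

lemma linear_foldr:
  assumes "\<And>j. linear (A j)"
  shows "linear (foldr A js)"
  by (induction js) (use assms in \<open>auto intro: linear_compose simp: linear_iff\<close>)

text \<open>Reduces the signed action on a fixed tensor power to adjacent swaps, for which alone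
  equivariance is then checked.\<close>

lemma tensor_permute_adjacent_product:
  assumes gr: "graded_space gr" and \<pi>: "\<And>k. \<pi> k permutes {..<k}"
    and js: "\<pi> n = adjacent_product js" "\<forall>j\<in>set js. Suc j < n" and t: "t \<in> tensor_length n"
  shows "tensor_permute gr \<pi> t = foldr (tswap gr) js t"
proof (rule linear_eq_on_tensor_length[OF gr linear_tensor_permute[OF \<pi> gr] linear_foldr[OF linear_tswap[OF gr]] t])
  fix ns xs assume h: "hom_word gr ns xs" "length xs = n"
  have "foldr (tswap gr) js (tword xs) =
      koszul_sign (adjacent_product js) ns *\<^sub>R tword (permute_list (adjacent_product js) xs)"
    using js(2)
  proof (induction js)
    case Nil
    then show ?case by (simp add: koszul_sign_id[unfolded id_def])
  next
    case (Cons j js)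
    then show ?case
      using tswap_permuted[OF gr h(1) adjacent_product_permutes[of js "length xs"], of j] h(2)
      by (simp add: comp_def)
  qed
  then show "tensor_permute gr \<pi> (tword xs) = foldr (tswap gr) js (tword xs)"
    using js(1) h(2) by (simp add: tensor_permute_tword[OF \<pi> gr h(1)])
qed

definition tensor_proj :: "nat \<Rightarrow> 'a::real_vector tensor \<Rightarrow> 'a tensor" where
  "tensor_proj n = tensor_lift (\<lambda>xs. if length xs = n then tword xs else 0)"

lemma multilinear_tensor_proj: "multilinear_words (\<lambda>xs. if length xs = n then tword xs else 0)"
  by (rule multilinear_words_if[OF multilinear_words_tword])

lemma linear_tensor_proj: "linear (tensor_proj n)"
  unfolding tensor_proj_def by (rule linear_tensor_lift[OF multilinear_tensor_proj])

lemma tensor_proj_tword: "tensor_proj n (tword xs) = (if length xs = n then tword xs else 0)"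
  unfolding tensor_proj_def by (rule tensor_lift_tword[OF multilinear_tensor_proj])

lemma linear_in_subspace_on_words:
  assumes "linear A" "subspace U" "\<And>xs. A (tword xs) \<in> U"
  shows "A t \<in> U"
proof -
  have "A ` span (range tword) \<subseteq> U"
    unfolding linear_span_image[OF assms(1), symmetric] by (intro span_minimal assms(2)) (auto simp: assms(3))
  then show ?thesis using span_tword[of t] by blast
qed

lemma tensor_proj_in: "tensor_proj n t \<in> tensor_length n"
  by (rule linear_in_subspace_on_words[OF linear_tensor_proj subspace_tensor_length])
    (auto simp: tensor_proj_tword tword_tensor_length subspace_0[OF subspace_tensor_length])

lemma tensor_proj_sum: "\<exists>N. \<forall>M\<ge>N. (\<Sum>n<M. tensor_proj n t) = t"
  using span_tword[of t]
proof (induction rule: span_induct_alt)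
  case base
  then show ?case by (simp add: linear_0[OF linear_tensor_proj])
next
  case (step c x y)
  then obtain xs N where x: "x = tword xs" and N: "\<And>M. M \<ge> N \<Longrightarrow> (\<Sum>n<M. tensor_proj n y) = y" by auto
  have "(\<Sum>n<M. tensor_proj n (c *\<^sub>R x + y)) = c *\<^sub>R x + y" if "M \<ge> max N (Suc (length xs))" for M
    using that N[of M]
    by (simp add: linear_add[OF linear_tensor_proj] linear_scale[OF linear_tensor_proj] sum.distrib
        scaleR_sum_right[symmetric] x tensor_proj_tword)
  then show ?case by blast
qed

lemma tensor_proj_cases: "\<exists>N. (\<Sum>n<N. tensor_proj n t) = t"
  using tensor_proj_sum[of t] by (metis order_refl)

lemma tensor_length_in_words:
  assumes "subspace U" "\<And>xs. length xs = n \<Longrightarrow> tword xs \<in> U" "t \<in> tensor_length n"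
  shows "t \<in> U"
  using assms span_minimal[of "{tword xs |xs. length xs = n}" U] by (auto simp: tensor_length_def)

lemma linear_maps_tensor_length:
  assumes "graded_space gr" "linear A" "subspace U" "t \<in> tensor_length n"
    "\<And>ns xs. hom_word gr ns xs \<Longrightarrow> length xs = n \<Longrightarrow> A (tword xs) \<in> U"
  shows "A t \<in> U"
proof -
  have "A ` tensor_length n \<subseteq> U"
    unfolding tensor_length_hom_span[OF assms(1)] linear_span_image[OF assms(2), symmetric]
    by (intro span_minimal assms(3)) (auto simp: assms(5))
  then show ?thesis using assms(4) by blast
qed

lemma tensor_permute_tensor_length:
  assumes "graded_space gr" "\<And>k. \<pi> k permutes {..<k}" "t \<in> tensor_length n"
  shows "tensor_permute gr \<pi> t \<in> tensor_length n"
proof (rule linear_maps_tensor_length[OF assms(1) linear_tensor_permute[OF assms(2,1)] subspace_tensor_length assms(3)])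
  fix ns xs assume h: "hom_word gr ns xs" "length xs = n"
  show "tensor_permute gr \<pi> (tword xs) \<in> tensor_length n"
    unfolding tensor_permute_tword[OF assms(2,1) h(1)] using tword_tensor_length[of "permute_list _ xs"]
    by (intro subspace_scale[OF subspace_tensor_length]) (simp add: h(2)[symmetric])
qed

lemma tensor_proj_of_length:
  assumes "t \<in> tensor_length n"
  shows "tensor_proj m t = (if m = n then t else 0)"
proof -
  have *: "t \<in> {t. tensor_proj m t = (if m = n then t else 0)}"
  proof (rule tensor_length_in_words[OF _ _ assms])
    show "subspace {t. tensor_proj m t = (if m = n then t else 0)}"
      by (auto simp: subspace_def linear_0[OF linear_tensor_proj] linear_add[OF linear_tensor_proj]
          linear_scale[OF linear_tensor_proj])
  qed (simp add: tensor_proj_tword)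
  then show ?thesis by simp
qed

text \<open>The factorization of \<open>\<pi> n\<close> into swaps depends on \<open>n\<close>, so
  the argument runs on each length component, and the components are summed at the end.\<close>

lemma tensor_permute_commute:
  assumes gr: "graded_space gr1" "graded_space gr2" and A: "linear A"
    and len: "\<And>n t. t \<in> tensor_length n \<Longrightarrow> A t \<in> tensor_length n"
    and swap: "\<And>j t. A (tswap gr1 j t) = tswap gr2 j (A t)" and \<pi>: "\<And>k. \<pi> k permutes {..<k}"
  shows "A (tensor_permute gr1 \<pi> t) = tensor_permute gr2 \<pi> (A t)"
proof -
  note lin = linear_sum[OF linear_tensor_permute[OF \<pi> gr(1)]] linear_sum[OF linear_tensor_permute[OF \<pi> gr(2)]]
    linear_sum[OF A]
  have main: "A (tensor_permute gr1 \<pi> t) = tensor_permute gr2 \<pi> (A t)" if t: "t \<in> tensor_length n" for n t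
  proof -
    obtain js where js: "\<forall>j\<in>set js. Suc j < n" "\<pi> n = adjacent_product js"
      using permutes_adjacent_product[OF \<pi>] by blast
    have "A (foldr (tswap gr1) ks t) = foldr (tswap gr2) ks (A t)" for ks
      by (induction ks) (simp_all add: swap)
    then show ?thesis
      unfolding tensor_permute_adjacent_product[OF gr(1) \<pi> js(2,1) t]
        tensor_permute_adjacent_product[OF gr(2) \<pi> js(2,1) len[OF t]] .
  qed
  obtain N where "(\<Sum>n<N. tensor_proj n t) = t" using tensor_proj_cases by blast
  moreover have "A (tensor_permute gr1 \<pi> (\<Sum>n<N. tensor_proj n t)) =
      tensor_permute gr2 \<pi> (A (\<Sum>n<N. tensor_proj n t))"
    by (simp add: lin main[OF tensor_proj_in])
  ultimately show ?thesis by metis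
qed

lemma tensor_proj_permute:
  assumes gr: "graded_space gr" and \<pi>: "\<And>k. \<pi> k permutes {..<k}"
  shows "tensor_proj n (tensor_permute gr \<pi> t) = tensor_permute gr \<pi> (tensor_proj n t)"
proof -
  note lin = linear_tensor_permute[OF \<pi> gr]
  show ?thesis
  proof (rule linear_eq_on_hom_words[OF gr, of "\<lambda>t. tensor_proj n (tensor_permute gr \<pi> t)"])
    show "linear (\<lambda>t. tensor_proj n (tensor_permute gr \<pi> t))" "linear (\<lambda>t. tensor_permute gr \<pi> (tensor_proj n t))"
      using linear_compose[OF lin linear_tensor_proj] linear_compose[OF linear_tensor_proj lin] by (simp_all add: o_def)
    fix ns xs
    show "tensor_proj n (tensor_permute gr \<pi> (tword xs)) = tensor_permute gr \<pi> (tensor_proj n (tword xs))"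
      using tensor_proj_of_length[OF tensor_permute_tensor_length[OF gr \<pi> tword_tensor_length]]
      by (simp add: tensor_proj_tword linear_0[OF lin])
  qed
qed

text \<open>Adjacent transpositions generate the symmetric groups. The factorization varies with the
  length, so the tensor is split into length components; these are again fixed by all swaps, because
  projecting to a length commutes with permuting.\<close>

lemma tensor_permute_fixed_iff:
  assumes gr: "graded_space gr"
  shows "(\<forall>\<pi>. (\<forall>k. \<pi> k permutes {..<k}) \<longrightarrow> tensor_permute gr \<pi> t = t) \<longleftrightarrow> (\<forall>j. tswap gr j t = t)"
proof safe
  fix j assume "\<forall>\<pi>. (\<forall>k. \<pi> k permutes {..<k}) \<longrightarrow> tensor_permute gr \<pi> t = t"
  then show "tswap gr j t = t" unfolding tswap_def using adjacent_permutes by blast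
next
  fix \<pi> :: "nat \<Rightarrow> nat \<Rightarrow> nat" assume fixed: "\<forall>j. tswap gr j t = t" and \<pi>: "\<forall>k. \<pi> k permutes {..<k}"
  have "tswap gr j (tensor_proj n t) = tensor_proj n t" for j n
    using fixed tensor_proj_permute[OF gr, of "adjacent j" n t] adjacent_permutes by (simp add: tswap_def)
  then have "foldr (tswap gr) js (tensor_proj n t) = tensor_proj n t" for js n
    by (induction js) simp_all
  moreover have "\<exists>js. tensor_permute gr \<pi> (tensor_proj n t) = foldr (tswap gr) js (tensor_proj n t)" for n
    using tensor_permute_adjacent_product[OF gr _ _ _ tensor_proj_in] permutes_adjacent_product[of "\<pi> n" n] \<pi>
    by metis
  ultimately have "tensor_permute gr \<pi> (tensor_proj n t) = tensor_proj n t" for n by metis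
  moreover have "linear (tensor_permute gr \<pi>)" using linear_tensor_permute[OF _ gr] \<pi> by blast
  ultimately have "tensor_permute gr \<pi> (\<Sum>n<N. tensor_proj n t) = (\<Sum>n<N. tensor_proj n t)" for N
    by (simp add: linear_sum)
  moreover obtain N where "(\<Sum>n<N. tensor_proj n t) = t" using tensor_proj_cases by blast
  ultimately show "tensor_permute gr \<pi> t = t" by metis
qed

section \<open>Moving blocks\<close>

text \<open>\<open>move_right gr i k\<close> carries the letter at position \<open>i\<close> past
  the next \<open>k\<close> letters, \<open>move_left gr i k\<close> undoes such a move, and
  \<open>move_block gr i k k'\<close> exchanges neighbouring blocks of \<open>k\<close> and
  \<open>k'\<close> letters. Being composed of swaps, all of them fix a tensor that is fixed by
  every swap.\<close>

primrec move_right :: "(int \<Rightarrow> 'a::real_vector set) \<Rightarrow> nat \<Rightarrow> nat \<Rightarrow> 'a tensor \<Rightarrow> 'a tensor" where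
  "move_right gr i 0 t = t"
| "move_right gr i (Suc k) t = move_right gr (Suc i) k (tswap gr i t)"

primrec move_left :: "(int \<Rightarrow> 'a::real_vector set) \<Rightarrow> nat \<Rightarrow> nat \<Rightarrow> 'a tensor \<Rightarrow> 'a tensor" where
  "move_left gr i 0 t = t"
| "move_left gr i (Suc k) t = tswap gr i (move_left gr (Suc i) k t)"

primrec move_block :: "(int \<Rightarrow> 'a::real_vector set) \<Rightarrow> nat \<Rightarrow> nat \<Rightarrow> nat \<Rightarrow> 'a tensor \<Rightarrow> 'a tensor" where
  "move_block gr i 0 k' t = t"
| "move_block gr i (Suc k) k' t = move_right gr i k' (move_block gr (Suc i) k k' t)"

lemma linear_move_right: "graded_space gr \<Longrightarrow> linear (move_right gr i k)"
  by (induction k arbitrary: i)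
    (auto simp: linear_iff linear_add[OF linear_tswap] linear_scale[OF linear_tswap])

lemma linear_move_left: "graded_space gr \<Longrightarrow> linear (move_left gr i k)"
  by (induction k arbitrary: i)
    (auto simp: linear_iff linear_add[OF linear_tswap] linear_scale[OF linear_tswap])

lemma linear_move_block: "graded_space gr \<Longrightarrow> linear (move_block gr i k k')"
  by (induction k arbitrary: i)
    (auto simp: linear_iff linear_add[OF linear_move_right] linear_scale[OF linear_move_right])

lemma move_fixed:
  assumes "\<And>j. tswap gr j t = t"
  shows "move_right gr i k t = t" "move_left gr i k t = t" "move_block gr i k k' t = t"
proof -
  show *: "move_right gr i k t = t" for i k by (induction k arbitrary: i) (simp_all add: assms)
  show "move_left gr i k t = t" by (induction k arbitrary: i) (simp_all add: assms)
  show "move_block gr i k k' t = t" by (induction k arbitrary: i) (simp_all add: assms *)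
qed

lemma move_right_tword:
  assumes gr: "graded_space gr" and h: "hom_word gr us u" "a \<in> gr n" "hom_word gr vs v" "hom_word gr ws w"
  shows "move_right gr (length u) (length v) (tword (u @ a # v @ w)) =
    (-1) powi ((n - 1) * sdeg vs) *\<^sub>R tword (u @ v @ a # w)"
  using h(3,1)
proof (induction vs v arbitrary: us u rule: list_all2_induct)
  case (Cons m vs b v)
  have "hom_word gr (us @ [m]) (u @ [b])" using Cons by (simp add: list_all2_appendI)
  note IH = Cons.IH[OF this]
  have "tswap gr (length u) (tword (u @ a # b # (v @ w))) =
      (-1) powi ((n - 1) * (m - 1)) *\<^sub>R tword (u @ b # a # (v @ w))"
    by (rule tswap_tword[OF gr Cons.prems h(2) Cons.hyps(1)]) (use Cons h(4) in \<open>auto intro: list_all2_appendI\<close>)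
  then show ?case
    using IH by (simp add: linear_scale[OF linear_move_right[OF gr]] neg_one_powi)
qed simp

lemma move_left_tword:
  assumes gr: "graded_space gr" and h: "hom_word gr us u" "a \<in> gr n" "hom_word gr vs v" "hom_word gr ws w"
  shows "move_left gr (length u) (length v) (tword (u @ v @ a # w)) =
    (-1) powi ((n - 1) * sdeg vs) *\<^sub>R tword (u @ a # v @ w)"
  using h(3,1)
proof (induction vs v arbitrary: us u rule: list_all2_induct)
  case (Cons m vs b v)
  have "hom_word gr (us @ [m]) (u @ [b])" using Cons by (simp add: list_all2_appendI)
  note IH = Cons.IH[OF this]
  have "tswap gr (length u) (tword (u @ b # a # (v @ w))) =
      (-1) powi ((m - 1) * (n - 1)) *\<^sub>R tword (u @ a # b # (v @ w))"
    by (rule tswap_tword[OF gr Cons.prems Cons.hyps(1) h(2)]) (use Cons h(4) in \<open>auto intro: list_all2_appendI\<close>)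
  then show ?case
    using IH by (simp add: linear_scale[OF linear_tswap[OF gr]] neg_one_powi)
qed simp

lemma move_block_tword:
  assumes gr: "graded_space gr" and h: "hom_word gr us u" "hom_word gr vs v" "hom_word gr vs' v'" "hom_word gr ws w"
  shows "move_block gr (length u) (length v) (length v') (tword (u @ v @ v' @ w)) =
    (-1) powi (sdeg vs * sdeg vs') *\<^sub>R tword (u @ v' @ v @ w)"
  using h(2,1)
proof (induction vs v arbitrary: us u rule: list_all2_induct)
  case (Cons m vs b v)
  have "hom_word gr (us @ [m]) (u @ [b])" using Cons by (simp add: list_all2_appendI)
  note IH = Cons.IH[OF this]
  have "move_right gr (length u) (length v') (tword (u @ b # v' @ (v @ w))) =
      (-1) powi ((m - 1) * sdeg vs') *\<^sub>R tword (u @ v' @ b # (v @ w))"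
    by (rule move_right_tword[OF gr Cons.prems Cons.hyps(1) h(3)]) (use Cons h(4) in \<open>auto intro: list_all2_appendI\<close>)
  then show ?case
    using IH by (simp add: linear_scale[OF linear_move_right[OF gr]] neg_one_powi)
qed simp

section \<open>The signed cyclic rotation\<close>

lemma cyclic_generator_adjacent_product:
  "cyclic_generator n = adjacent_product [0..<n - 1]"
proof -
  \<comment> \<open>The last letter travels to the front through neighbouring places. The statement
    is generalized to intervals and proved by induction from the lower end, where the list of swaps
    is unfolded.\<close>
  have *: "adjacent_product [a..<b] i = (if i = a then b else if a < i \<and> i \<le> b then i - 1 else i)"
    if "a \<le> b" for a b i
    using that
  proof (induction "b - a" arbitrary: a i)
    case 0
    then show ?case by simp
  next
    case (Suc d)
    then have "[a..<b] = a # [Suc a..<b]" by (simp add: upt_conv_Cons)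
    then show ?case using Suc(1)[of "Suc a"] Suc(2,3) by (auto simp: Transposition.transpose_def)
  qed
  show ?thesis
  proof
    fix i
    show "cyclic_generator n i = adjacent_product [0..<n - 1] i"
      using *[of 0 "n - 1" i] by (cases i) (auto simp: cyclic_generator_def mod_if)
  qed
qed

lemma cyclic_generator_permutes: "cyclic_generator n permutes {..<n}"
  unfolding cyclic_generator_adjacent_product by (rule adjacent_product_permutes) auto

definition trotate :: "(int \<Rightarrow> 'a::real_vector set) \<Rightarrow> 'a tensor \<Rightarrow> 'a tensor" where
  "trotate gr = tensor_permute gr cyclic_generator"

lemma linear_trotate: "graded_space gr \<Longrightarrow> linear (trotate gr)"
  unfolding trotate_def by (rule linear_tensor_permute[OF cyclic_generator_permutes])

lemma trotate_move_left:
  assumes "graded_space gr" "t \<in> tensor_length (Suc n)"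
  shows "trotate gr t = move_left gr 0 n t"
proof -
  have "foldr (tswap gr) [i..<i + k] t = move_left gr i k t" for i k
  proof (induction k arbitrary: i)
    case (Suc k)
    show ?case using Suc[of "Suc i"] by (simp add: upt_conv_Cons del: upt_Suc)
  qed simp
  from this[of 0 n] tensor_permute_adjacent_product[OF assms(1) cyclic_generator_permutes
      cyclic_generator_adjacent_product _ assms(2)]
  show ?thesis by (simp add: trotate_def)
qed

lemma trotate_tword:
  assumes gr: "graded_space gr" and h: "hom_word gr us u" "a \<in> gr n"
  shows "trotate gr (tword (u @ [a])) = (-1) powi ((n - 1) * sdeg us) *\<^sub>R tword (a # u)"
proof -
  have "tword (u @ [a]) \<in> tensor_length (Suc (length u))" using tword_tensor_length[of "u @ [a]"] by simp
  from trotate_move_left[OF gr this] show ?thesis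
    using move_left_tword[OF gr list.rel_intros(1) h(2,1) list.rel_intros(1)] by simp
qed

text \<open>Induction on \<open>v\<close> from its right end, since each rotation takes the last
  letter. A letter of \<open>v\<close> passes the other letters of \<open>v\<close> twice in total,
  and the two signs cancel, so only the sign against \<open>u\<close> remains.\<close>

lemma trotate_power_tword:
  assumes gr: "graded_space gr" and h: "hom_word gr vs v" "hom_word gr us u"
  shows "(trotate gr ^^ length v) (tword (u @ v)) = (-1) powi (sdeg us * sdeg vs) *\<^sub>R tword (v @ u)"
  using h
proof (induction v arbitrary: vs us u rule: rev_induct)
  case Nil
  then show ?case by simp
next
  case (snoc b v)
  obtain m vs' where vs: "vs = vs' @ [m]" "hom_word gr vs' v" "b \<in> gr m"
    using snoc.prems(1) by (auto simp: list_all2_append2 list_all2_Cons2)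
  have h': "hom_word gr (us @ vs') (u @ v)" "hom_word gr (m # us) (b # u)"
    using vs snoc.prems(2) by (auto intro: list_all2_appendI)
  have lin: "linear (trotate gr ^^ k)" for k
    by (induction k) (auto simp: linear_iff linear_add[OF linear_trotate[OF gr]] linear_scale[OF linear_trotate[OF gr]])
  have "(trotate gr ^^ length (v @ [b])) (tword (u @ v @ [b])) =
      (trotate gr ^^ length v) (trotate gr (tword ((u @ v) @ [b])))"
    by (simp add: funpow_swap1)
  also have "\<dots> = (-1) powi ((m - 1) * (sdeg us + sdeg vs')) *\<^sub>R
      (trotate gr ^^ length v) (tword ((b # u) @ v))"
    unfolding trotate_tword[OF gr h'(1) vs(3)] by (simp add: linear_scale[OF lin])
  also have "(trotate gr ^^ length v) (tword ((b # u) @ v)) =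
      (-1) powi ((m - 1 + sdeg us) * sdeg vs') *\<^sub>R tword (v @ b # u)"
    using snoc.IH[OF vs(2) h'(2)] by simp
  finally show ?case by (simp add: vs(1) neg_one_powi)
qed

lemma trotate_fixed_power:
  assumes "trotate gr t = t"
  shows "(trotate gr ^^ k) t = t"
  by (induction k) (simp_all add: assms)

section \<open>Coefficients of multilinear maps and of words\<close>

lemma multilinear_words_ncoeffI:
  assumes "\<And>s q. multilinear_words (\<lambda>xs. ncoeff (\<phi> xs) s q)"
  shows "multilinear_words \<phi>"
  using assms unfolding multilinear_words_def by (auto intro!: nov_eqI)

lemma multilinear_words_ncoeff:
  "multilinear_words \<phi> \<Longrightarrow> multilinear_words (\<lambda>xs. ncoeff (\<phi> xs) s q)"
  by (rule multilinear_words_compose[OF _ linear_ncoeff])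

lemma nov_const_add: "nov_const (x + y) = nov_const x + (nov_const y :: 'a::real_vector nov)"
  by (rule nov_eqI) (simp add: ncoeff_nov_const)

lemma nov_const_scale: "nov_const (r *\<^sub>R x) = r *\<^sub>R (nov_const x :: 'a::real_vector nov)"
  by (rule nov_eqI) (simp add: ncoeff_nov_const)

lemma nov_smult_const: "nov_smult (nov_const r) x = r *\<^sub>R x"
  unfolding nov_smult_def by (rule nov_extend_const) simp

lemma multilinear_words_const_of_nov_multilinear:
  assumes "nov_multilinear f"
  shows "multilinear_words (\<lambda>xs. f (map nov_const xs))"
  using assms unfolding nov_multilinear_def multilinear_words_def
  by (simp add: nov_const_add nov_const_scale nov_smult_const[symmetric])

lemma tensor_cons_tword: "tensor_cons v (tword xs) = tword (v # xs)"
  unfolding tensor_cons_def by (rule tensor_lift_tword[OF multilinear_words_tl[OF multilinear_words_tword]])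

lemma linear_tensor_cons: "linear (tensor_cons v)"
  unfolding tensor_cons_def by (rule linear_tensor_lift[OF multilinear_words_tl[OF multilinear_words_tword]])

lemma linear_tensor_cons_left: "linear (\<lambda>v. tensor_cons v t)"
proof (rule linearI)
  note lin = multilinear_words_linear_hd[OF multilinear_words_tword]
  fix u v :: 'a and r :: real
  have "linear (\<lambda>t. tensor_cons u t + tensor_cons v t)" "linear (\<lambda>t. r *\<^sub>R tensor_cons v t)" for v
    by (intro linear_compose_add linear_compose_scale_right linear_tensor_cons)+
  then show "tensor_cons (u + v) t = tensor_cons u t + tensor_cons v t"
    "tensor_cons (r *\<^sub>R u) t = r *\<^sub>R tensor_cons u t"
    using linear_eq_on_words[of "tensor_cons (u + v)" "\<lambda>t. tensor_cons u t + tensor_cons v t" t]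
      linear_eq_on_words[of "tensor_cons (r *\<^sub>R u)" "\<lambda>t. r *\<^sub>R tensor_cons u t" t]
    by (simp_all add: linear_tensor_cons tensor_cons_tword linear_add[OF lin] linear_scale[OF lin])
qed

lemma linear_nov_map_tensor_cons: "linear (\<lambda>v. nov_map (tensor_cons v) t)"
  by (rule linearI; rule nov_eqI)
    (simp_all add: ncoeff_nov_map linear_tensor_cons linear_add[OF linear_tensor_cons_left]
      linear_scale[OF linear_tensor_cons_left])

lemma nov_word_Cons_const: "nov_word (nov_const x # as) = nov_map (tensor_cons x) (nov_word as)"
  by (simp add: nov_extend_const linear_0[OF linear_nov_map_tensor_cons])

lemma nov_map_const: "linear g \<Longrightarrow> nov_map g (nov_const v) = nov_const (g v)"
  by (rule nov_eqI) (simp add: ncoeff_nov_map ncoeff_nov_const linear_0)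

lemma nov_word_const: "nov_word (map nov_const xs) = nov_const (tword xs)"
  by (induction xs)
    (simp_all add: nov_word_Cons_const nov_map_const linear_tensor_cons tensor_cons_tword del: nov_word.simps(2))

text \<open>With a single letter that is not constant there is no convolution of
  coefficients.\<close>

lemma ncoeff_nov_word_insert:
  "ncoeff (nov_word (map nov_const u @ a # map nov_const w)) s q = tword (u @ ncoeff a s q # w)"
proof (induction u)
  case Nil
  have "nov_word (a # map nov_const w) = nov_map (\<lambda>v. tword (v # w)) a"
    by (simp add: nov_word_const nov_map_const linear_tensor_cons tensor_cons_tword nov_map_def[of "\<lambda>v. tword (v # w)"])
  then show ?case by (simp add: ncoeff_nov_map multilinear_words_linear_hd multilinear_words_tword)
next
  case (Cons x u)
  then show ?case
    by (simp add: nov_word_Cons_const ncoeff_nov_map linear_tensor_cons tensor_cons_tword del: nov_word.simps(2))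
qed

text \<open>For a gapped family this is the component with index
  \<open>\<beta> = (s, 2 * q)\<close>, in all arities at once.\<close>

definition coeff_map :: "('a::real_vector nov list \<Rightarrow> 'b::real_vector nov) \<Rightarrow> real \<Rightarrow> int \<Rightarrow> 'a list \<Rightarrow> 'b" where
  "coeff_map f s q xs = ncoeff (f (map nov_const xs)) s q"

definition homogeneous_maps ::
  "(int \<Rightarrow> 'a::real_vector set) \<Rightarrow> (int \<Rightarrow> 'b::real_vector set) \<Rightarrow> int \<Rightarrow> ('a list \<Rightarrow> 'b) \<Rightarrow> bool" where
  "homogeneous_maps gr1 gr2 d \<mu> \<longleftrightarrow> multilinear_words \<mu> \<and>
     (\<forall>ns xs. hom_word gr1 ns xs \<longrightarrow> \<mu> xs \<in> gr2 (sdeg ns + d + 1))"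

lemma nov_const_degree:
  assumes "graded_space gr" "x \<in> gr n"
  shows "nov_const x \<in> nov_degree gr n"
  using assms subspace_0[OF graded_subspace[OF assms(1)]] by (auto simp: nov_degree_def ncoeff_nov_const)

lemma filtered_maps_degree:
  assumes "filtered_maps gr1 gr2 d f" "graded_space gr1" "hom_word gr1 ns xs"
  shows "f (map nov_const xs) \<in> nov_degree gr2 (sdeg ns + d + 1)"
proof -
  have "list_all2 (\<lambda>n x. x \<in> nov_degree gr1 n) ns (map nov_const xs)"
    using assms(3) unfolding list_all2_map2 by (rule list_all2_mono) (rule nov_const_degree[OF assms(2)])
  then show ?thesis using assms(1) by (simp add: filtered_maps_def)
qed

text \<open>Since \<open>e\<close> has degree 2, the coefficient of \<open>e^q\<close> has its
  degree lowered by \<open>2 * q\<close>. The parity is unchanged, so all coefficients of the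
  operations obey the sign rule for odd maps.\<close>

lemma homogeneous_maps_coeff_map:
  assumes "filtered_maps gr1 gr2 d f" "graded_space gr1"
  shows "homogeneous_maps gr1 gr2 (d - 2 * q) (coeff_map f s q)"
proof -
  have "multilinear_words (\<lambda>xs. f (map nov_const xs))"
    using assms(1) by (intro multilinear_words_const_of_nov_multilinear) (simp add: filtered_maps_def)
  moreover have "coeff_map f s q xs \<in> gr2 (sdeg ns + (d - 2 * q) + 1)" if "hom_word gr1 ns xs" for ns xs
  proof -
    have "coeff_map f s q xs \<in> gr2 (sdeg ns + d + 1 - 2 * q)"
      using filtered_maps_degree[OF assms that] by (auto simp: nov_degree_def coeff_map_def)
    then show ?thesis by (simp add: algebra_simps)
  qed
  ultimately show ?thesis
    unfolding homogeneous_maps_def coeff_map_def[abs_def] by (auto intro: multilinear_words_ncoeff)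
qed

lemma hom_word_split:
  assumes "hom_word gr ns xs" "i \<le> length xs"
  obtains us u ws w where "ns = us @ ws" "xs = u @ w" "length u = i" "hom_word gr us u" "hom_word gr ws w"
proof
  show "ns = take i ns @ drop i ns" "xs = take i xs @ drop i xs" "length (take i xs) = i"
    using assms(2) by simp_all
  show "hom_word gr (take i ns) (take i xs)" "hom_word gr (drop i ns) (drop i xs)"
    using assms(1) by (auto simp: list_all2_conv_all_nth)
qed

lemma hom_word_split_nth:
  assumes "hom_word gr ns xs" "i < length xs"
  obtains us u n a ws w where "ns = us @ n # ws" "xs = u @ a # w" "length u = i"
    "hom_word gr us u" "a \<in> gr n" "hom_word gr ws w"
proof -
  obtain us u ws w where *: "ns = us @ ws" "xs = u @ w" "length u = i" "hom_word gr us u" "hom_word gr ws w"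
    by (rule hom_word_split[OF assms(1), of i]) ((use assms(2) in auto)[1], (rule that; assumption))
  then obtain a w' where "w = a # w'" using assms(2) by (cases w) auto
  with * that show ?thesis by (auto simp: list_all2_Cons2)
qed

lemma hom_word_append: "hom_word gr us u \<Longrightarrow> hom_word gr ws w \<Longrightarrow> hom_word gr (us @ ws) (u @ w)"
  by (rule list_all2_appendI)

lemma tswap_tensor_length_short:
  assumes gr: "graded_space gr" and "t \<in> tensor_length n" "n \<le> Suc j"
  shows "tswap gr j t = t"
  by (rule linear_eq_on_tensor_length[OF gr linear_tswap[OF gr] linear_id[unfolded id_def] assms(2)])
    (use assms(3) in \<open>simp add: tswap_short[OF gr]\<close>)

section \<open>The differential preserves the subcomplexes\<close>

definition insert_sign :: "int list \<Rightarrow> nat \<Rightarrow> real" where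
  "insert_sign ns i = (-1) powi (\<Sum>j<i. ns ! j - 1)"

lemma insert_sign_append: "length us = i \<Longrightarrow> insert_sign (us @ ws) i = (-1) powi sdeg us"
proof -
  assume "length us = i"
  then have "(\<Sum>j<i. (us @ ws) ! j - 1) = sdeg us"
    by (simp add: sum_list_sum_nth atLeast0LessThan nth_append)
  then show ?thesis by (simp add: insert_sign_def)
qed

text \<open>One summand of the differential for one operation \<open>\<mu>\<close>, on words of
  length \<open>n\<close> only. With the length fixed the range of the insertion position
  \<open>i\<close> does not vary with the word, and each summand is a linear map on all
  tensors.\<close>

definition insert_term :: "(int \<Rightarrow> 'a::real_vector set) \<Rightarrow> ('a list \<Rightarrow> 'a) \<Rightarrow> nat \<Rightarrow> nat \<Rightarrow> nat \<Rightarrow> 'a tensor \<Rightarrow> 'a tensor" where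
  "insert_term gr \<mu> n k i = hext gr (\<lambda>ns xs. if length xs = n \<and> i + k \<le> length xs then insert_sign ns i *\<^sub>R
     tword (take i xs @ \<mu> (take k (drop i xs)) # drop (i + k) xs) else 0)"

lemma multilinear_insert:
  assumes "multilinear_words \<mu>"
  shows "multilinear_words (\<lambda>xs. if P (length xs) \<and> i + k \<le> length xs then c *\<^sub>R
    tword (take i xs @ \<mu> (take k (drop i xs)) # drop (i + k) xs) else 0)"
  unfolding multilinear_words_iff_update
proof (intro allI impI)
  fix xs :: "'a list" and p assume p: "p < length xs"
  note upd = multilinear_words_tword[unfolded multilinear_words_iff_update, rule_format]
  let ?f = "\<lambda>x. tword (take i (xs[p := x]) @ \<mu> (take k (drop i (xs[p := x]))) # drop (i + k) (xs[p := x]))"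
  have "linear ?f" if le: "i + k \<le> length xs"
  proof -
    consider "p < i" | "i \<le> p" "p < i + k" | "i + k \<le> p" by linarith
    then show ?thesis
    proof cases
      case 1
      then have "?f = (\<lambda>x. tword ((take i xs @ \<mu> (take k (drop i xs)) # drop (i + k) xs)[p := x]))"
        using le by (simp add: fun_eq_iff take_update_swap list_update_append1)
      then show ?thesis using upd[of p "take i xs @ \<mu> (take k (drop i xs)) # drop (i + k) xs"] 1 le by simp
    next
      case 2
      then have "?f = (\<lambda>x. tword (take i xs @ \<mu> ((take k (drop i xs))[p - i := x]) # drop (i + k) xs))"
        by (simp add: fun_eq_iff take_update_swap[of k] drop_update_swap)
      moreover have "linear (\<lambda>x. \<mu> ((take k (drop i xs))[p - i := x]))"
        using assms[unfolded multilinear_words_iff_update, rule_format, of "p - i" "take k (drop i xs)"] 2 le by simp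
      ultimately show ?thesis
        using linear_compose[OF _ multilinear_words_linear[OF multilinear_words_tword, of "take i xs" "drop (i + k) xs"]]
        by (simp add: o_def)
    next
      case 3
      \<comment> \<open>Behind the block the position drops by \<open>k\<close> and rises by one, as
        a single letter takes the place of the block.\<close>
      then have "?f = (\<lambda>x. tword ((take i xs @ \<mu> (take k (drop i xs)) # drop (i + k) xs)[Suc p - k := x]))"
        using le by (auto simp: fun_eq_iff drop_update_swap list_update_append Suc_diff_le diff_diff_left add.commute
            split: nat.splits)
      then show ?thesis
        using upd[of "Suc p - k" "take i xs @ \<mu> (take k (drop i xs)) # drop (i + k) xs"] 3 le p by simp
    qed
  qed
  then show "linear (\<lambda>x. if P (length (xs[p := x])) \<and> i + k \<le> length (xs[p := x]) then c *\<^sub>R ?f x else 0)"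
    by (cases "P (length xs) \<and> i + k \<le> length xs") (simp_all add: linear_compose_scale_right, auto simp: linear_iff)
qed

context
  fixes gr :: "int \<Rightarrow> 'a::real_vector set" and \<mu> :: "'a list \<Rightarrow> 'a" and d :: int
  assumes gr: "graded_space gr" and \<mu>: "homogeneous_maps gr gr d \<mu>" and d: "odd d"
begin

private lemma ml: "multilinear_words \<mu>"
  using \<mu> by (simp add: homogeneous_maps_def)

private lemma \<mu>_deg: "hom_word gr ns xs \<Longrightarrow> \<mu> xs \<in> gr (sdeg ns + d + 1)"
  using \<mu> by (simp add: homogeneous_maps_def)

private lemma mlF: "multilinear_words (\<lambda>xs. if length xs = n \<and> i + k \<le> length xs then insert_sign ns i *\<^sub>R
     tword (take i xs @ \<mu> (take k (drop i xs)) # drop (i + k) xs) else 0)"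
  by (rule multilinear_insert[OF ml])

lemma linear_insert_term: "linear (insert_term gr \<mu> n k i)"
  unfolding insert_term_def by (rule linear_hext[OF gr mlF])

lemma insert_term_tword:
  assumes "hom_word gr us u" "hom_word gr vs v" "hom_word gr ws w"
    "length u = i" "length v = k" "length (u @ v @ w) = n"
  shows "insert_term gr \<mu> n k i (tword (u @ v @ w)) = (-1) powi sdeg us *\<^sub>R tword (u @ \<mu> v # w)"
proof -
  have "hom_word gr (us @ vs @ ws) (u @ v @ w)" by (intro hom_word_append assms(1-3))
  moreover have "insert_sign (us @ vs @ ws) i = (-1) powi sdeg us"
    by (rule insert_sign_append) (use assms(1,4) in \<open>auto dest: list_all2_lengthD\<close>)
  moreover have "take i (u @ v @ w) @ \<mu> (take k (drop i (u @ v @ w))) # drop (i + k) (u @ v @ w) = u @ \<mu> v # w"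
    using assms(4,5) by simp
  ultimately show ?thesis
    using assms(4-6) unfolding insert_term_def by (subst hext_tword[OF gr mlF]) auto
qed

lemma insert_term_length:
  assumes "t \<in> tensor_length n" "i + k \<le> n"
  shows "insert_term gr \<mu> n k i t \<in> tensor_length (Suc (n - k))"
proof (rule linear_maps_tensor_length[OF gr linear_insert_term subspace_tensor_length assms(1)])
  fix ns xs assume h: "hom_word gr ns xs" "length xs = n"
  obtain us u rs r where 1: "ns = us @ rs" "xs = u @ r" "length u = i" "hom_word gr us u" "hom_word gr rs r"
    by (rule hom_word_split[OF h(1), of i]) ((use assms(2) h(2) in auto)[1], (rule that; assumption))
  obtain vs v ws w where 2: "rs = vs @ ws" "r = v @ w" "length v = k" "hom_word gr vs v" "hom_word gr ws w"
    by (rule hom_word_split[OF 1(5), of k]) ((use assms(2) h(2) 1 in auto)[1], (rule that; assumption))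
  have "insert_term gr \<mu> n k i (tword xs) = (-1) powi sdeg us *\<^sub>R tword (u @ \<mu> v # w)"
    unfolding 1 2 by (rule insert_term_tword) (use 1 2 h in auto)
  moreover have "length (u @ \<mu> v # w) = Suc (n - k)" using 1 2 h by auto
  ultimately show "insert_term gr \<mu> n k i (tword xs) \<in> tensor_length (Suc (n - k))"
    using tword_tensor_length[of "u @ \<mu> v # w"] subspace_scale[OF subspace_tensor_length] by metis
qed

text \<open>Behind the inserted letter, position \<open>j\<close> of the output is position
  \<open>j + k - 1\<close> of the input.\<close>

lemma tswap_insert_term_after:
  assumes "t \<in> tensor_length n" "i < j" "j < n - k" "k \<le> n"
  shows "tswap gr j (insert_term gr \<mu> n k i t) = insert_term gr \<mu> n k i (tswap gr (j + k - 1) t)"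
proof (rule linear_eq_on_tensor_length[OF gr linear_compose[OF linear_insert_term linear_tswap[OF gr], unfolded o_def]
      linear_compose[OF linear_tswap[OF gr] linear_insert_term, unfolded o_def] assms(1)])
  fix ns xs assume h: "hom_word gr ns xs" "length xs = n"
  obtain us u rs r where 1: "ns = us @ rs" "xs = u @ r" "length u = i" "hom_word gr us u" "hom_word gr rs r"
    by (rule hom_word_split[OF h(1), of i]) ((use assms h(2) in auto)[1], (rule that; assumption))
  obtain vs v ws w where 2: "rs = vs @ ws" "r = v @ w" "length v = k" "hom_word gr vs v" "hom_word gr ws w"
    by (rule hom_word_split[OF 1(5), of k]) ((use assms h(2) 1 in auto)[1], (rule that; assumption))
  obtain ps p m a ys y where 3: "ws = ps @ m # ys" "w = p @ a # y" "length p = j - i - 1"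
    "hom_word gr ps p" "a \<in> gr m" "hom_word gr ys y"
    by (rule hom_word_split_nth[OF 2(5), of "j - i - 1"]) ((use assms h(2) 1 2 in auto)[1], (rule that; assumption))
  have "length y > 0" using 1 2 3 h(2) assms by auto
  then obtain b z m' zs where 4: "y = b # z" "ys = m' # zs" "b \<in> gr m'" "hom_word gr zs z"
    using 3(6) by (cases y) (auto simp: list_all2_Cons2)
  have len: "j + k - 1 = length (u @ v @ p)" "j = length (u @ \<mu> v # p)" using 1 2 3 assms by auto
  have hp: "hom_word gr ((us @ vs) @ ps) ((u @ v) @ p)"
      "hom_word gr (us @ (sdeg vs + d + 1) # ps) (u @ \<mu> v # p)"
    using 1 2 3 \<mu>_deg by (auto intro!: hom_word_append)
  have "insert_term gr \<mu> n k i (tword (u @ v @ (p @ a # b # z))) = (-1) powi sdeg us *\<^sub>R tword (u @ \<mu> v # (p @ a # b # z))"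
    "insert_term gr \<mu> n k i (tword (u @ v @ (p @ b # a # z))) = (-1) powi sdeg us *\<^sub>R tword (u @ \<mu> v # (p @ b # a # z))"
    by (rule insert_term_tword; use 1 2 3 4 h in \<open>auto intro!: hom_word_append\<close>)+
  moreover have "tswap gr (j + k - 1) (tword (u @ v @ p @ a # b # z)) =
      (-1) powi ((m - 1) * (m' - 1)) *\<^sub>R tword (u @ v @ p @ b # a # z)"
    using tswap_tword[OF gr hp(1) 3(5) 4(3,4)] unfolding len(1) by simp
  moreover have "tswap gr j (tword (u @ \<mu> v # p @ a # b # z)) =
      (-1) powi ((m - 1) * (m' - 1)) *\<^sub>R tword (u @ \<mu> v # p @ b # a # z)"
    using tswap_tword[OF gr hp(2) 3(5) 4(3,4)] unfolding len(2) by simp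
  ultimately show "tswap gr j (insert_term gr \<mu> n k i (tword xs)) = insert_term gr \<mu> n k i (tswap gr (j + k - 1) (tword xs))"
    by (simp add: 1 2 3 4 linear_scale[OF linear_tswap[OF gr]] linear_scale[OF linear_insert_term])
qed

text \<open>Exchanging two letters ahead of the block leaves the sum of their degrees unchanged,
  hence also the insertion sign.\<close>

lemma tswap_insert_term_before:
  assumes "t \<in> tensor_length n" "Suc j < i" "i + k \<le> n"
  shows "tswap gr j (insert_term gr \<mu> n k i t) = insert_term gr \<mu> n k i (tswap gr j t)"
proof (rule linear_eq_on_tensor_length[OF gr linear_compose[OF linear_insert_term linear_tswap[OF gr], unfolded o_def]
      linear_compose[OF linear_tswap[OF gr] linear_insert_term, unfolded o_def] assms(1)])
  fix ns xs assume h: "hom_word gr ns xs" "length xs = n"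
  obtain us u rs r where 1: "ns = us @ rs" "xs = u @ r" "length u = i" "hom_word gr us u" "hom_word gr rs r"
    by (rule hom_word_split[OF h(1), of i]) ((use assms h(2) in auto)[1], (rule that; assumption))
  obtain vs v ws w where 2: "rs = vs @ ws" "r = v @ w" "length v = k" "hom_word gr vs v" "hom_word gr ws w"
    by (rule hom_word_split[OF 1(5), of k]) ((use assms h(2) 1 in auto)[1], (rule that; assumption))
  obtain ps p m a ys y where 3: "us = ps @ m # ys" "u = p @ a # y" "length p = j"
    "hom_word gr ps p" "a \<in> gr m" "hom_word gr ys y"
    by (rule hom_word_split_nth[OF 1(4), of j]) ((use assms 1 in auto)[1], (rule that; assumption))
  have "length y > 0" using 1 3 assms by auto
  then obtain b z m' zs where 4: "y = b # z" "ys = m' # zs" "b \<in> gr m'" "hom_word gr zs z"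
    using 3(6) by (cases y) (auto simp: list_all2_Cons2)
  have hp: "hom_word gr ((zs @ vs) @ ws) ((z @ v) @ w)" "hom_word gr (zs @ (sdeg vs + d + 1) # ws) (z @ \<mu> v # w)"
    using 2 4 \<mu>_deg by (auto intro!: hom_word_append)
  have "insert_term gr \<mu> n k i (tword ((p @ a # b # z) @ v @ w)) =
      (-1) powi sdeg (ps @ m # m' # zs) *\<^sub>R tword ((p @ a # b # z) @ \<mu> v # w)"
    "insert_term gr \<mu> n k i (tword ((p @ b # a # z) @ v @ w)) =
      (-1) powi sdeg (ps @ m' # m # zs) *\<^sub>R tword ((p @ b # a # z) @ \<mu> v # w)"
    by (rule insert_term_tword; use 1 2 3 4 h in \<open>auto intro!: hom_word_append\<close>)+
  then show "tswap gr j (insert_term gr \<mu> n k i (tword xs)) = insert_term gr \<mu> n k i (tswap gr j (tword xs))"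
    using tswap_tword[OF gr 3(4,5) 4(3) hp(1)] tswap_tword[OF gr 3(4,5) 4(3) hp(2)] 3(3)
    by (simp add: 1 2 3 4 linear_scale[OF linear_tswap[OF gr]] linear_scale[OF linear_insert_term] algebra_simps)
qed

text \<open>Moving the next letter ahead of the inserted one amounts to moving it ahead of the whole
  block first. The signs agree because \<open>\<mu>\<close> has odd degree: passing it costs the
  sign of one further odd letter, and this is the sign with which the moved letter enters the prefix
  of the insertion.\<close>

lemma tswap_insert_term_forward:
  assumes "t \<in> tensor_length n" "i + k < n"
  shows "tswap gr i (insert_term gr \<mu> n k i t) = insert_term gr \<mu> n k (Suc i) (move_left gr i k t)"
proof (rule linear_eq_on_tensor_length[OF gr linear_compose[OF linear_insert_term linear_tswap[OF gr], unfolded o_def]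
      linear_compose[OF linear_move_left[OF gr] linear_insert_term, unfolded o_def] assms(1)])
  fix ns xs assume h: "hom_word gr ns xs" "length xs = n"
  obtain us u rs r where 1: "ns = us @ rs" "xs = u @ r" "length u = i" "hom_word gr us u" "hom_word gr rs r"
    by (rule hom_word_split[OF h(1), of i]) ((use assms h(2) in auto)[1], (rule that; assumption))
  obtain vs v m a ws w where 2: "rs = vs @ m # ws" "r = v @ a # w" "length v = k"
    "hom_word gr vs v" "a \<in> gr m" "hom_word gr ws w"
    by (rule hom_word_split_nth[OF 1(5), of k]) ((use assms h(2) 1 in auto)[1], (rule that; assumption))
  have "insert_term gr \<mu> n k i (tword (u @ v @ (a # w))) = (-1) powi sdeg us *\<^sub>R tword (u @ \<mu> v # (a # w))"
    by (rule insert_term_tword) (use 1 2 h in auto)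
  moreover have "insert_term gr \<mu> n k (Suc i) (tword ((u @ [a]) @ v @ w)) =
      (-1) powi sdeg (us @ [m]) *\<^sub>R tword ((u @ [a]) @ \<mu> v # w)"
    by (rule insert_term_tword) (use 1 2 h in \<open>auto intro!: hom_word_append\<close>)
  ultimately show "tswap gr i (insert_term gr \<mu> n k i (tword xs)) =
      insert_term gr \<mu> n k (Suc i) (move_left gr i k (tword xs))"
    using tswap_tword[OF gr 1(4) \<mu>_deg[OF 2(4)] 2(5,6)] move_left_tword[OF gr 1(4) 2(5,4,6)] 1(3) 2(3) d
    by (simp add: 1 2 linear_scale[OF linear_tswap[OF gr]] linear_scale[OF linear_insert_term] neg_one_powi)
qed

lemma tswap_insert_term_backward:
  assumes "t \<in> tensor_length n" "Suc i + k \<le> n"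
  shows "tswap gr i (insert_term gr \<mu> n k (Suc i) t) = insert_term gr \<mu> n k i (move_right gr i k t)"
proof (rule linear_eq_on_tensor_length[OF gr linear_compose[OF linear_insert_term linear_tswap[OF gr], unfolded o_def]
      linear_compose[OF linear_move_right[OF gr] linear_insert_term, unfolded o_def] assms(1)])
  fix ns xs assume h: "hom_word gr ns xs" "length xs = n"
  obtain us u m a rs r where 1: "ns = us @ m # rs" "xs = u @ a # r" "length u = i"
    "hom_word gr us u" "a \<in> gr m" "hom_word gr rs r"
    by (rule hom_word_split_nth[OF h(1), of i]) ((use assms h(2) in auto)[1], (rule that; assumption))
  obtain vs v ws w where 2: "rs = vs @ ws" "r = v @ w" "length v = k" "hom_word gr vs v" "hom_word gr ws w"
    by (rule hom_word_split[OF 1(6), of k]) ((use assms h(2) 1 in auto)[1], (rule that; assumption))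
  have "insert_term gr \<mu> n k i (tword (u @ v @ (a # w))) = (-1) powi sdeg us *\<^sub>R tword (u @ \<mu> v # (a # w))"
    by (rule insert_term_tword) (use 1 2 h in auto)
  moreover have "insert_term gr \<mu> n k (Suc i) (tword ((u @ [a]) @ v @ w)) =
      (-1) powi sdeg (us @ [m]) *\<^sub>R tword ((u @ [a]) @ \<mu> v # w)"
    by (rule insert_term_tword) (use 1 2 h in \<open>auto intro!: hom_word_append\<close>)
  ultimately show "tswap gr i (insert_term gr \<mu> n k (Suc i) (tword xs)) =
      insert_term gr \<mu> n k i (move_right gr i k (tword xs))"
    using tswap_tword[OF gr 1(4,5) \<mu>_deg[OF 2(4)] 2(5)] move_right_tword[OF gr 1(4,5) 2(4,5)] 1(3) 2(3) d
    by (simp add: 1 2 linear_scale[OF linear_tswap[OF gr]] linear_scale[OF linear_insert_term] neg_one_powi)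
qed

text \<open>On a symmetric tensor the swap of \<open>j\<close> and \<open>j + 1\<close> permutes the
  insertion positions by the same transposition, so their sum is fixed. If \<open>j\<close> is too
  large for the output length \<open>n - k + 1\<close>, the swap acts as the identity.\<close>

lemma tswap_sum_insert_term:
  assumes t: "t \<in> tensor_length n" "\<And>j. tswap gr j t = t" and k: "k \<le> n"
  shows "tswap gr j (\<Sum>i\<le>n - k. insert_term gr \<mu> n k i t) = (\<Sum>i\<le>n - k. insert_term gr \<mu> n k i t)"
proof (cases "j < n - k")
  case False
  have "(\<Sum>i\<le>n - k. insert_term gr \<mu> n k i t) \<in> tensor_length (Suc (n - k))"
    using k by (intro subspace_sum[OF subspace_tensor_length] insert_term_length[OF t(1)]) auto
  then show ?thesis by (rule tswap_tensor_length_short[OF gr]) (use False in simp)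
next
  case True
  let ?s = "Transposition.transpose j (Suc j)"
  have "tswap gr j (insert_term gr \<mu> n k i t) = insert_term gr \<mu> n k (?s i) t" if "i \<le> n - k" for i
  proof -
    consider "i < j" | "i = j" | "i = Suc j" | "Suc j < i" by linarith
    then show ?thesis
    proof cases
      case 1
      then show ?thesis using tswap_insert_term_after[OF t(1) 1 True k] t(2) by simp
    next
      case 2
      then show ?thesis
        using tswap_insert_term_forward[OF t(1), of i k] True move_fixed(2)[of gr t, OF t(2)] by simp
    next
      case 3
      then show ?thesis
        using tswap_insert_term_backward[OF t(1), of j k] True move_fixed(1)[of gr t, OF t(2)] by simp
    next
      case 4
      then show ?thesis using tswap_insert_term_before[OF t(1) 4, of k] t(2) that k by simp
    qed
  qed
  then have "tswap gr j (\<Sum>i\<le>n - k. insert_term gr \<mu> n k i t) = (\<Sum>i\<le>n - k. insert_term gr \<mu> n k (?s i) t)"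
    by (simp add: linear_sum[OF linear_tswap[OF gr]])
  also have "\<dots> = (\<Sum>i\<le>n - k. insert_term gr \<mu> n k i t)"
  proof -
    have "?s permutes {..n - k}" using True by (intro permutes_swap_id) auto
    from sum.permute[OF this, of "\<lambda>i. insert_term gr \<mu> n k i t"] show ?thesis by (simp add: o_def)
  qed
  finally show ?thesis .
qed

lemma trotate_insert_term:
  assumes "t \<in> tensor_length n" "i + k < n"
  shows "trotate gr (insert_term gr \<mu> n k i t) = insert_term gr \<mu> n k (Suc i) (trotate gr t)"
proof (rule linear_eq_on_tensor_length[OF gr linear_compose[OF linear_insert_term linear_trotate[OF gr], unfolded o_def]
      linear_compose[OF linear_trotate[OF gr] linear_insert_term, unfolded o_def] assms(1)])
  fix ns xs assume h: "hom_word gr ns xs" "length xs = n"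
  obtain us u rs r where 1: "ns = us @ rs" "xs = u @ r" "length u = i" "hom_word gr us u" "hom_word gr rs r"
    by (rule hom_word_split[OF h(1), of i]) ((use assms h(2) in auto)[1], (rule that; assumption))
  obtain vs v ws w where 2: "rs = vs @ ws" "r = v @ w" "length v = k" "hom_word gr vs v" "hom_word gr ws w"
    by (rule hom_word_split[OF 1(5), of k]) ((use assms h(2) 1 in auto)[1], (rule that; assumption))
  have "length w > 0" using 1 2 h assms by auto
  obtain zs z m a ys y where 3: "ws = zs @ m # ys" "w = z @ a # y" "length z = length w - 1"
    "hom_word gr zs z" "a \<in> gr m" "hom_word gr ys y"
    by (rule hom_word_split_nth[OF 2(5), of "length w - 1"]) ((use \<open>length w > 0\<close> in simp)[1], (rule that; assumption))
  have y: "y = []" "ys = []" using 3 \<open>length w > 0\<close> by auto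
  have hp: "hom_word gr (us @ (sdeg vs + d + 1) # zs) (u @ \<mu> v # z)" "hom_word gr (us @ vs @ zs) (u @ v @ z)"
    using 1 2 3 \<mu>_deg by (auto intro!: hom_word_append)
  have "insert_term gr \<mu> n k i (tword (u @ v @ (z @ [a]))) = (-1) powi sdeg us *\<^sub>R tword (u @ \<mu> v # (z @ [a]))"
    by (rule insert_term_tword) (use 1 2 3 y h in auto)
  moreover have "insert_term gr \<mu> n k (Suc i) (tword ((a # u) @ v @ z)) =
      (-1) powi sdeg (m # us) *\<^sub>R tword ((a # u) @ \<mu> v # z)"
    by (rule insert_term_tword) (use 1 2 3 y h in auto)
  ultimately show "trotate gr (insert_term gr \<mu> n k i (tword xs)) =
      insert_term gr \<mu> n k (Suc i) (trotate gr (tword xs))"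
    using trotate_tword[OF gr hp(1) 3(5)] trotate_tword[OF gr hp(2) 3(5)] d
    by (simp add: 1 2 3 y linear_scale[OF linear_trotate[OF gr]] linear_scale[OF linear_insert_term] neg_one_powi)
qed

text \<open>The inserted letter is itself the last one here; carrying it to the front means rotating
  all \<open>k\<close> letters of its block to the front of the input.\<close>

lemma trotate_insert_term_last:
  assumes "t \<in> tensor_length n" "k \<le> n"
  shows "trotate gr (insert_term gr \<mu> n k (n - k) t) = insert_term gr \<mu> n k 0 ((trotate gr ^^ k) t)"
proof -
  have lin: "linear (trotate gr ^^ k)"
    by (induction k) (auto simp: linear_iff linear_add[OF linear_trotate[OF gr]] linear_scale[OF linear_trotate[OF gr]])
  show ?thesis
  proof (rule linear_eq_on_tensor_length[OF gr linear_compose[OF linear_insert_term linear_trotate[OF gr], unfolded o_def]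
      linear_compose[OF lin linear_insert_term, unfolded o_def] assms(1)])
    fix ns xs assume h: "hom_word gr ns xs" "length xs = n"
    obtain us u vs v where 1: "ns = us @ vs" "xs = u @ v" "length u = n - k" "hom_word gr us u" "hom_word gr vs v"
      by (rule hom_word_split[OF h(1), of "n - k"]) ((use h(2) in auto)[1], (rule that; assumption))
    have v: "length v = k" using 1 h assms by auto
    have "insert_term gr \<mu> n k (n - k) (tword (u @ v @ [])) = (-1) powi sdeg us *\<^sub>R tword (u @ \<mu> v # [])"
      by (rule insert_term_tword) (use 1 v h in auto)
    moreover have "insert_term gr \<mu> n k 0 (tword ([] @ v @ u)) = (-1) powi sdeg [] *\<^sub>R tword ([] @ \<mu> v # u)"
      by (rule insert_term_tword) (use 1 v h in auto)
    ultimately show "trotate gr (insert_term gr \<mu> n k (n - k) (tword xs)) =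
        insert_term gr \<mu> n k 0 ((trotate gr ^^ k) (tword xs))"
      using trotate_tword[OF gr 1(4) \<mu>_deg[OF 1(5)]] trotate_power_tword[OF gr 1(5,4)] v d
      by (simp add: 1 linear_scale[OF linear_trotate[OF gr]] linear_scale[OF linear_insert_term] neg_one_powi)
  qed
qed

text \<open>Rotation shifts the insertion positions cyclically. The last position wraps around to 0
  at the cost of \<open>k\<close> rotations of the argument, and these fix a cyclic tensor.\<close>

lemma trotate_sum_insert_term:
  assumes t: "t \<in> tensor_length n" "trotate gr t = t" and k: "k \<le> n"
  shows "trotate gr (\<Sum>i\<le>n - k. insert_term gr \<mu> n k i t) = (\<Sum>i\<le>n - k. insert_term gr \<mu> n k i t)"
proof -
  have "trotate gr (\<Sum>i\<le>n - k. insert_term gr \<mu> n k i t) =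
      (\<Sum>i<n - k. trotate gr (insert_term gr \<mu> n k i t)) + trotate gr (insert_term gr \<mu> n k (n - k) t)"
    by (simp add: linear_sum[OF linear_trotate[OF gr]] linear_add[OF linear_trotate[OF gr]] lessThan_Suc_atMost[symmetric])
  also have "\<dots> = (\<Sum>i<n - k. insert_term gr \<mu> n k (Suc i) t) + insert_term gr \<mu> n k 0 t"
    using trotate_insert_term[OF t(1)] trotate_insert_term_last[OF t(1) k]
    by (simp add: t(2) trotate_fixed_power[OF t(2)])
  finally show ?thesis by (simp add: sum.atMost_shift)
qed

end

section \<open>The length filtration, degrees and fixed tensors\<close>

definition tensor_below :: "nat \<Rightarrow> 'a::real_vector tensor set" where
  "tensor_below n = span {tword xs |xs. length xs < n}"

lemma subspace_tensor_below: "subspace (tensor_below n)"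
  by (simp add: tensor_below_def subspace_span)

lemma tword_tensor_below: "length xs < n \<Longrightarrow> tword xs \<in> tensor_below n"
  by (auto simp: tensor_below_def intro: span_base)

lemma tensor_below_mono: "m \<le> n \<Longrightarrow> tensor_below m \<subseteq> tensor_below n"
  unfolding tensor_below_def by (intro span_mono) auto

text \<open>The strict bound on the length makes the filtration start at zero, as
  \<open>filtered_cone_acyclic\<close> asks.\<close>

lemma tensor_below_0: "tensor_below 0 = {0}"
  by (simp add: tensor_below_def)

lemma tensor_below_exhaust: "\<exists>n. t \<in> tensor_below n"
proof -
  obtain N where N: "(\<Sum>n<N. tensor_proj n t) = t" using tensor_proj_cases by blast
  have "tensor_proj n t \<in> tensor_below N" if "n < N" for n
    by (rule tensor_length_in_words[OF subspace_tensor_below _ tensor_proj_in]) (use that tword_tensor_below in auto)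
  then have "(\<Sum>n<N. tensor_proj n t) \<in> tensor_below N"
    by (intro subspace_sum[OF subspace_tensor_below]) auto
  then show ?thesis unfolding N by blast
qed

lemma linear_maps_tensor_below:
  assumes "graded_space gr" "linear A" "subspace U" "t \<in> tensor_below n"
    "\<And>ns xs. hom_word gr ns xs \<Longrightarrow> length xs < n \<Longrightarrow> A (tword xs) \<in> U"
  shows "A t \<in> U"
proof -
  have "A ` {tword xs |xs. length xs < n} \<subseteq> U"
    using linear_maps_tensor_length[OF assms(1-3) tword_tensor_length] assms(5) by auto
  then have "A ` tensor_below n \<subseteq> U"
    unfolding tensor_below_def linear_span_image[OF assms(2), symmetric] by (intro span_minimal assms(3))
  then show ?thesis using assms(4) by blast
qed

lemma subspace_tensor_degree: "subspace (tensor_degree gr n)"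
  by (simp add: tensor_degree_def subspace_span)

lemma tword_tensor_degree: "hom_word gr ns xs \<Longrightarrow> sdeg ns = n \<Longrightarrow> tword xs \<in> tensor_degree gr n"
  unfolding tensor_degree_def by (intro span_base) auto

lemma linear_maps_tensor_degree:
  assumes "linear A" "subspace U" "t \<in> tensor_degree gr n"
    "\<And>ns xs. hom_word gr ns xs \<Longrightarrow> sdeg ns = n \<Longrightarrow> A (tword xs) \<in> U"
  shows "A t \<in> U"
proof -
  have "A ` tensor_degree gr n \<subseteq> U"
    unfolding tensor_degree_def linear_span_image[OF assms(1), symmetric]
    by (intro span_minimal assms(2)) (auto simp: assms(4))
  then show ?thesis using assms(3) by blast
qed

text \<open>Adjacent swaps generate all signed permutations, so these are the coefficient spaces of
  \<open>bar_sym\<close>, as \<open>bar_sym_conv\<close> shows.\<close>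

definition sym_tensors :: "(int \<Rightarrow> 'a::real_vector set) \<Rightarrow> 'a tensor set" where
  "sym_tensors gr = {t. \<forall>j. tswap gr j t = t}"

definition cyc_tensors :: "(int \<Rightarrow> 'a::real_vector set) \<Rightarrow> 'a tensor set" where
  "cyc_tensors gr = {t. trotate gr t = t}"

lemma subspace_fixed: "linear A \<Longrightarrow> subspace {t. A t = t}"
  by (simp add: subspace_def linear_0 linear_add linear_scale)

lemma subspace_cyc_tensors: "graded_space gr \<Longrightarrow> subspace (cyc_tensors gr)"
  unfolding cyc_tensors_def by (rule subspace_fixed[OF linear_trotate])

lemma subspace_sym_tensors: "graded_space gr \<Longrightarrow> subspace (sym_tensors gr)"
  by (auto simp: sym_tensors_def subspace_def linear_0[OF linear_tswap] linear_add[OF linear_tswap]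
      linear_scale[OF linear_tswap])

lemma nov_map_fixed_iff: "linear A \<Longrightarrow> nov_map A x = x \<longleftrightarrow> (\<forall>s q. A (ncoeff x s q) = ncoeff x s q)"
  by (metis ncoeff_nov_map nov_eqI)

lemma bar_cyc_conv: "graded_space gr \<Longrightarrow> bar_cyc gr = coeffs_in (\<lambda>q. cyc_tensors gr)"
  by (simp add: bar_cyc_def bar_permute_conv nov_map_fixed_iff linear_tensor_permute cyclic_generator_permutes
      coeffs_in_def cyc_tensors_def trotate_def)

lemma bar_sym_conv:
  assumes "graded_space gr"
  shows "bar_sym gr = coeffs_in (\<lambda>q. sym_tensors gr)"
proof -
  have "bar_permute gr \<pi> x = x \<longleftrightarrow> (\<forall>s q. tensor_permute gr \<pi> (ncoeff x s q) = ncoeff x s q)"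
    if "\<forall>k. \<pi> k permutes {..<k}" for \<pi> x
    unfolding bar_permute_conv using that by (intro nov_map_fixed_iff linear_tensor_permute assms) auto
  then have "x \<in> bar_sym gr \<longleftrightarrow> (\<forall>s q. \<forall>\<pi>. (\<forall>k. \<pi> k permutes {..<k}) \<longrightarrow>
      tensor_permute gr \<pi> (ncoeff x s q) = ncoeff x s q)" for x
    unfolding bar_sym_def mem_Collect_eq by blast
  then show ?thesis
    unfolding tensor_permute_fixed_iff[OF assms] by (auto simp: coeffs_in_def sym_tensors_def)
qed

lemma bar_degree_conv: "bar_degree gr n = coeffs_in (\<lambda>q. tensor_degree gr (n - 2 * q))"
  by (simp add: bar_degree_def nov_degree_def coeffs_in_def)

lemma UNIV_conv: "UNIV = coeffs_in (\<lambda>q. UNIV)"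
  by (simp add: coeffs_in_def)

lemma coeffs_in_Int: "coeffs_in U \<inter> coeffs_in V = coeffs_in (\<lambda>q. U q \<inter> V q)"
  by (auto simp: coeffs_in_def)

lemma tensor_proj_sym: "graded_space gr \<Longrightarrow> t \<in> sym_tensors gr \<Longrightarrow> tensor_proj n t \<in> sym_tensors gr"
  unfolding sym_tensors_def tswap_def
  by (simp add: tensor_proj_permute[symmetric] adjacent_permutes)

lemma tensor_proj_cyc: "graded_space gr \<Longrightarrow> t \<in> cyc_tensors gr \<Longrightarrow> tensor_proj n t \<in> cyc_tensors gr"
  unfolding cyc_tensors_def trotate_def
  by (simp add: tensor_proj_permute[symmetric] cyclic_generator_permutes)

lemma coeffs_in_by_length:
  assumes "linear D" "subspace U" "\<And>n. D (tensor_proj n t) \<in> coeffs_in (\<lambda>q. U)"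
  shows "D t \<in> coeffs_in (\<lambda>q. U)"
proof -
  obtain N where N: "(\<Sum>n<N. tensor_proj n t) = t" using tensor_proj_cases by blast
  have "(\<Sum>n<N. D (tensor_proj n t)) \<in> coeffs_in (\<lambda>q. U)"
    by (intro subspace_sum[OF subspace_coeffs_in] assms)
  then show ?thesis using linear_sum[OF assms(1), of "\<lambda>n. tensor_proj n t" "{..<N}"] N by simp
qed

text \<open>The sign \<open>(-1)\<^bsup>|x|'\<^esup>\<close> as a linear operator.\<close>

definition koszul_parity :: "(int \<Rightarrow> 'a::real_vector set) \<Rightarrow> 'a \<Rightarrow> 'a" where
  "koszul_parity gr x = (\<Sum>n | hcomp gr n x \<noteq> 0. (-1) powi (n - 1) *\<^sub>R hcomp gr n x)"

lemma linear_koszul_parity: "graded_space gr \<Longrightarrow> linear (koszul_parity gr)"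
  unfolding koszul_parity_def
  by (rule linear_sum_hcomp) (simp_all add: linear_compose_scale_right linear_iff scaleR_add_right)

lemma koszul_parity_homogeneous:
  assumes "graded_space gr" "x \<in> gr n"
  shows "koszul_parity gr x = (-1) powi (n - 1) *\<^sub>R x"
  unfolding koszul_parity_def hcomp_support_homogeneous[OF assms]
  by (simp add: hcomp_homogeneous[OF assms])

text \<open>The signed Leibniz rule. With the sign written as the operator
  \<open>koszul_parity\<close> no list of degrees is involved, so the formula also makes sense on
  words that are homogeneous for a different grading, such as the weights used for the
  contraction.\<close>

primrec derivation_word :: "(int \<Rightarrow> 'a::real_vector set) \<Rightarrow> ('a \<Rightarrow> 'a) \<Rightarrow> 'a list \<Rightarrow> 'a tensor" where
  "derivation_word gr \<delta> [] = 0"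
| "derivation_word gr \<delta> (x # xs) = tword (\<delta> x # xs) + tensor_cons (koszul_parity gr x) (derivation_word gr \<delta> xs)"

definition tensor_derivation :: "(int \<Rightarrow> 'a::real_vector set) \<Rightarrow> ('a \<Rightarrow> 'a) \<Rightarrow> 'a tensor \<Rightarrow> 'a tensor" where
  "tensor_derivation gr \<delta> = tensor_lift (derivation_word gr \<delta>)"

lemma multilinear_derivation_word:
  assumes "graded_space gr" "linear \<delta>"
  shows "multilinear_words (derivation_word gr \<delta>)"
proof -
  note lp = linear_koszul_parity[OF assms(1)]
  note [simp] = linear_add[OF assms(2)] linear_scale[OF assms(2)] linear_add[OF lp] linear_scale[OF lp]
    linear_add[OF linear_tensor_cons] linear_scale[OF linear_tensor_cons]
    linear_add[OF linear_tensor_cons_left] linear_scale[OF linear_tensor_cons_left]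
    linear_add[OF multilinear_words_linear[OF multilinear_words_tword]]
    linear_scale[OF multilinear_words_linear[OF multilinear_words_tword]]
    linear_add[OF multilinear_words_linear_hd[OF multilinear_words_tword]]
    linear_scale[OF multilinear_words_linear_hd[OF multilinear_words_tword]]
    linear_add[OF multilinear_words_linear[OF multilinear_words_tl[OF multilinear_words_tword]]]
    linear_scale[OF multilinear_words_linear[OF multilinear_words_tl[OF multilinear_words_tword]]]
  have "derivation_word gr \<delta> (xs @ (x + y) # ys) = derivation_word gr \<delta> (xs @ x # ys) + derivation_word gr \<delta> (xs @ y # ys)"
    "derivation_word gr \<delta> (xs @ (r *\<^sub>R x) # ys) = r *\<^sub>R derivation_word gr \<delta> (xs @ x # ys)" for xs x y ys r
    by (induction xs) (simp_all add: algebra_simps)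
  then show ?thesis by (simp add: multilinear_words_def)
qed

context
  fixes gr :: "int \<Rightarrow> 'a::real_vector set" and \<delta> :: "'a \<Rightarrow> 'a"
  assumes gr: "graded_space gr" and \<delta>: "linear \<delta>"
begin

lemma linear_tensor_derivation: "linear (tensor_derivation gr \<delta>)"
  unfolding tensor_derivation_def by (rule linear_tensor_lift[OF multilinear_derivation_word[OF gr \<delta>]])

lemma tensor_derivation_tword: "tensor_derivation gr \<delta> (tword xs) = derivation_word gr \<delta> xs"
  unfolding tensor_derivation_def by (rule tensor_lift_tword[OF multilinear_derivation_word[OF gr \<delta>]])

lemma tensor_derivation_cons:
  "tensor_derivation gr \<delta> (tensor_cons x t) =
    tensor_cons (\<delta> x) t + tensor_cons (koszul_parity gr x) (tensor_derivation gr \<delta> t)"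
proof (rule linear_eq_on_words[of "\<lambda>t. tensor_derivation gr \<delta> (tensor_cons x t)"])
  show "linear (\<lambda>t. tensor_derivation gr \<delta> (tensor_cons x t))"
    using linear_compose[OF linear_tensor_cons linear_tensor_derivation] by (simp add: o_def)
  show "linear (\<lambda>t. tensor_cons (\<delta> x) t + tensor_cons (koszul_parity gr x) (tensor_derivation gr \<delta> t))"
    using linear_compose[OF linear_tensor_derivation linear_tensor_cons]
    by (intro linear_compose_add linear_tensor_cons) (simp add: o_def)
qed (simp add: tensor_cons_tword tensor_derivation_tword)

lemma derivation_word_sum:
  assumes "hom_word gr ns xs"
  shows "derivation_word gr \<delta> xs =
    (\<Sum>i<length xs. insert_sign ns i *\<^sub>R tword (take i xs @ \<delta> (xs ! i) # drop (Suc i) xs))"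
  using assms
proof (induction ns xs rule: list_all2_induct)
  case (Cons n ns x xs)
  have sg: "insert_sign (n # ns) (Suc i) = (-1) powi (n - 1) * insert_sign ns i" for i
    by (simp add: insert_sign_def sum.lessThan_Suc_shift power_int_add del: sum.lessThan_Suc)
  have "insert_sign (n # ns) 0 = 1" by (simp add: insert_sign_def)
  then show ?case
    using Cons by (simp add: sum.lessThan_Suc_shift sg koszul_parity_homogeneous[OF gr]
        linear_scale[OF linear_tensor_cons_left] linear_sum[OF linear_tensor_cons] linear_scale[OF linear_tensor_cons]
        tensor_cons_tword scaleR_sum_right mult.commute
        linear_scale[OF multilinear_words_linear_hd[OF multilinear_words_tword]] del: sum.lessThan_Suc)
qed simp

end

section \<open>Coefficients of the bar differential\<close>

context
  fixes gr :: "int \<Rightarrow> 'a::real_vector set" and m :: "'a nov list \<Rightarrow> 'a nov"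
  assumes gr: "graded_space gr" and m: "filtered_maps gr gr 1 m"
begin

definition differential_word :: "int list \<Rightarrow> 'a list \<Rightarrow> 'a tensor nov" where
  "differential_word ns xs = (\<Sum>k\<le>length xs. m_hat_word m k ns xs)"

private lemma hm: "homogeneous_maps gr gr (1 - 2 * q) (coeff_map m s q)"
  by (rule homogeneous_maps_coeff_map[OF m gr])

private lemma odd_degree: "odd (1 - 2 * q)" for q :: int
  by simp

private lemma ml_coeff: "multilinear_words (coeff_map m s q)"
  using hm by (simp add: homogeneous_maps_def)

text \<open>The condition \<open>length xs = length xs\<close> brings the summands into the shape
  that \<open>insert_term\<close> has for \<open>n = length xs\<close>.\<close>

lemma ncoeff_differential_word:
  "ncoeff (differential_word ns xs) s q = (\<Sum>k\<le>length xs. \<Sum>i\<le>length xs - k.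
    if length xs = length xs \<and> i + k \<le> length xs then insert_sign ns i *\<^sub>R
      tword (take i xs @ coeff_map m s q (take k (drop i xs)) # drop (i + k) xs) else 0)"
proof -
  have "ncoeff (m_hat_word m k ns xs) s q = (\<Sum>i\<le>length xs - k.
      insert_sign ns i *\<^sub>R tword (take i xs @ coeff_map m s q (take k (drop i xs)) # drop (i + k) xs))"
    if "k \<le> length xs" for k
  proof -
    have "{i. i + k \<le> length xs} = {..length xs - k}" using that by auto
    then show ?thesis
      by (simp only: m_hat_word_def ncoeff_sum ncoeff_simps ncoeff_nov_word_insert insert_sign_def coeff_map_def)
  qed
  then show ?thesis
    unfolding differential_word_def ncoeff_sum by (auto intro!: sum.cong)
qed

lemma multilinear_differential_word: "multilinear_words (differential_word ns)"
proof (rule multilinear_words_ncoeffI)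
  fix s q
  show "multilinear_words (\<lambda>xs. ncoeff (differential_word ns xs) s q)"
    by (rule multilinear_words_length_cong[where \<phi> = "\<lambda>n xs. \<Sum>k\<le>n. \<Sum>i\<le>n - k.
        if length xs = n \<and> i + k \<le> length xs then insert_sign ns i *\<^sub>R
          tword (take i xs @ coeff_map m s q (take k (drop i xs)) # drop (i + k) xs) else 0"])
      (intro multilinear_words_sum multilinear_insert ml_coeff, rule ncoeff_differential_word)
qed

definition tensor_differential :: "'a tensor \<Rightarrow> 'a tensor nov" where
  "tensor_differential = hext gr differential_word"

lemma bar_differential_conv: "bar_differential gr m = nov_extend tensor_differential"
  by (simp add: bar_differential_def tensor_differential_def hext_def differential_word_def[abs_def])

lemma linear_tensor_differential: "linear tensor_differential"
  unfolding tensor_differential_def by (rule linear_hext[OF gr multilinear_differential_word])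

lemma ncoeff_tensor_differential:
  assumes "t \<in> tensor_length n"
  shows "ncoeff (tensor_differential t) s q = (\<Sum>k\<le>n. \<Sum>i\<le>n - k. insert_term gr (coeff_map m s q) n k i t)"
proof (rule linear_eq_on_tensor_length[OF gr _ _ assms])
  show "linear (\<lambda>t. ncoeff (tensor_differential t) s q)"
    using linear_compose[OF linear_tensor_differential linear_ncoeff] by (simp add: o_def)
  show "linear (\<lambda>t. \<Sum>k\<le>n. \<Sum>i\<le>n - k. insert_term gr (coeff_map m s q) n k i t)"
    by (intro linear_compose_sum ballI linear_insert_term[OF gr hm odd_degree])
  fix ns xs assume h: "hom_word gr ns xs" "length xs = n"
  have "insert_term gr (coeff_map m s q) n k i (tword xs) = (if length xs = n \<and> i + k \<le> length xs then
      insert_sign ns i *\<^sub>R tword (take i xs @ coeff_map m s q (take k (drop i xs)) # drop (i + k) xs) else 0)" for k i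
    unfolding insert_term_def by (rule hext_tword[OF gr multilinear_insert[OF ml_coeff] h(1)])
  then show "ncoeff (tensor_differential (tword xs)) s q =
      (\<Sum>k\<le>n. \<Sum>i\<le>n - k. insert_term gr (coeff_map m s q) n k i (tword xs))"
    unfolding tensor_differential_def hext_tword[OF gr multilinear_differential_word h(1)] ncoeff_differential_word
    by (simp add: h(2) cong: if_cong)
qed

text \<open>On one length component, each coefficient of the differential is a sum over arities of
  the position sums treated above, for operations of odd degree \<open>1 - 2 * q\<close>.\<close>

lemma tensor_differential_sym:
  assumes "t \<in> sym_tensors gr"
  shows "tensor_differential t \<in> coeffs_in (\<lambda>q. sym_tensors gr)"
proof (rule coeffs_in_by_length[OF linear_tensor_differential subspace_sym_tensors[OF gr]])
  fix n
  have fixed: "tswap gr j (tensor_proj n t) = tensor_proj n t" for j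
    using tensor_proj_sym[OF gr assms] by (simp add: sym_tensors_def)
  show "tensor_differential (tensor_proj n t) \<in> coeffs_in (\<lambda>q. sym_tensors gr)"
    unfolding coeffs_in_def mem_Collect_eq ncoeff_tensor_differential[OF tensor_proj_in]
  proof (intro allI, rule subspace_sum[OF subspace_sym_tensors[OF gr]])
    fix s q k assume "k \<in> {..n}"
    then show "(\<Sum>i\<le>n - k. insert_term gr (coeff_map m s q) n k i (tensor_proj n t)) \<in> sym_tensors gr"
      unfolding sym_tensors_def mem_Collect_eq
      by (intro allI tswap_sum_insert_term[OF gr hm odd_degree tensor_proj_in fixed]) auto
  qed
qed

lemma tensor_differential_cyc:
  assumes "t \<in> cyc_tensors gr"
  shows "tensor_differential t \<in> coeffs_in (\<lambda>q. cyc_tensors gr)"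
proof (rule coeffs_in_by_length[OF linear_tensor_differential subspace_cyc_tensors[OF gr]])
  fix n
  have fixed: "trotate gr (tensor_proj n t) = tensor_proj n t"
    using tensor_proj_cyc[OF gr assms] by (simp add: cyc_tensors_def)
  show "tensor_differential (tensor_proj n t) \<in> coeffs_in (\<lambda>q. cyc_tensors gr)"
    unfolding coeffs_in_def mem_Collect_eq ncoeff_tensor_differential[OF tensor_proj_in]
  proof (intro allI, rule subspace_sum[OF subspace_cyc_tensors[OF gr]])
    fix s q k assume "k \<in> {..n}"
    then show "(\<Sum>i\<le>n - k. insert_term gr (coeff_map m s q) n k i (tensor_proj n t)) \<in> cyc_tensors gr"
      unfolding cyc_tensors_def mem_Collect_eq
      by (intro trotate_sum_insert_term[OF gr hm odd_degree tensor_proj_in fixed]) auto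
  qed
qed

lemma tensor_differential_degree:
  assumes "t \<in> tensor_degree gr n"
  shows "tensor_differential t \<in> coeffs_in (\<lambda>q. tensor_degree gr (n + 1 - 2 * q))"
proof (rule linear_maps_tensor_degree[OF linear_tensor_differential subspace_coeffs_in[OF subspace_tensor_degree] assms])
  fix ns xs assume h: "hom_word gr ns xs" "sdeg ns = n"
  show "tensor_differential (tword xs) \<in> coeffs_in (\<lambda>q. tensor_degree gr (n + 1 - 2 * q))"
    unfolding coeffs_in_def mem_Collect_eq ncoeff_tensor_differential[OF tword_tensor_length]
  proof (intro allI subspace_sum[OF subspace_tensor_degree])
    fix s q k i assume k: "k \<in> {..length xs}" "i \<in> {..length xs - k}"
    obtain us u rs r where 1: "ns = us @ rs" "xs = u @ r" "length u = i" "hom_word gr us u" "hom_word gr rs r"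
      by (rule hom_word_split[OF h(1), of i]) ((use k in auto)[1], (rule that; assumption))
    obtain vs v ws w where 2: "rs = vs @ ws" "r = v @ w" "length v = k" "hom_word gr vs v" "hom_word gr ws w"
      by (rule hom_word_split[OF 1(5), of k]) ((use k 1 in auto)[1], (rule that; assumption))
    have "insert_term gr (coeff_map m s q) (length xs) k i (tword xs) =
        (-1) powi sdeg us *\<^sub>R tword (u @ coeff_map m s q v # w)"
      unfolding 1(2) 2(2) by (rule insert_term_tword[OF gr hm odd_degree 1(4) 2(4,5)]) (use 1 2 in auto)
    moreover have "hom_word gr (us @ (sdeg vs + (1 - 2 * q) + 1) # ws) (u @ coeff_map m s q v # w)"
      using 1 2 hm[of q s] by (auto intro!: hom_word_append simp: homogeneous_maps_def)
    then have "tword (u @ coeff_map m s q v # w) \<in> tensor_degree gr (n + 1 - 2 * q)"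
      by (rule tword_tensor_degree) (use h(2) 1 2 in simp)
    ultimately show "insert_term gr (coeff_map m s q) (length xs) k i (tword xs) \<in> tensor_degree gr (n + 1 - 2 * q)"
      by (simp add: subspace_scale[OF subspace_tensor_degree])
  qed
qed

lemma tensor_differential_low:
  assumes "\<And>xs. coeff_map m s q xs = 0"
  shows "ncoeff (tensor_differential t) s q = 0"
proof -
  have "ncoeff (tensor_differential t) s q = (\<lambda>t. 0) t"
  proof (rule linear_eq_on_hom_words[OF gr, of "\<lambda>t. ncoeff (tensor_differential t) s q"])
    show "linear (\<lambda>t. ncoeff (tensor_differential t) s q)"
      using linear_compose[OF linear_tensor_differential linear_ncoeff] by (simp add: o_def)
    fix ns xs assume "hom_word gr ns xs"
    have z: "tword (u @ 0 # w) = (0::'a tensor)" for u w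
      by (rule multilinear_words_zero[OF multilinear_words_tword]) simp
    show "ncoeff (tensor_differential (tword xs)) s q = 0"
      unfolding tensor_differential_def hext_tword[OF gr multilinear_differential_word \<open>hom_word gr ns xs\<close>] ncoeff_differential_word
      by (intro sum.neutral ballI) (simp add: assms z)
  qed (simp add: linear_iff)
  then show ?thesis by simp
qed

lemma linear_reduction_single: "linear (\<lambda>x. reduction m [x])"
  using multilinear_words_linear_hd[OF ml_coeff[of 0 0], of "[]"] by (simp add: reduction_def coeff_map_def)

text \<open>Inserting an operation of arity \<open>k\<close> changes the length by
  \<open>1 - k\<close>. At energy 0 the arity 0 term vanishes by assumption, arity 1 gives the
  derivation, and all higher arities shorten the word.\<close>

lemma tensor_differential_leading:
  assumes "coeff_map m 0 0 [] = 0" "t \<in> tensor_below (Suc n)"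
  shows "ncoeff (tensor_differential t) 0 0 - tensor_derivation gr (\<lambda>x. reduction m [x]) t \<in> tensor_below n"
proof (rule linear_maps_tensor_below[OF gr _ subspace_tensor_below assms(2)])
  note lin = linear_tensor_derivation[OF gr linear_reduction_single]
  show "linear (\<lambda>t. ncoeff (tensor_differential t) 0 0 - tensor_derivation gr (\<lambda>x. reduction m [x]) t)"
    using linear_compose[OF linear_tensor_differential linear_ncoeff]
    by (intro linear_compose_sub lin) (simp add: o_def)
  fix ns xs assume h: "hom_word gr ns xs" "length xs < Suc n"
  have z: "tword (u @ 0 # w) = (0::'a tensor)" for u w
    by (rule multilinear_words_zero[OF multilinear_words_tword]) simp
  define G where "G = (\<lambda>k. \<Sum>i\<le>length xs - k. if length xs = length xs \<and> i + k \<le> length xs then insert_sign ns i *\<^sub>R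
      tword (take i xs @ coeff_map m 0 0 (take k (drop i xs)) # drop (i + k) xs) else 0)"
  have eq: "ncoeff (tensor_differential (tword xs)) 0 0 = (\<Sum>k\<le>length xs. G k)"
    unfolding tensor_differential_def hext_tword[OF gr multilinear_differential_word h(1)] ncoeff_differential_word G_def ..
  have G0: "G 0 = 0" unfolding G_def by (intro sum.neutral ballI) (simp add: assms(1) z)
  have low: "G k \<in> tensor_below n" if "2 \<le> k" "k \<le> length xs" for k
    unfolding G_def using that h(2)
    by (intro subspace_sum[OF subspace_tensor_below])
      (auto intro!: subspace_scale[OF subspace_tensor_below] tword_tensor_below subspace_0[OF subspace_tensor_below])
  show "ncoeff (tensor_differential (tword xs)) 0 0 - tensor_derivation gr (\<lambda>x. reduction m [x]) (tword xs) \<in> tensor_below n"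
  proof (cases "xs = []")
    case True
    then show ?thesis
      using eq G0 by (simp add: tensor_derivation_tword[OF gr linear_reduction_single] subspace_0[OF subspace_tensor_below])
  next
    case False
    have "{..length xs} = insert 0 (insert 1 {2..length xs})" using False by (cases xs) auto
    then have "(\<Sum>k\<le>length xs. G k) = G 1 + (\<Sum>k=2..length xs. G k)" by (simp add: G0)
    moreover have "G 1 = tensor_derivation gr (\<lambda>x. reduction m [x]) (tword xs)"
    proof -
      have "{..length xs - 1} = {..<length xs}" using False by (cases xs) auto
      then have "G 1 = (\<Sum>i<length xs. insert_sign ns i *\<^sub>R
          tword (take i xs @ reduction m [xs ! i] # drop (Suc i) xs))"
        unfolding G_def
        by (auto intro!: sum.cong simp: take_Suc_conv_app_nth reduction_def coeff_map_def hd_drop_conv_nth take_Suc drop_eq_Nil)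
      then show ?thesis
        by (simp add: tensor_derivation_tword[OF gr linear_reduction_single]
            derivation_word_sum[OF gr linear_reduction_single h(1)])
    qed
    moreover have "(\<Sum>k=2..length xs. G k) \<in> tensor_below n"
      using low by (intro subspace_sum[OF subspace_tensor_below]) auto
    ultimately show ?thesis by (simp add: eq)
  qed
qed

end

section \<open>Completed tensors of letters\<close>

definition ncons :: "'a::real_vector nov \<Rightarrow> 'a tensor nov \<Rightarrow> 'a tensor nov" where
  "ncons a t = nov_extend (\<lambda>v. nov_map (tensor_cons v) t) a"

lemma nov_word_Cons: "nov_word (a # as) = ncons a (nov_word as)"
  by (simp add: ncons_def)

lemma tensor_cons_zero: "tensor_cons 0 t = 0" "tensor_cons v 0 = 0"
  by (simp_all add: linear_0[OF linear_tensor_cons_left] linear_0[OF linear_tensor_cons])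

lemma ncoeff_ncons:
  assumes "finite A" "{(s', q'). s' \<le> s \<and> ncoeff a s' q' \<noteq> 0} \<subseteq> A"
  shows "ncoeff (ncons a t) s q = (\<Sum>(s', q')\<in>A. tensor_cons (ncoeff a s' q') (ncoeff t (s - s') (q - q')))"
  unfolding ncons_def
  by (subst ncoeff_nov_extend[where D = "\<lambda>v. nov_map (tensor_cons v) t", OF linear_0[OF linear_nov_map_tensor_cons] assms])
    (simp add: ncoeff_nov_map linear_tensor_cons)

lemma linear_ncons_left: "linear (\<lambda>a. ncons a t)"
  unfolding ncons_def by (rule linear_nov_extend[OF linear_nov_map_tensor_cons])

lemma linear_ncons: "linear (ncons a)"
proof (rule linearI; rule nov_eqI)
  fix x y :: "'a tensor nov" and r :: real and s q
  note * = ncoeff_ncons[OF finite_ncoeff[of s a] order_refl]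
  show "ncoeff (ncons a (x + y)) s q = ncoeff (ncons a x + ncons a y) s q"
    by (simp add: * linear_add[OF linear_tensor_cons] sum.distrib[symmetric] split_beta)
  show "ncoeff (ncons a (r *\<^sub>R x)) s q = ncoeff (r *\<^sub>R ncons a x) s q"
    by (simp add: * linear_scale[OF linear_tensor_cons] scaleR_sum_right split_beta)
qed

lemma ncons_coeffs_in:
  assumes "\<And>q. subspace (U q)" "\<And>s q s' q'. tensor_cons (ncoeff a s q) (ncoeff t s' q') \<in> U (q + q')"
  shows "ncons a t \<in> coeffs_in U"
  unfolding coeffs_in_def mem_Collect_eq
proof (intro allI)
  fix s q
  have "tensor_cons (ncoeff a s' q') (ncoeff t (s - s') (q - q')) \<in> U q" for s' q'
    using assms(2)[of s' q' "s - s'" "q - q'"] by simp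
  then show "ncoeff (ncons a t) s q \<in> U q"
    unfolding ncoeff_ncons[OF finite_ncoeff[of s a] order_refl] by (intro subspace_sum[OF assms(1)]) auto
qed

lemma ncons_energy:
  assumes "a \<in> energy_ge E" "t \<in> energy_ge E'"
  shows "ncons a t \<in> energy_ge (E + E')"
proof -
  have "ncoeff (ncons a t) s q = 0" if "s < E + E'" for s q
    unfolding ncoeff_ncons[OF finite_ncoeff[of s a] order_refl]
  proof (rule sum.neutral, clarify)
    fix s' q' assume "ncoeff a s' q' \<noteq> 0"
    then have "s - s' < E'" using assms(1) that by (cases "s' < E") (auto simp: energy_ge_def)
    then show "tensor_cons (ncoeff a s' q') (ncoeff t (s - s') (q - q')) = 0"
      using assms(2) by (simp add: energy_ge_def tensor_cons_zero)
  qed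
  then show ?thesis by (simp add: energy_ge_def)
qed

definition low_constant :: "real \<Rightarrow> 'v::zero nov \<Rightarrow> bool" where
  "low_constant e a \<longleftrightarrow> (\<forall>s q. s < e \<longrightarrow> (s, q) \<noteq> (0, 0) \<longrightarrow> ncoeff a s q = 0)"

lemma ncons_low:
  assumes "low_constant e a" "s < e"
  shows "ncoeff (ncons a t) s q = tensor_cons (ncoeff a 0 0) (ncoeff t s q)"
proof -
  let ?A = "insert (0, 0) {(s', q'). s' \<le> s \<and> ncoeff a s' q' \<noteq> 0}"
  have fin: "finite ?A" by (intro finite.insertI finite_ncoeff)
  have "ncoeff (ncons a t) s q = (\<Sum>(s', q')\<in>?A. tensor_cons (ncoeff a s' q') (ncoeff t (s - s') (q - q')))"
    by (rule ncoeff_ncons[OF fin]) auto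
  also have "\<dots> = (\<Sum>(s', q')\<in>{(0, 0)}. tensor_cons (ncoeff a s' q') (ncoeff t (s - s') (q - q')))"
  proof (rule sum.mono_neutral_right[OF fin])
    have "ncoeff a s' q' = 0" if "s' \<le> s" "(s', q') \<noteq> (0, 0)" for s' q'
      using assms that unfolding low_constant_def by (meson le_less_trans)
    then show "\<forall>i\<in>?A - {(0, 0)}. (case i of (s', q') \<Rightarrow> tensor_cons (ncoeff a s' q') (ncoeff t (s - s') (q - q'))) = 0"
      by auto
  qed auto
  finally show ?thesis by simp
qed

text \<open>Below the gap only the \<open>T^0 e^0\<close> part of each letter is present, so the
  product has a single possible coefficient there.\<close>

lemma nov_word_low:
  assumes "\<And>a. a \<in> set as \<Longrightarrow> low_constant e a" "s < e"
  shows "ncoeff (nov_word as) s q = (if s = 0 \<and> q = 0 then tword (map (\<lambda>a. ncoeff a 0 0) as) else 0)"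
  using assms
proof (induction as)
  case Nil
  then show ?case by (simp add: ncoeff_nov_const)
next
  case (Cons a as)
  have "low_constant e a" using Cons.prems by simp
  then show ?case
    using Cons by (simp add: nov_word_Cons ncons_low[OF \<open>low_constant e a\<close> assms(2)] tensor_cons_tword tensor_cons_zero del: nov_word.simps(2))
qed

lemma tensor_cons_length: "t \<in> tensor_length n \<Longrightarrow> tensor_cons v t \<in> tensor_length (Suc n)"
proof -
  assume t: "t \<in> tensor_length n"
  have "t \<in> {t. tensor_cons v t \<in> tensor_length (Suc n)}"
  proof (rule tensor_length_in_words[OF _ _ t])
    show "subspace {t. tensor_cons v t \<in> tensor_length (Suc n)}"
      using linear_subspace_vimage[OF linear_tensor_cons subspace_tensor_length] by (simp add: vimage_def)
    fix xs :: "'a list" assume "length xs = n"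
    then show "tword xs \<in> {t. tensor_cons v t \<in> tensor_length (Suc n)}"
      using tword_tensor_length[of "v # xs"] by (simp add: tensor_cons_tword)
  qed
  then show ?thesis by simp
qed

lemma nov_word_length: "nov_word as \<in> coeffs_in (\<lambda>q. tensor_length (length as))"
proof (induction as)
  case Nil
  then show ?case
    using tword_tensor_length[of "[]"] subspace_0[OF subspace_tensor_length]
    by (auto simp: coeffs_in_def ncoeff_nov_const)
next
  case (Cons a as)
  then show ?case
    unfolding nov_word_Cons by (intro ncons_coeffs_in[OF subspace_tensor_length]) (auto simp: coeffs_in_def intro: tensor_cons_length)
qed

lemma tensor_cons_degree:
  assumes "x \<in> gr n" "t \<in> tensor_degree gr m"
  shows "tensor_cons x t \<in> tensor_degree gr (n - 1 + m)"
proof (rule linear_maps_tensor_degree[OF linear_tensor_cons subspace_tensor_degree assms(2)])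
  fix ns xs assume "hom_word gr ns xs" "sdeg ns = m"
  then show "tensor_cons x (tword xs) \<in> tensor_degree gr (n - 1 + m)"
    unfolding tensor_cons_tword using assms(1) by (intro tword_tensor_degree[of gr "n # ns"]) auto
qed

lemma nov_word_degree:
  assumes "list_all2 (\<lambda>n a. a \<in> nov_degree gr n) ns as"
  shows "nov_word as \<in> coeffs_in (\<lambda>q. tensor_degree gr (sdeg ns - 2 * q))"
  using assms
proof (induction ns as rule: list_all2_induct)
  case Nil
  have "tword [] \<in> tensor_degree gr 0" by (rule tword_tensor_degree[of gr "[]"]) auto
  then show ?case using subspace_0[OF subspace_tensor_degree] by (auto simp: coeffs_in_def ncoeff_nov_const)
next
  case (Cons n ns a as)
  show ?case
    unfolding nov_word_Cons
  proof (rule ncons_coeffs_in[OF subspace_tensor_degree])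
    fix s q s' q'
    have "ncoeff a s q \<in> gr (n - 2 * q)" "ncoeff (nov_word as) s' q' \<in> tensor_degree gr (sdeg ns - 2 * q')"
      using Cons by (auto simp: nov_degree_def coeffs_in_def)
    from tensor_cons_degree[OF this]
    show "tensor_cons (ncoeff a s q) (ncoeff (nov_word as) s' q') \<in> tensor_degree gr (sdeg (n # ns) - 2 * (q + q'))"
      by (simp add: algebra_simps)
  qed
qed

context
  fixes gr :: "int \<Rightarrow> 'a::real_vector set"
  assumes gr: "graded_space gr"
begin

lemma tswap_Suc_cons: "tswap gr (Suc j) (tensor_cons x t) = tensor_cons x (tswap gr j t)"
proof -
  have *: "tswap gr (Suc j) (tensor_cons x (tword ys)) = tensor_cons x (tswap gr j (tword ys))"
    if x: "x \<in> gr n" and h: "hom_word gr ns ys" for x n ys ns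
  proof (cases "Suc j < length ys")
    case False
    then show ?thesis
      using tswap_short[OF gr h] tswap_short[OF gr, of "n # ns" "x # ys" "Suc j"] x h by (simp add: tensor_cons_tword)
  next
    case True
    obtain us u k a ws w where 1: "ns = us @ k # ws" "ys = u @ a # w" "length u = j"
      "hom_word gr us u" "a \<in> gr k" "hom_word gr ws w"
      by (rule hom_word_split_nth[OF h, of j]) ((use True in auto)[1], (rule that; assumption))
    then obtain b z l zs where 2: "w = b # z" "ws = l # zs" "b \<in> gr l" "hom_word gr zs z"
      using True by (cases w) (auto simp: list_all2_Cons2)
    have "hom_word gr (n # us) (x # u)" using x 1 by simp
    from tswap_tword[OF gr this 1(5) 2(3,4)] tswap_tword[OF gr 1(4,5) 2(3,4)] 1(3)
    show ?thesis by (simp add: 1 2 tensor_cons_tword linear_scale[OF linear_tensor_cons])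
  qed
  have hom: "tswap gr (Suc j) (tensor_cons x t) = tensor_cons x (tswap gr j t)" if x: "x \<in> gr n" for x n t
    by (rule linear_eq_on_hom_words[OF gr linear_compose[OF linear_tensor_cons linear_tswap[OF gr], unfolded o_def]
          linear_compose[OF linear_tswap[OF gr] linear_tensor_cons, unfolded o_def]]) (rule *[OF x])
  show ?thesis
    by (rule linear_eq_on_span[OF linear_compose[OF linear_tensor_cons_left linear_tswap[OF gr], unfolded o_def]
          linear_tensor_cons_left _ graded_span[OF gr]]) (use hom in auto)
qed

lemma tswap_0_cons:
  assumes "x \<in> gr n" "y \<in> gr m"
  shows "tswap gr 0 (tensor_cons x (tensor_cons y t)) = (-1) powi ((n - 1) * (m - 1)) *\<^sub>R tensor_cons y (tensor_cons x t)"
proof -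
  have lin: "linear (\<lambda>t. tswap gr 0 (tensor_cons x (tensor_cons y t)))"
    "linear (\<lambda>t. (-1) powi ((n - 1) * (m - 1)) *\<^sub>R tensor_cons y (tensor_cons x t))"
    by (auto simp: linear_iff linear_add[OF linear_tensor_cons] linear_scale[OF linear_tensor_cons]
        linear_add[OF linear_tswap[OF gr]] linear_scale[OF linear_tswap[OF gr]] scaleR_add_right)
  show ?thesis
  proof (rule linear_eq_on_hom_words[OF gr lin])
    fix ns xs assume "hom_word gr ns xs"
    from tswap_tword[OF gr list.rel_intros(1) assms this]
    show "tswap gr 0 (tensor_cons x (tensor_cons y (tword xs))) =
        (-1) powi ((n - 1) * (m - 1)) *\<^sub>R tensor_cons y (tensor_cons x (tword xs))"
      by (simp add: tensor_cons_tword)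
  qed
qed

lemma nov_tswap_Suc_ncons: "nov_map (tswap gr (Suc j)) (ncons a t) = ncons a (nov_map (tswap gr j) t)"
  by (rule nov_eqI)
    (simp add: ncoeff_nov_map linear_tswap[OF gr] ncoeff_ncons[OF finite_ncoeff order_refl]
      linear_sum[OF linear_tswap[OF gr]] tswap_Suc_cons split_beta)

lemma nov_tswap_0_ncons:
  assumes a: "a \<in> nov_degree gr n" and b: "b \<in> nov_degree gr m"
  shows "nov_map (tswap gr 0) (ncons a (ncons b t)) = (-1) powi ((n - 1) * (m - 1)) *\<^sub>R ncons b (ncons a t)"
proof (rule nov_eqI)
  fix s q
  \<comment> \<open>Energies are nonnegative, so the supports below \<open>s\<close> serve for the
    inner sums at \<open>s - s'\<close> too. Both orders of summation then run over the same finite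
    product.\<close>
  define A where "A = {(s', q'). s' \<le> s \<and> ncoeff a s' q' \<noteq> 0}"
  define B where "B = {(s', q'). s' \<le> s \<and> ncoeff b s' q' \<noteq> 0}"
  have fin: "finite A" "finite B" by (auto simp: A_def B_def finite_ncoeff)
  have nonneg: "0 \<le> s'" if "(s', q') \<in> A \<or> (s', q') \<in> B" for s' q'
    using that ncoeff_neg[of s' a q'] ncoeff_neg[of s' b q'] by (auto simp: A_def B_def intro: leI)
  have inner: "ncoeff (ncons b t) (s - s') (q - q') =
      (\<Sum>(s'', q'')\<in>B. tensor_cons (ncoeff b s'' q'') (ncoeff t (s - s' - s'') (q - q' - q'')))"
    if "(s', q') \<in> A" for s' q'
    by (rule ncoeff_ncons[OF fin(2)]) (use that nonneg[of s' q'] in \<open>auto simp: B_def\<close>)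
  have inner': "ncoeff (ncons a t) (s - s') (q - q') =
      (\<Sum>(s'', q'')\<in>A. tensor_cons (ncoeff a s'' q'') (ncoeff t (s - s' - s'') (q - q' - q'')))"
    if "(s', q') \<in> B" for s' q'
    by (rule ncoeff_ncons[OF fin(1)]) (use that nonneg[of s' q'] in \<open>auto simp: A_def\<close>)
  \<comment> \<open>The degrees of the coefficients differ from \<open>n\<close> and
    \<open>m\<close> by even numbers, so one common sign comes out of the sum.\<close>
  have sg: "tswap gr 0 (tensor_cons (ncoeff a s' q') (tensor_cons (ncoeff b s'' q'') u)) =
      (-1) powi ((n - 1) * (m - 1)) *\<^sub>R tensor_cons (ncoeff b s'' q'') (tensor_cons (ncoeff a s' q') u)"
    for s' q' s'' q'' u
  proof -
    have "ncoeff a s' q' \<in> gr (n - 2 * q')" "ncoeff b s'' q'' \<in> gr (m - 2 * q'')"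
      using a b by (auto simp: nov_degree_def)
    from tswap_0_cons[OF this, of u] show ?thesis by (simp add: neg_one_powi)
  qed
  have "ncoeff (nov_map (tswap gr 0) (ncons a (ncons b t))) s q =
      tswap gr 0 (\<Sum>(s', q')\<in>A. tensor_cons (ncoeff a s' q') (ncoeff (ncons b t) (s - s') (q - q')))"
    by (simp add: ncoeff_nov_map linear_tswap[OF gr] ncoeff_ncons[OF fin(1)[unfolded A_def] order_refl] A_def)
  also have "\<dots> = tswap gr 0 (\<Sum>(s', q')\<in>A. \<Sum>(s'', q'')\<in>B.
      tensor_cons (ncoeff a s' q') (tensor_cons (ncoeff b s'' q'') (ncoeff t (s - s' - s'') (q - q' - q''))))"
    using nonneg by (intro arg_cong[of _ _ "tswap gr 0"] sum.cong[OF refl] prod.case_cong[OF refl])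
      (simp add: inner linear_sum[OF linear_tensor_cons] split_beta)
  also have "\<dots> = (\<Sum>(s', q')\<in>A. \<Sum>(s'', q'')\<in>B. (-1) powi ((n - 1) * (m - 1)) *\<^sub>R
      tensor_cons (ncoeff b s'' q'') (tensor_cons (ncoeff a s' q') (ncoeff t (s - s' - s'') (q - q' - q''))))"
    by (simp add: linear_sum[OF linear_tswap[OF gr]] split_beta sg)
  also have "\<dots> = (\<Sum>(s'', q'')\<in>B. \<Sum>(s', q')\<in>A. (-1) powi ((n - 1) * (m - 1)) *\<^sub>R
      tensor_cons (ncoeff b s'' q'') (tensor_cons (ncoeff a s' q') (ncoeff t (s - s'' - s') (q - q'' - q'))))"
    unfolding split_beta by (subst sum.swap) (simp add: algebra_simps)
  also have "\<dots> = (-1) powi ((n - 1) * (m - 1)) *\<^sub>R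
      (\<Sum>(s'', q'')\<in>B. tensor_cons (ncoeff b s'' q'') (ncoeff (ncons a t) (s - s'') (q - q'')))"
    unfolding scaleR_sum_right
    using nonneg by (intro sum.cong[OF refl])
      (auto simp: inner' linear_sum[OF linear_tensor_cons] split_beta scaleR_sum_right)
  also have "\<dots> = ncoeff ((-1) powi ((n - 1) * (m - 1)) *\<^sub>R ncons b (ncons a t)) s q"
    by (simp add: ncoeff_ncons[OF fin(2)[unfolded B_def] order_refl] B_def)
  finally show "ncoeff (nov_map (tswap gr 0) (ncons a (ncons b t))) s q =
    ncoeff ((-1) powi ((n - 1) * (m - 1)) *\<^sub>R ncons b (ncons a t)) s q" .
qed

lemma nov_tswap_word:
  assumes "a \<in> nov_degree gr n" "b \<in> nov_degree gr m"
  shows "nov_map (tswap gr (length as)) (nov_word (as @ a # b # cs)) =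
    (-1) powi ((n - 1) * (m - 1)) *\<^sub>R nov_word (as @ b # a # cs)"
  by (induction as)
    (simp_all add: nov_word_Cons nov_tswap_0_ncons[OF assms] nov_tswap_Suc_ncons linear_scale[OF linear_ncons]
      del: nov_word.simps(2))

lemma nov_move_left_word:
  assumes a: "a \<in> nov_degree gr n" and bs: "list_all2 (\<lambda>n a. a \<in> nov_degree gr n) ns bs"
  shows "nov_map (move_left gr (length as) (length bs)) (nov_word (as @ bs @ a # cs)) =
    (-1) powi ((n - 1) * sdeg ns) *\<^sub>R nov_word (as @ a # bs @ cs)"
  using bs
proof (induction ns bs arbitrary: as rule: list_all2_induct)
  case Nil
  then show ?case by (simp add: nov_eqI ncoeff_nov_map linear_iff)
next
  case (Cons m ns b bs)
  have "nov_map (move_left gr (length as) (Suc (length bs))) x =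
      nov_map (tswap gr (length as)) (nov_map (move_left gr (length (as @ [b])) (length bs)) x)" for x
    by (rule nov_eqI) (simp add: ncoeff_nov_map[OF linear_move_left[OF gr]] ncoeff_nov_map[OF linear_tswap[OF gr]])
  then show ?case
    using Cons.IH[of "as @ [b]"] nov_tswap_word[OF Cons.hyps(1) a, of as "bs @ cs"]
    by (simp add: linear_scale[OF linear_nov_map[OF linear_tswap[OF gr]]] neg_one_powi del: move_left.simps)
qed

lemma nov_trotate_word:
  assumes "a \<in> nov_degree gr n" "list_all2 (\<lambda>n a. a \<in> nov_degree gr n) ns bs"
  shows "nov_map (trotate gr) (nov_word (bs @ [a])) = (-1) powi ((n - 1) * sdeg ns) *\<^sub>R nov_word (a # bs)"
proof -
  have "nov_map (trotate gr) (nov_word (bs @ [a])) = nov_map (move_left gr 0 (length bs)) (nov_word (bs @ [a]))"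
  proof (rule nov_eqI)
    fix s q
    have "ncoeff (nov_word (bs @ [a])) s q \<in> tensor_length (Suc (length bs))"
      using nov_word_length[of "bs @ [a]"] by (simp add: coeffs_in_def)
    from trotate_move_left[OF gr this]
    show "ncoeff (nov_map (trotate gr) (nov_word (bs @ [a]))) s q =
        ncoeff (nov_map (move_left gr 0 (length bs)) (nov_word (bs @ [a]))) s q"
      by (simp add: ncoeff_nov_map linear_trotate[OF gr] linear_move_left[OF gr])
  qed
  then show ?thesis using nov_move_left_word[OF assms, of "[]" "[]"] by simp
qed

end

section \<open>The induced map preserves the subcomplexes\<close>

text \<open>A cutting is recorded by the lengths of its pieces. This does not refer to the letters,
  so all words of one length share an index set, and rearranging pieces becomes rearranging a list
  of numbers.\<close>

primrec cut :: "nat list \<Rightarrow> 'a list \<Rightarrow> 'a list list" where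
  "cut [] xs = []"
| "cut (k # ks) xs = take k xs # cut ks (drop k xs)"

lemma length_cut [simp]: "length (cut ks xs) = length ks"
  by (induction ks arbitrary: xs) auto

lemma concat_cut: "sum_list ks = length xs \<Longrightarrow> concat (cut ks xs) = xs"
  by (induction ks arbitrary: xs) auto

lemma map_length_cut: "sum_list ks = length xs \<Longrightarrow> map length (cut ks xs) = ks"
  by (induction ks arbitrary: xs) auto

lemma cut_map_length: "cut (map length ps) (concat ps) = ps"
  by (induction ps) auto

lemma cut_append: "sum_list ks = length xs \<Longrightarrow> cut (ks @ ks') (xs @ ys) = cut ks xs @ cut ks' ys"
  by (induction ks arbitrary: xs) auto

text \<open>A map of degree 0 takes a piece with degrees \<open>ns\<close> to unshifted degree
  \<open>sdeg ns + 1\<close>. The shifted degree of the output letter is thus that of its piece, and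
  the total is preserved.\<close>

lemma sdeg_cut: "sum_list ks = length ns \<Longrightarrow> sdeg (map (\<lambda>ns. sdeg ns + 1) (cut ks ns)) = sdeg ns"
proof (induction ks arbitrary: ns)
  case (Cons k ks)
  then have "sdeg (map (\<lambda>ns. sdeg ns + 1) (cut ks (drop k ns))) = sdeg (drop k ns)" by simp
  moreover have "sdeg ns = sdeg (take k ns) + sdeg (drop k ns)"
    by (metis append_take_drop_id map_append sum_list_append)
  ultimately show ?case by simp
qed simp

lemma hom_words_cut: "hom_word gr ns xs \<Longrightarrow> list_all2 (hom_word gr) (cut ks ns) (cut ks xs)"
  by (induction ks arbitrary: ns xs) (auto intro: list_all2_takeI list_all2_dropI)

context
  fixes gr1 :: "int \<Rightarrow> 'a::real_vector set" and gr2 :: "int \<Rightarrow> 'b::real_vector set"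
    and f :: "'a nov list \<Rightarrow> 'b nov"
  assumes gr1: "graded_space gr1" and gr2: "graded_space gr2" and f: "filtered_maps gr1 gr2 0 f"
begin

private abbreviation (input) "g \<equiv> \<lambda>p. f (map nov_const p)"

private lemma mlg: "multilinear_words g"
  using f by (intro multilinear_words_const_of_nov_multilinear) (simp add: filtered_maps_def)

definition cut_word :: "nat list \<Rightarrow> 'a list \<Rightarrow> 'b tensor nov" where
  "cut_word ks xs = nov_word (map g (cut ks xs))"

lemma multilinear_cut_word: "multilinear_words (\<lambda>xs. if length xs = sum_list ks then cut_word ks xs else 0)"
proof (induction ks)
  case Nil
  then show ?case by (auto simp: multilinear_words_iff_update linear_iff)
next
  case (Cons k ks)
  show ?case
    unfolding multilinear_words_iff_update
  proof (intro allI impI)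
    fix xs :: "'a list" and p assume p: "p < length xs"
    have "linear (\<lambda>x. cut_word (k # ks) (xs[p := x]))" if len: "length xs = k + sum_list ks"
    proof (cases "p < k")
      case True
      have "linear (\<lambda>x. g ((take k xs)[p := x]))"
        using mlg[unfolded multilinear_words_iff_update, rule_format, of p "take k xs"] True p by simp
      from linear_compose[OF this linear_ncons_left] True show ?thesis
        by (simp add: cut_word_def nov_word_Cons o_def take_update_swap del: nov_word.simps(2))
    next
      case False
      have "linear (\<lambda>x. cut_word ks ((drop k xs)[p - k := x]))"
        using Cons.IH[unfolded multilinear_words_iff_update, rule_format, of "p - k" "drop k xs"] p False len by simp
      from linear_compose[OF this linear_ncons] False show ?thesis
        by (simp add: cut_word_def nov_word_Cons o_def drop_update_swap del: nov_word.simps(2))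
    qed
    then show "linear (\<lambda>x. if length (xs[p := x]) = sum_list (k # ks) then cut_word (k # ks) (xs[p := x]) else 0)"
      by (cases "length xs = k + sum_list ks") (simp_all, auto simp: linear_iff)
  qed
qed

definition cut_map :: "nat list \<Rightarrow> 'a tensor \<Rightarrow> 'b tensor nov" where
  "cut_map ks = tensor_lift (\<lambda>xs. if length xs = sum_list ks then cut_word ks xs else 0)"

lemma linear_cut_map: "linear (cut_map ks)"
  unfolding cut_map_def by (rule linear_tensor_lift[OF multilinear_cut_word])

lemma cut_map_tword: "cut_map ks (tword xs) = (if length xs = sum_list ks then cut_word ks xs else 0)"
  unfolding cut_map_def by (rule tensor_lift_tword[OF multilinear_cut_word])

lemma cut_letters_degree:
  assumes "hom_word gr1 ns xs"
  shows "list_all2 (\<lambda>n a. a \<in> nov_degree gr2 n) (map (\<lambda>ns. sdeg ns + 1) (cut ks ns)) (map g (cut ks xs))"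
  unfolding list_all2_map1 list_all2_map2
  using hom_words_cut[OF assms] by (rule list_all2_mono) (use filtered_maps_degree[OF f gr1] in simp)

section \<open>Convergence of the sum over cuttings\<close>

definition positive_energy :: real where
  "positive_energy = (SOME E. E > 0 \<and> f [] \<in> energy_ge E)"

private lemma E0: "positive_energy > 0" "f [] \<in> energy_ge positive_energy"
  using f someI_ex[of "\<lambda>E. E > 0 \<and> f [] \<in> energy_ge E"] by (auto simp: filtered_maps_def positive_energy_def)

text \<open>In a cutting of \<open>n\<close> letters at least \<open>length ks - n\<close> pieces
  are empty, and each of these contributes \<open>positive_energy\<close>. Cuttings with more pieces
  than this bound therefore have zero coefficient at energy \<open>s\<close>.\<close>

definition cut_bound :: "nat \<Rightarrow> real \<Rightarrow> nat" where
  "cut_bound n s = n + nat \<lceil>s / positive_energy\<rceil>"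

definition cuttings :: "nat \<Rightarrow> nat \<Rightarrow> nat list set" where
  "cuttings n b = {ks. sum_list ks = n \<and> length ks \<le> b}"

lemma finite_cuttings: "finite (cuttings n b)"
proof (rule finite_subset)
  show "cuttings n b \<subseteq> {ks. set ks \<subseteq> {..n} \<and> length ks \<le> b}"
    by (auto simp: cuttings_def dest: member_le_sum_list)
qed (rule finite_lists_length_le, simp)

text \<open>Piece by piece: an empty piece is credited \<open>positive_energy\<close>, a nonempty
  one with \<open>l\<close> letters the nonpositive amount \<open>(1 - l) * positive_energy\<close>.
  This makes the bound additive along the list of pieces.\<close>

lemma nov_word_cut_energy:
  "nov_word (map g ps) \<in> energy_ge (real (length ps) * positive_energy - real (length (concat ps)) * positive_energy)"
proof (induction ps)
  case Nil
  then show ?case by (simp add: energy_ge_0)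
next
  case (Cons p ps)
  have "g p \<in> energy_ge (positive_energy - real (length p) * positive_energy)"
  proof (cases p)
    case Nil
    then show ?thesis using E0 by simp
  next
    case (Cons x xs)
    then have "positive_energy - real (length p) * positive_energy \<le> 0"
      using E0(1) by (simp add: algebra_simps)
    then show ?thesis using energy_ge_mono energy_ge_0 by blast
  qed
  from ncons_energy[OF this Cons.IH] show ?case
    by (simp add: nov_word_Cons algebra_simps del: nov_word.simps(2))
qed

lemma nov_word_cut_zero:
  assumes "cut_bound (length (concat ps)) s < length ps"
  shows "ncoeff (nov_word (map g ps)) s q = 0"
proof -
  let ?n = "length (concat ps)"
  have "s / positive_energy \<le> real (nat \<lceil>s / positive_energy\<rceil>)" by linarith
  also have "\<dots> < real (length ps) - real ?n" using assms by (simp add: cut_bound_def)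
  finally have "s < (real (length ps) - real ?n) * positive_energy"
    using E0(1) by (simp add: pos_divide_less_eq)
  then show ?thesis using nov_word_cut_energy[of ps] by (simp add: energy_ge_def algebra_simps)
qed

definition map_word :: "'a list \<Rightarrow> 'b tensor nov" where
  "map_word xs = nov_sum (\<lambda>ps. nov_word (map g ps)) {ps. concat ps = xs}"

lemma summable_cuts: "nov_summable (\<lambda>ps. nov_word (map g ps)) {ps. concat ps = xs}"
  unfolding nov_summable_def
proof
  fix E
  let ?b = "cut_bound (length xs) E"
  have "length ps \<le> ?b" if "concat ps = xs" "nov_word (map g ps) \<notin> energy_ge E" for ps
  proof (rule ccontr)
    assume *: "\<not> length ps \<le> ?b"
    have "ncoeff (nov_word (map g ps)) s q = 0" if "s < E" for s q
    proof (rule nov_word_cut_zero)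
      have "cut_bound (length xs) s \<le> ?b"
        unfolding cut_bound_def using that E0(1) by (intro add_left_mono nat_mono ceiling_mono divide_right_mono) auto
      then show "cut_bound (length (concat ps)) s < length ps" using * \<open>concat ps = xs\<close> by simp
    qed
    then show False using that(2) by (simp add: energy_ge_def)
  qed
  then have "{ps \<in> {ps. concat ps = xs}. nov_word (map g ps) \<notin> energy_ge E} \<subseteq>
      (\<lambda>ks. cut ks xs) ` cuttings (length xs) ?b"
    by (auto simp: cuttings_def length_concat cut_map_length intro!: image_eqI[of _ _ "map length _"])
  then show "finite {ps \<in> {ps. concat ps = xs}. nov_word (map g ps) \<notin> energy_ge E}"
    by (rule finite_subset) (intro finite_imageI finite_cuttings)
qed

lemma ncoeff_map_word:
  assumes "cut_bound (length xs) s \<le> b"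
  shows "ncoeff (map_word xs) s q = (\<Sum>ks\<in>cuttings (length xs) b. ncoeff (cut_word ks xs) s q)"
proof -
  let ?P = "(\<lambda>ks. cut ks xs) ` cuttings (length xs) b"
  have inj: "inj_on (\<lambda>ks. cut ks xs) (cuttings (length xs) b)"
    by (rule inj_on_inverseI[of _ "map length"]) (simp add: cuttings_def map_length_cut)
  have "ncoeff (map_word xs) s q =
      (\<Sum>ps | ps \<in> {ps. concat ps = xs} \<and> ncoeff (nov_word (map g ps)) s q \<noteq> 0. ncoeff (nov_word (map g ps)) s q)"
    unfolding map_word_def by (rule ncoeff_nov_sum[OF summable_cuts])
  also have "\<dots> = (\<Sum>ps\<in>?P. ncoeff (nov_word (map g ps)) s q)"
  proof (rule sum.mono_neutral_left)
    show "finite ?P" by (intro finite_imageI finite_cuttings)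
    show "{ps. ps \<in> {ps. concat ps = xs} \<and> ncoeff (nov_word (map g ps)) s q \<noteq> 0} \<subseteq> ?P"
    proof
      fix ps assume "ps \<in> {ps. ps \<in> {ps. concat ps = xs} \<and> ncoeff (nov_word (map g ps)) s q \<noteq> 0}"
      then have ps: "concat ps = xs" "ncoeff (nov_word (map g ps)) s q \<noteq> 0" by auto
      then have "length ps \<le> b" using nov_word_cut_zero[of ps s q] assms by (cases "length ps \<le> b") auto
      then have "map length ps \<in> cuttings (length xs) b" using ps by (auto simp: cuttings_def length_concat)
      then show "ps \<in> ?P" using cut_map_length[of ps] ps(1) by (auto intro!: image_eqI[of _ _ "map length ps"])
    qed
  qed (auto simp: cuttings_def concat_cut)
  finally show ?thesis by (simp add: sum.reindex[OF inj] cut_word_def)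
qed

lemma multilinear_map_word: "multilinear_words map_word"
proof (rule multilinear_words_ncoeffI)
  fix s q
  have "ncoeff (map_word xs) s q = (\<Sum>ks\<in>cuttings (length xs) (cut_bound (length xs) s).
      ncoeff (if length xs = sum_list ks then cut_word ks xs else 0) s q)" for xs
    unfolding ncoeff_map_word[OF order_refl] by (intro sum.cong) (auto simp: cuttings_def)
  then show "multilinear_words (\<lambda>xs. ncoeff (map_word xs) s q)"
    by (rule multilinear_words_length_cong[where \<phi> = "\<lambda>n xs. \<Sum>ks\<in>cuttings n (cut_bound n s).
        ncoeff (if length xs = sum_list ks then cut_word ks xs else 0) s q", rotated])
      (intro multilinear_words_sum multilinear_words_ncoeff multilinear_cut_word)
qed

definition tensor_map :: "'a tensor \<Rightarrow> 'b tensor nov" where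
  "tensor_map = tensor_lift map_word"

lemma bar_map_conv: "bar_map f = nov_extend tensor_map"
  by (simp add: bar_map_def tensor_map_def map_word_def[abs_def])

lemma linear_tensor_map: "linear tensor_map"
  unfolding tensor_map_def by (rule linear_tensor_lift[OF multilinear_map_word])

lemma tensor_map_tword: "tensor_map (tword xs) = map_word xs"
  unfolding tensor_map_def by (rule tensor_lift_tword[OF multilinear_map_word])

lemma ncoeff_tensor_map:
  assumes "t \<in> tensor_length n"
  shows "ncoeff (tensor_map t) s q = (\<Sum>ks\<in>cuttings n (cut_bound n s). ncoeff (cut_map ks t) s q)"
proof (rule linear_eq_on_tensor_length[OF gr1 _ _ assms])
  show "linear (\<lambda>t. ncoeff (tensor_map t) s q)"
    using linear_compose[OF linear_tensor_map linear_ncoeff] by (simp add: o_def)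
  show "linear (\<lambda>t. \<Sum>ks\<in>cuttings n (cut_bound n s). ncoeff (cut_map ks t) s q)"
    using linear_compose[OF linear_cut_map linear_ncoeff] by (intro linear_compose_sum) (simp add: o_def)
  fix ns xs assume "hom_word gr1 ns xs" "length xs = n"
  then show "ncoeff (tensor_map (tword xs)) s q =
      (\<Sum>ks\<in>cuttings n (cut_bound n s). ncoeff (cut_map ks (tword xs)) s q)"
    unfolding tensor_map_tword by (subst ncoeff_map_word[OF order_refl])
      (auto simp: cut_map_tword cuttings_def intro!: sum.cong)
qed

text \<open>Exchanging two neighbouring output letters is exchanging their pieces in the input.
  Since \<open>f\<close> has degree 0, each output letter has the shifted degree of its piece, so
  both exchanges carry the same Koszul sign.\<close>

lemma tswap_cut_map:
  assumes t: "t \<in> tensor_length (sum_list ks)" "\<And>j. tswap gr1 j t = t" and j: "Suc j < length ks"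
  shows "nov_map (tswap gr2 j) (cut_map ks t) = cut_map (ks[j := ks ! Suc j, Suc j := ks ! j]) t"
proof -
  obtain ks1 k k' ks2 where ks: "ks = ks1 @ k # k' # ks2" "length ks1 = j"
  proof
    show "ks = take j ks @ ks ! j # ks ! Suc j # drop (Suc (Suc j)) ks" "length (take j ks) = j"
      using j by (simp_all add: Cons_nth_drop_Suc)
  qed
  let ?i = "sum_list ks1" and ?ks = "ks1 @ k' # k # ks2"
  note lt = linear_tswap[OF gr2]
  have "nov_map (tswap gr2 j) (cut_map ks t) = cut_map ?ks (move_block gr1 ?i k k' t)"
  proof (rule linear_eq_on_tensor_length[OF gr1 linear_compose[OF linear_cut_map linear_nov_map[OF lt], unfolded o_def]
      linear_compose[OF linear_move_block[OF gr1] linear_cut_map, unfolded o_def] t(1)])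
    fix ns xs assume h: "hom_word gr1 ns xs" "length xs = sum_list ks"
    obtain us u rs r where 1: "ns = us @ rs" "xs = u @ r" "length u = ?i" "hom_word gr1 us u" "hom_word gr1 rs r"
      by (rule hom_word_split[OF h(1), of ?i]) ((use h(2) ks in auto)[1], (rule that; assumption))
    obtain vs v rs' r' where 2: "rs = vs @ rs'" "r = v @ r'" "length v = k" "hom_word gr1 vs v" "hom_word gr1 rs' r'"
      by (rule hom_word_split[OF 1(5), of k]) ((use h(2) ks 1 in auto)[1], (rule that; assumption))
    obtain vs' v' ws w where 3: "rs' = vs' @ ws" "r' = v' @ w" "length v' = k'" "hom_word gr1 vs' v'" "hom_word gr1 ws w"
      by (rule hom_word_split[OF 2(5), of k']) ((use h(2) ks 1 2 in auto)[1], (rule that; assumption))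
    have xs: "xs = u @ v @ v' @ w" by (simp add: 1 2 3)
    have len: "length w = sum_list ks2" using h(2) ks 1 2 3 by simp
    have c: "cut ks xs = cut ks1 u @ v # v' # cut ks2 w" "cut ?ks (u @ v' @ v @ w) = cut ks1 u @ v' # v # cut ks2 w"
      using 1 2 3 unfolding xs ks(1) by (simp_all add: cut_append)
    have deg: "g v \<in> nov_degree gr2 (sdeg vs + 1)" "g v' \<in> nov_degree gr2 (sdeg vs' + 1)"
      using filtered_maps_degree[OF f gr1 2(4)] filtered_maps_degree[OF f gr1 3(4)] by simp_all
    have "nov_map (tswap gr2 j) (cut_word ks xs) =
        (-1) powi (sdeg vs * sdeg vs') *\<^sub>R cut_word ?ks (u @ v' @ v @ w)"
      unfolding cut_word_def c using nov_tswap_word[OF gr2 deg, of "map g (cut ks1 u)" "map g (cut ks2 w)"] ks(2) by simp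
    moreover have "move_block gr1 ?i k k' (tword xs) = (-1) powi (sdeg vs * sdeg vs') *\<^sub>R tword (u @ v' @ v @ w)"
      unfolding xs using move_block_tword[OF gr1 1(4) 2(4) 3(4,5)] 1(3) 2(3) 3(3) by simp
    ultimately show "nov_map (tswap gr2 j) (cut_map ks (tword xs)) = cut_map ?ks (move_block gr1 ?i k k' (tword xs))"
      using 1 2 3 len h(2) by (simp add: linear_scale[OF linear_cut_map] cut_map_tword)
  qed
  moreover have "ks[j := ks ! Suc j, Suc j := ks ! j] = ?ks"
    using ks by (auto simp: nth_append list_update_append)
  ultimately show ?thesis using move_fixed(3)[of gr1 t, OF t(2)] by simp
qed

lemma cut_map_coeffs: "cut_map ks t \<in> coeffs_in (\<lambda>q. tensor_length (length ks))"
proof (rule linear_in_subspace_on_words[OF linear_cut_map subspace_coeffs_in[OF subspace_tensor_length]])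
  fix xs
  show "cut_map ks (tword xs) \<in> coeffs_in (\<lambda>q. tensor_length (length ks))"
    using nov_word_length[of "map g (cut ks xs)"] subspace_0[OF subspace_tensor_length]
    by (auto simp: cut_map_tword cut_word_def coeffs_in_def)
qed

lemma tensor_map_sym:
  assumes "t \<in> sym_tensors gr1"
  shows "tensor_map t \<in> coeffs_in (\<lambda>q. sym_tensors gr2)"
proof (rule coeffs_in_by_length[OF linear_tensor_map subspace_sym_tensors[OF gr2]])
  fix n
  have fixed: "tswap gr1 j (tensor_proj n t) = tensor_proj n t" for j
    using tensor_proj_sym[OF gr1 assms] by (simp add: sym_tensors_def)
  have "tswap gr2 j (ncoeff (tensor_map (tensor_proj n t)) s q) = ncoeff (tensor_map (tensor_proj n t)) s q" for s q j
  proof -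
    \<comment> \<open>The swap acts on the index set by exchanging two piece lengths. Cuttings with
      too few pieces stay in place, and on their values the swap is the identity.\<close>
    define \<sigma> where "\<sigma> = (\<lambda>ks :: nat list. if Suc j < length ks then ks[j := ks ! Suc j, Suc j := ks ! j] else ks)"
    let ?K = "cuttings n (cut_bound n s)"
    have sum_\<sigma>: "sum_list (\<sigma> ks) = sum_list ks" and \<sigma>\<sigma>: "\<sigma> (\<sigma> ks) = ks" for ks
    proof -
      have "sum_list (\<sigma> ks) = sum_list ks \<and> \<sigma> (\<sigma> ks) = ks"
      proof (cases "Suc j < length ks")
        case True
        then obtain ks1 k k' ks2 where "ks = ks1 @ k # k' # ks2" "length ks1 = j"
          using that[of "take j ks" "ks ! j" "ks ! Suc j" "drop (Suc (Suc j)) ks"] by (simp add: Cons_nth_drop_Suc)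
        then show ?thesis by (auto simp: \<sigma>_def nth_append list_update_append)
      qed (simp add: \<sigma>_def)
      then show "sum_list (\<sigma> ks) = sum_list ks" "\<sigma> (\<sigma> ks) = ks" by auto
    qed
    have bij: "bij_betw \<sigma> ?K ?K"
      by (rule bij_betw_byWitness[where f' = \<sigma>]) (auto simp: \<sigma>\<sigma> cuttings_def sum_\<sigma>, auto simp: \<sigma>_def)
    have "tswap gr2 j (ncoeff (cut_map ks (tensor_proj n t)) s q) = ncoeff (cut_map (\<sigma> ks) (tensor_proj n t)) s q"
      if "ks \<in> ?K" for ks
    proof (cases "Suc j < length ks")
      case True
      have "tensor_proj n t \<in> tensor_length (sum_list ks)" using that tensor_proj_in by (auto simp: cuttings_def)
      from tswap_cut_map[OF this fixed True] True show ?thesis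
        by (simp add: \<sigma>_def ncoeff_nov_map[OF linear_tswap[OF gr2], symmetric])
    next
      case False
      have "ncoeff (cut_map ks (tensor_proj n t)) s q \<in> tensor_length (length ks)"
        using cut_map_coeffs[of ks "tensor_proj n t"] by (simp add: coeffs_in_def)
      from tswap_tensor_length_short[OF gr2 this, of j] False show ?thesis by (simp add: \<sigma>_def)
    qed
    then show ?thesis
      unfolding ncoeff_tensor_map[OF tensor_proj_in] linear_sum[OF linear_tswap[OF gr2]]
      using sum.reindex_bij_betw[OF bij, of "\<lambda>ks. ncoeff (cut_map ks (tensor_proj n t)) s q"] by simp
  qed
  then show "tensor_map (tensor_proj n t) \<in> coeffs_in (\<lambda>q. sym_tensors gr2)"
    by (simp add: coeffs_in_def sym_tensors_def)
qed

lemma trotate_short: "graded_space gr \<Longrightarrow> t \<in> tensor_length 0 \<Longrightarrow> trotate gr t = t"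
  using tensor_permute_adjacent_product[of gr, OF _ cyclic_generator_permutes cyclic_generator_adjacent_product[of 0]]
  by (simp add: trotate_def)

text \<open>Bringing the last output letter to the front rotates the whole piece behind it to the
  front of the input, and a cyclic tensor is fixed by these rotations.\<close>

lemma trotate_cut_map:
  assumes t: "t \<in> tensor_length (sum_list ks)" "trotate gr1 t = t"
  shows "nov_map (trotate gr2) (cut_map (rotate1 ks) t) = cut_map ks t"
proof (cases ks)
  case Nil
  then show ?thesis
    using cut_map_coeffs[of "[]" t] trotate_short[OF gr2]
    by (intro nov_eqI) (simp add: ncoeff_nov_map linear_trotate[OF gr2] coeffs_in_def)
next
  case (Cons k ks')
  have lin: "linear (trotate gr1 ^^ k)" for k
    by (induction k) (auto simp: linear_iff linear_add[OF linear_trotate[OF gr1]] linear_scale[OF linear_trotate[OF gr1]])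
  have "nov_map (trotate gr2) (cut_map (ks' @ [k]) t) = cut_map (k # ks') ((trotate gr1 ^^ k) t)"
  proof (rule linear_eq_on_tensor_length[OF gr1 linear_compose[OF linear_cut_map linear_nov_map[OF linear_trotate[OF gr2]], unfolded o_def]
      linear_compose[OF lin linear_cut_map, unfolded o_def] t(1)])
    fix ns xs assume h: "hom_word gr1 ns xs" "length xs = sum_list ks"
    obtain us u vs v where 1: "ns = us @ vs" "xs = u @ v" "length u = sum_list ks'" "hom_word gr1 us u" "hom_word gr1 vs v"
      by (rule hom_word_split[OF h(1), of "sum_list ks'"]) ((use h(2) Cons in auto)[1], (rule that; assumption))
    have v: "length v = k" using 1 h(2) Cons by simp
    have c: "cut (ks' @ [k]) (u @ v) = cut ks' u @ [v]" "cut (k # ks') (v @ u) = v # cut ks' u"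
      using 1 v by (simp_all add: cut_append)
    have deg: "g v \<in> nov_degree gr2 (sdeg vs + 1)" using filtered_maps_degree[OF f gr1 1(5)] by simp
    have "sdeg (map (\<lambda>ns. sdeg ns + 1) (cut ks' us)) = sdeg us"
      by (rule sdeg_cut) (use 1(3) list_all2_lengthD[OF 1(4)] in simp)
    then have "nov_map (trotate gr2) (cut_word (ks' @ [k]) (u @ v)) =
        (-1) powi (sdeg us * sdeg vs) *\<^sub>R cut_word (k # ks') (v @ u)"
      unfolding cut_word_def c using nov_trotate_word[OF gr2 deg cut_letters_degree[OF 1(4), of ks']]
      by (simp add: mult.commute)
    then show "nov_map (trotate gr2) (cut_map (ks' @ [k]) (tword xs)) = cut_map (k # ks') ((trotate gr1 ^^ k) (tword xs))"
      using trotate_power_tword[OF gr1 1(5,4)] v 1 by (simp add: cut_map_tword linear_scale[OF linear_cut_map])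
  qed
  then show ?thesis using trotate_fixed_power[OF t(2)] by (simp add: Cons)
qed

lemma tensor_map_cyc:
  assumes "t \<in> cyc_tensors gr1"
  shows "tensor_map t \<in> coeffs_in (\<lambda>q. cyc_tensors gr2)"
proof (rule coeffs_in_by_length[OF linear_tensor_map subspace_cyc_tensors[OF gr2]])
  fix n
  have fixed: "trotate gr1 (tensor_proj n t) = tensor_proj n t"
    using tensor_proj_cyc[OF gr1 assms] by (simp add: cyc_tensors_def)
  have "trotate gr2 (ncoeff (tensor_map (tensor_proj n t)) s q) = ncoeff (tensor_map (tensor_proj n t)) s q" for s q
  proof -
    let ?K = "cuttings n (cut_bound n s)"
    have "sum_list (rotate1 ks) = sum_list ks" for ks :: "nat list" by (cases ks) simp_all
    then have "rotate1 ` ?K \<subseteq> ?K" by (auto simp: cuttings_def)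
    moreover have "inj_on rotate1 ?K" by (rule inj_onI) (metis bij_rotate1 bij_is_inj injD)
    ultimately have bij: "bij_betw rotate1 ?K ?K"
      by (simp add: bij_betw_def endo_inj_surj[OF finite_cuttings])
    have "trotate gr2 (ncoeff (cut_map (rotate1 ks) (tensor_proj n t)) s q) = ncoeff (cut_map ks (tensor_proj n t)) s q"
      if "ks \<in> ?K" for ks
    proof -
      have "tensor_proj n t \<in> tensor_length (sum_list ks)" using that tensor_proj_in by (auto simp: cuttings_def)
      from trotate_cut_map[OF this fixed] show ?thesis
        by (simp add: ncoeff_nov_map[OF linear_trotate[OF gr2], symmetric])
    qed
    then have "(\<Sum>ks\<in>?K. trotate gr2 (ncoeff (cut_map (rotate1 ks) (tensor_proj n t)) s q)) =
        (\<Sum>ks\<in>?K. ncoeff (cut_map ks (tensor_proj n t)) s q)" by simp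
    then show ?thesis
      unfolding ncoeff_tensor_map[OF tensor_proj_in] linear_sum[OF linear_trotate[OF gr2]]
      using sum.reindex_bij_betw[OF bij, of "\<lambda>ks. trotate gr2 (ncoeff (cut_map ks (tensor_proj n t)) s q)"] by simp
  qed
  then show "tensor_map (tensor_proj n t) \<in> coeffs_in (\<lambda>q. cyc_tensors gr2)"
    by (simp add: coeffs_in_def cyc_tensors_def)
qed

lemma tensor_map_degree:
  assumes "t \<in> tensor_degree gr1 n"
  shows "tensor_map t \<in> coeffs_in (\<lambda>q. tensor_degree gr2 (n - 2 * q))"
proof (rule linear_maps_tensor_degree[OF linear_tensor_map subspace_coeffs_in[OF subspace_tensor_degree] assms])
  fix ns xs assume h: "hom_word gr1 ns xs" "sdeg ns = n"
  have "cut_word ks xs \<in> coeffs_in (\<lambda>q. tensor_degree gr2 (n - 2 * q))" if "sum_list ks = length xs" for ks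
    using nov_word_degree[OF cut_letters_degree[OF h(1)], of ks] sdeg_cut[of ks ns] h that list_all2_lengthD[OF h(1)]
    by (simp add: cut_word_def)
  then show "tensor_map (tword xs) \<in> coeffs_in (\<lambda>q. tensor_degree gr2 (n - 2 * q))"
    unfolding coeffs_in_def tensor_map_tword mem_Collect_eq ncoeff_map_word[OF order_refl]
    by (intro allI subspace_sum[OF subspace_tensor_degree]) (auto simp: cuttings_def)
qed

lemma tensor_map_low:
  assumes low: "\<And>xs. low_constant e (g xs)" and s: "s < e" "(s, q) \<noteq> (0, 0)"
  shows "ncoeff (tensor_map t) s q = 0"
proof -
  have "ncoeff (tensor_map t) s q = (\<lambda>t. 0) t"
  proof (rule linear_eq_on_words[of "\<lambda>t. ncoeff (tensor_map t) s q"])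
    show "linear (\<lambda>t. ncoeff (tensor_map t) s q)"
      using linear_compose[OF linear_tensor_map linear_ncoeff] by (simp add: o_def)
    fix xs
    show "ncoeff (tensor_map (tword xs)) s q = 0"
      unfolding tensor_map_tword ncoeff_map_word[OF order_refl] cut_word_def
      using low s by (intro sum.neutral ballI) (subst nov_word_low[of _ e], auto)
  qed (simp add: linear_iff)
  then show ?thesis by simp
qed

lemma linear_reduction_single_map: "linear (\<lambda>x. reduction f [x])"
  using linear_compose[OF multilinear_words_linear_hd[OF mlg, of "[]"] linear_ncoeff[of 0 0]]
  by (simp add: reduction_def o_def)

text \<open>At energy 0 an empty piece contributes 0. A cutting into nonempty pieces has fewer
  pieces than letters unless all pieces are single letters, and that cutting is the functorial
  extension of the linear part.\<close>

lemma tensor_map_leading: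
  assumes low: "\<And>xs. low_constant e (g xs)" and e: "0 < e" and t: "t \<in> tensor_below (Suc n)"
  shows "ncoeff (tensor_map t) 0 0 - tensor_lift (\<lambda>xs. tword (map (\<lambda>x. reduction f [x]) xs)) t \<in> tensor_below n"
proof (rule linear_maps_tensor_below[OF gr1 _ subspace_tensor_below t])
  note ml = multilinear_words_map[OF multilinear_words_tword linear_reduction_single_map]
  show "linear (\<lambda>t. ncoeff (tensor_map t) 0 0 - tensor_lift (\<lambda>xs. tword (map (\<lambda>x. reduction f [x]) xs)) t)"
    using linear_compose[OF linear_tensor_map linear_ncoeff]
    by (intro linear_compose_sub linear_tensor_lift[OF ml]) (simp add: o_def)
  fix ns xs assume h: "hom_word gr1 ns xs" "length xs < Suc n"
  let ?K = "cuttings (length xs) (cut_bound (length xs) 0)"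
  define W where "W = (\<lambda>ks. tword (map (\<lambda>p. ncoeff (g p) 0 0) (cut ks xs)))"
  define ones where "ones = replicate (length xs) (1::nat)"
  have "ncoeff (cut_word ks xs) 0 0 = W ks" for ks
    unfolding cut_word_def W_def using low e by (subst nov_word_low[of _ e]) (auto simp: o_def)
  then have eq: "ncoeff (tensor_map (tword xs)) 0 0 = (\<Sum>ks\<in>?K. W ks)"
    unfolding tensor_map_tword ncoeff_map_word[OF order_refl] by simp
  have "ones \<in> ?K" by (simp add: ones_def cuttings_def cut_bound_def sum_list_replicate)
  then have "(\<Sum>ks\<in>?K. W ks) = W ones + (\<Sum>ks\<in>?K - {ones}. W ks)"
    by (rule sum.remove[OF finite_cuttings])
  moreover have "W ones = tword (map (\<lambda>x. reduction f [x]) xs)"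
  proof -
    have "cut (replicate (length ys) 1) ys = map (\<lambda>x. [x]) ys" for ys :: "'a list" by (induction ys) auto
    then show ?thesis by (simp add: W_def ones_def reduction_def o_def)
  qed
  moreover have "(\<Sum>ks\<in>?K - {ones}. W ks) \<in> tensor_below n"
  proof (rule subspace_sum[OF subspace_tensor_below])
    fix ks assume ks: "ks \<in> ?K - {ones}"
    show "W ks \<in> tensor_below n"
    proof (cases "0 \<in> set ks")
      case True
      moreover have "map length (cut ks xs) = ks" using ks by (simp add: cuttings_def map_length_cut)
      ultimately have "0 \<in> length ` set (cut ks xs)" by (metis set_map)
      then have "[] \<in> set (cut ks xs)" by auto
      moreover have "ncoeff (f []) 0 0 = 0" using E0 by (simp add: energy_ge_def)
      ultimately have "0 \<in> set (map (\<lambda>p. ncoeff (g p) 0 0) (cut ks xs))" by (force simp: image_iff)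
      then show ?thesis
        unfolding W_def by (simp add: multilinear_words_zero[OF multilinear_words_tword] subspace_0[OF subspace_tensor_below])
    next
      case False
      have *: "length ks \<le> sum_list ks \<and> (length ks = sum_list ks \<longrightarrow> (\<forall>k\<in>set ks. k = 1))"
        if "0 \<notin> set ks" for ks :: "nat list"
        using that by (induction ks) fastforce+
      have "length ks < length xs"
      proof (cases "length ks = sum_list ks")
        case True
        then have "ks = replicate (length ks) 1"
          using *[OF False] by (intro replicate_length_same[symmetric]) auto
        then show ?thesis using True ks by (auto simp: cuttings_def ones_def)
      next
        case False
        then show ?thesis using *[OF \<open>0 \<notin> set ks\<close>] ks by (auto simp: cuttings_def)
      qed
      then show ?thesis unfolding W_def using h(2) by (intro tword_tensor_below) simp
    qed
  qed
  ultimately show "ncoeff (tensor_map (tword xs)) 0 0 - tensor_lift (\<lambda>xs. tword (map (\<lambda>x. reduction f [x]) xs)) (tword xs) \<in> tensor_below n"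
    by (simp add: eq tensor_lift_tword[OF ml])
qed

end

section \<open>Homotopy inverses of quasi-isomorphisms of graded vector spaces\<close>

definition degree_map :: "(int \<Rightarrow> 'a::real_vector set) \<Rightarrow> (int \<Rightarrow> 'b::real_vector set) \<Rightarrow> int \<Rightarrow> ('a \<Rightarrow> 'b) \<Rightarrow> bool" where
  "degree_map gr1 gr2 k A \<longleftrightarrow> linear A \<and> (\<forall>n. A ` gr1 n \<subseteq> gr2 (n + k))"

lemma degree_map_linear: "degree_map gr1 gr2 k A \<Longrightarrow> linear A"
  by (simp add: degree_map_def)

lemma degree_mapD: "degree_map gr1 gr2 k A \<Longrightarrow> x \<in> gr1 n \<Longrightarrow> A x \<in> gr2 (n + k)"
  by (auto simp: degree_map_def)

lemma degree_map_compose: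
  assumes "degree_map gr1 gr2 k A" "degree_map gr2 gr3 l B"
  shows "degree_map gr1 gr3 (k + l) (\<lambda>x. B (A x))"
  using assms linear_compose[of A B] by (fastforce simp: degree_map_def o_def add.assoc[symmetric])

lemma degree_map_diff:
  assumes "graded_space gr2" "degree_map gr1 gr2 k A" "degree_map gr1 gr2 k B"
  shows "degree_map gr1 gr2 k (\<lambda>x. A x - B x)"
  unfolding degree_map_def
proof (intro conjI allI)
  show "linear (\<lambda>x. A x - B x)" using assms by (intro linear_compose_sub degree_map_linear)
  fix n
  show "(\<lambda>x. A x - B x) ` gr1 n \<subseteq> gr2 (n + k)"
    using degree_mapD[OF assms(2)] degree_mapD[OF assms(3)] by (blast intro: subspace_diff[OF graded_subspace[OF assms(1)]])
qed

lemma degree_map_id: "degree_map gr gr 0 (\<lambda>x. x)"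
  by (auto simp: degree_map_def linear_iff)

lemma linear_eq_on_homogeneous:
  assumes "graded_space gr" "linear A" "linear B" "\<And>n x. x \<in> gr n \<Longrightarrow> A x = B x"
  shows "A x = B x"
  by (rule linear_eq_on_span[OF assms(2,3) _ graded_span[OF assms(1)]]) (use assms(4) in auto)

lemma degree_map_hcomp:
  assumes gr: "graded_space gr1" "graded_space gr2" and A: "degree_map gr1 gr2 k A"
  shows "hcomp gr2 (n + k) (A x) = A (hcomp gr1 n x)"
proof (rule linear_eq_on_homogeneous[OF gr(1)
      linear_compose[OF degree_map_linear[OF A] linear_hcomp[OF gr(2)], unfolded o_def]
      linear_compose[OF linear_hcomp[OF gr(1)] degree_map_linear[OF A], unfolded o_def]])
  fix m x assume x: "x \<in> gr1 m"
  show "hcomp gr2 (n + k) (A x) = A (hcomp gr1 n x)"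
    by (simp add: hcomp_homogeneous[OF gr(1) x] hcomp_homogeneous[OF gr(2) degree_mapD[OF A x]]
        linear_0[OF degree_map_linear[OF A]])
qed

text \<open>The component of degree \<open>k\<close> of a linear map. Right inverses obtained by
  linear algebra need not respect the grading; their homogeneous components do, and still satisfy
  the relevant identities with homogeneous maps.\<close>

definition homogeneous_part ::
  "(int \<Rightarrow> 'a::real_vector set) \<Rightarrow> (int \<Rightarrow> 'b::real_vector set) \<Rightarrow> int \<Rightarrow> ('a \<Rightarrow> 'b) \<Rightarrow> 'a \<Rightarrow> 'b" where
  "homogeneous_part gr1 gr2 k A x = (\<Sum>n | hcomp gr1 n x \<noteq> 0. hcomp gr2 (n + k) (A (hcomp gr1 n x)))"

lemma homogeneous_part_homogeneous:
  assumes "graded_space gr1" "graded_space gr2" "linear A" "x \<in> gr1 n"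
  shows "homogeneous_part gr1 gr2 k A x = hcomp gr2 (n + k) (A x)"
  unfolding homogeneous_part_def hcomp_support_homogeneous[OF assms(1,4)]
  by (simp add: hcomp_homogeneous[OF assms(1,4)] linear_0[OF assms(3)] linear_0[OF linear_hcomp[OF assms(2)]])

lemma degree_map_homogeneous_part:
  assumes "graded_space gr1" "graded_space gr2" "linear A"
  shows "degree_map gr1 gr2 k (homogeneous_part gr1 gr2 k A)"
proof -
  have "linear (\<lambda>x. hcomp gr2 (n + k) (A x))" for n
    using linear_compose[OF assms(3) linear_hcomp[OF assms(2)]] by (simp add: o_def)
  then have "linear (homogeneous_part gr1 gr2 k A)"
    unfolding homogeneous_part_def by (rule linear_sum_hcomp[OF assms(1)])
  then show ?thesis
    using homogeneous_part_homogeneous[OF assms] hcomp_in[OF assms(2)] by (auto simp: degree_map_def)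
qed

text \<open>Over the reals \<open>d\<close> has a linear right inverse on its image. As
  \<open>d\<close> is homogeneous of degree 1, the component of degree \<open>-1\<close> of that
  inverse serves as well.\<close>

lemma homogeneous_generalized_inverse:
  assumes gr: "graded_space gr" and d: "degree_map gr gr 1 d"
  shows "\<exists>s. degree_map gr gr (-1) s \<and> (\<forall>x. d (s (d x)) = d x)"
proof -
  note lin = degree_map_linear[OF d]
  obtain s0 where s0: "linear s0" "\<forall>v\<in>d ` UNIV. d (s0 v) = v"
    using linear_exists_right_inverse_on[OF lin subspace_UNIV] by blast
  let ?s = "homogeneous_part gr gr (-1) s0"
  have deg: "degree_map gr gr (-1) ?s" by (rule degree_map_homogeneous_part[OF gr gr s0(1)])
  note lins = degree_map_linear[OF deg]
  have "d (?s (d x)) = d x" for x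
  proof (rule linear_eq_on_homogeneous[OF gr _ lin])
    show "linear (\<lambda>x. d (?s (d x)))"
      using linear_compose[OF linear_compose[OF lin lins] lin] by (simp add: o_def)
    fix n x assume x: "x \<in> gr n"
    have dx: "d x \<in> gr (n + 1)" by (rule degree_mapD[OF d x])
    have "d (?s (d x)) = d (hcomp gr n (s0 (d x)))"
      by (simp add: homogeneous_part_homogeneous[OF gr gr s0(1) dx])
    also have "\<dots> = hcomp gr (n + 1) (d x)"
      using degree_map_hcomp[OF gr gr d, of n "s0 (d x)"] s0(2) by simp
    also have "\<dots> = d x" using dx by (simp add: hcomp_homogeneous[OF gr])
    finally show "d (?s (d x)) = d x" .
  qed
  then show ?thesis using deg by blast
qed

lemma homogeneous_section:
  assumes gr: "graded_space gr1" "graded_space gr2" and d: "degree_map gr1 gr1 1 d1" "degree_map gr2 gr2 1 d2"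
    and f: "degree_map gr1 gr2 0 f"
    and surj: "\<And>y. d2 y = 0 \<Longrightarrow> \<exists>x w. d1 x = 0 \<and> y = f x + d2 w"
  shows "\<exists>g. degree_map gr2 gr1 0 g \<and> (\<forall>y. d1 (g y) = 0) \<and> (\<forall>y. d2 y = 0 \<longrightarrow> y - f (g y) \<in> range d2)"
proof -
  note lin = degree_map_linear[OF d(1)] degree_map_linear[OF d(2)] degree_map_linear[OF f]
  \<comment> \<open>By surjectivity on cohomology every cocycle is a value of this map on
    \<open>?V\<close>. A linear right inverse chooses the preimage cocycle and the correcting
    cochain simultaneously.\<close>
  let ?\<Psi> = "\<lambda>z. f (fst z) + d2 (snd z)" and ?V = "{z. d1 (fst z) = 0}"
  have "linear ?\<Psi>"
    by (simp add: linear_iff linear_add[OF lin(3)] linear_add[OF lin(2)] linear_scale[OF lin(3)] linear_scale[OF lin(2)]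
        scaleR_add_right)
  moreover have "subspace ?V"
    by (simp add: subspace_def linear_add[OF lin(1)] linear_scale[OF lin(1)] linear_0[OF lin(1)])
  ultimately obtain G where G: "range G \<subseteq> ?V" "linear G" "\<forall>v\<in>?\<Psi> ` ?V. ?\<Psi> (G v) = v"
    using linear_exists_right_inverse_on by blast
  define g0 where "g0 = (\<lambda>y. fst (G y))"
  have lg0: "linear g0" using linear_compose[OF G(2) linear_fst] by (simp add: g0_def o_def)
  have g0: "d1 (g0 y) = 0" for y using G(1) by (auto simp: g0_def)
  have g0': "\<exists>w. y - f (g0 y) = d2 w" if y: "d2 y = 0" for y
  proof -
    obtain x w where "d1 x = 0" "y = f x + d2 w" using surj[OF y] by blast
    then have "y \<in> ?\<Psi> ` ?V" by (intro image_eqI[of _ _ "(x, w)"]) auto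
    then have "f (fst (G y)) + d2 (snd (G y)) = y" using G(3) by blast
    then have "y - f (g0 y) = d2 (snd (G y))" by (simp add: g0_def algebra_simps)
    then show ?thesis ..
  qed
  let ?g = "homogeneous_part gr2 gr1 0 g0"
  have deg: "degree_map gr2 gr1 0 ?g" by (rule degree_map_homogeneous_part[OF gr(2,1) lg0])
  note lg = degree_map_linear[OF deg]
  have "d1 (?g y) = 0" for y
  proof -
    have "d1 (?g y) = (\<lambda>y. 0) y"
    proof (rule linear_eq_on_homogeneous[OF gr(2), of "\<lambda>y. d1 (?g y)"])
      show "linear (\<lambda>y. d1 (?g y))" using linear_compose[OF lg lin(1)] by (simp add: o_def)
      fix n y assume "y \<in> gr2 n"
      then have "d1 (?g y) = d1 (hcomp gr1 n (g0 y))" by (simp add: homogeneous_part_homogeneous[OF gr(2,1) lg0])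
      also have "\<dots> = 0" using degree_map_hcomp[OF gr(1,1) d(1), of n "g0 y"] by (simp add: g0 linear_0[OF linear_hcomp[OF gr(1)]])
      finally show "d1 (?g y) = 0" .
    qed (simp add: linear_iff)
    then show ?thesis by simp
  qed
  moreover have "y - f (?g y) \<in> range d2" if y: "d2 y = 0" for y
  proof -
    have hom: "z - f (?g z) \<in> range d2" if z: "z \<in> gr2 n" "d2 z = 0" for z n
    proof -
      obtain w where w: "z - f (g0 z) = d2 w" using g0' z(2) by blast
      have "z - f (?g z) = hcomp gr2 n z - hcomp gr2 n (f (g0 z))"
        using degree_map_hcomp[OF gr f, of n "g0 z"] z(1)
        by (simp add: homogeneous_part_homogeneous[OF gr(2,1) lg0] hcomp_homogeneous[OF gr(2)])
      also have "\<dots> = hcomp gr2 n (d2 w)" by (simp add: linear_diff[OF linear_hcomp[OF gr(2)], symmetric] w)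
      also have "\<dots> = d2 (hcomp gr2 (n - 1) w)" using degree_map_hcomp[OF gr(2,2) d(2), of "n - 1" w] by simp
      finally show ?thesis by blast
    qed
    have lfg: "linear (\<lambda>y. y - f (?g y))"
      using linear_compose[OF lg lin(3)] by (intro linear_compose_sub) (simp_all add: o_def linear_iff)
    have "d2 (hcomp gr2 n y) = 0" for n
      using degree_map_hcomp[OF gr(2,2) d(2), of n y] y by (simp add: linear_0[OF linear_hcomp[OF gr(2)]])
    then have "hcomp gr2 n y - f (?g (hcomp gr2 n y)) \<in> range d2" for n
      using hom hcomp_in[OF gr(2)] by blast
    then have "(\<Sum>n | hcomp gr2 n y \<noteq> 0. hcomp gr2 n y - f (?g (hcomp gr2 n y))) \<in> range d2"
      by (intro subspace_sum linear_subspace_image[OF lin(2)] subspace_UNIV) auto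
    then have "(\<Sum>n | hcomp gr2 n y \<noteq> 0. hcomp gr2 n y) - f (?g (\<Sum>n | hcomp gr2 n y \<noteq> 0. hcomp gr2 n y)) \<in> range d2"
      unfolding linear_sum[OF lfg, of "\<lambda>n. hcomp gr2 n y"] .
    then show ?thesis by (simp only: sum_hcomp[OF gr(2)])
  qed
  ultimately show ?thesis using deg by blast
qed

text \<open>The last three identities go beyond a homotopy inverse. They make \<open>g f\<close> and
  \<open>f g\<close> idempotents whose images have zero differential and which kill exact elements,
  so that letters split into a harmonic and an acyclic part compatibly with the
  differential.\<close>

lemma quasi_iso_homotopy_inverse:
  assumes gr: "graded_space gr1" "graded_space gr2" and d: "degree_map gr1 gr1 1 d1" "degree_map gr2 gr2 1 d2"
    and f: "degree_map gr1 gr2 0 f"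
    and dd: "\<And>x. d1 (d1 x) = 0" "\<And>y. d2 (d2 y) = 0" and chain: "\<And>x. f (d1 x) = d2 (f x)"
    and inj: "\<And>x. d1 x = 0 \<Longrightarrow> f x \<in> range d2 \<Longrightarrow> x \<in> range d1"
    and surj: "\<And>y. d2 y = 0 \<Longrightarrow> \<exists>x w. d1 x = 0 \<and> y = f x + d2 w"
  shows "\<exists>h1 h2 g. degree_map gr1 gr1 (-1) h1 \<and> degree_map gr2 gr2 (-1) h2 \<and> degree_map gr2 gr1 0 g \<and>
    (\<forall>x. d1 (h1 x) + h1 (d1 x) = x - g (f x)) \<and> (\<forall>y. d2 (h2 y) + h2 (d2 y) = y - f (g y)) \<and>
    (\<forall>y. g (f (g y)) = g y) \<and> (\<forall>y. d1 (g y) = 0) \<and> (\<forall>y. g (d2 y) = 0)"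
proof -
  obtain s1 where s1: "degree_map gr1 gr1 (-1) s1" "\<And>x. d1 (s1 (d1 x)) = d1 x"
    using homogeneous_generalized_inverse[OF gr(1) d(1)] by blast
  obtain s2 where s2: "degree_map gr2 gr2 (-1) s2" "\<And>y. d2 (s2 (d2 y)) = d2 y"
    using homogeneous_generalized_inverse[OF gr(2) d(2)] by blast
  obtain \<gamma> where \<gamma>: "degree_map gr2 gr1 0 \<gamma>" "\<And>y. d1 (\<gamma> y) = 0" "\<And>y. d2 y = 0 \<Longrightarrow> y - f (\<gamma> y) \<in> range d2"
    using homogeneous_section[OF gr d f surj] by blast
  note lin = degree_map_linear[OF d(1)] degree_map_linear[OF d(2)] degree_map_linear[OF f]
    degree_map_linear[OF s1(1)] degree_map_linear[OF s2(1)] degree_map_linear[OF \<gamma>(1)]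
  note [simp] = dd s1(2) s2(2) \<gamma>(2) chain
  note L = lin[THEN linear_diff] lin[THEN linear_add]
  note Z = lin[THEN linear_0]
  have range2: "y \<in> range d2 \<Longrightarrow> z \<in> range d2 \<Longrightarrow> y - z \<in> range d2" for y z
    by (rule subspace_diff[OF linear_subspace_image[OF lin(2) subspace_UNIV]])
  \<comment> \<open>A projection onto the cocycles of the second complex.\<close>
  define k2 where "k2 = (\<lambda>y. y - s2 (d2 y))"
  have k2_deg: "degree_map gr2 gr2 0 k2"
    unfolding k2_def using degree_map_compose[OF d(2) s2(1)] by (intro degree_map_diff[OF gr(2)] degree_map_id) simp
  have k2: "d2 (k2 y) = 0" for y by (simp add: k2_def L)
  have k2_id: "k2 y = y" if "d2 y = 0" for y using that by (simp add: k2_def Z)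
  \<comment> \<open>\<open>d1 s1\<close> projects onto the exact elements. Subtracting it replaces
    each representative by one in a fixed complement of these; a cocycle whose class is zero is
    therefore sent to 0.\<close>
  define g where "g = (\<lambda>y. \<gamma> (k2 y) - d1 (s1 (\<gamma> (k2 y))))"
  have \<gamma>k2: "degree_map gr2 gr1 0 (\<lambda>y. \<gamma> (k2 y))" using degree_map_compose[OF k2_deg \<gamma>(1)] by simp
  have g_deg: "degree_map gr2 gr1 0 g"
    unfolding g_def using degree_map_compose[OF degree_map_compose[OF \<gamma>k2 s1(1)] d(1)]
    by (intro degree_map_diff[OF gr(1)] \<gamma>k2) simp
  note lg = degree_map_linear[OF g_deg]
  have d1g: "d1 (g y) = 0" for y by (simp add: g_def L)
  have gd2: "g (d2 y) = 0" for y
  proof -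
    have "d2 y - f (\<gamma> (d2 y)) \<in> range d2" by (rule \<gamma>(3)) simp
    then have "d2 y - (d2 y - f (\<gamma> (d2 y))) \<in> range d2" by (rule range2[OF rangeI])
    then have "f (\<gamma> (d2 y)) \<in> range d2" by simp
    then obtain v where "\<gamma> (d2 y) = d1 v" using inj[of "\<gamma> (d2 y)"] by auto
    then show ?thesis by (simp add: g_def k2_id)
  qed
  have gk2: "g (k2 y) = g y" for y by (simp add: g_def k2_id[OF k2])
  define R where "R = (\<lambda>y. y - f (g y))"
  have R_deg: "degree_map gr2 gr2 0 R"
    unfolding R_def using degree_map_compose[OF g_deg f] by (intro degree_map_diff[OF gr(2)] degree_map_id) simp
  have R_exact: "R y \<in> range d2" if y: "d2 y = 0" for y
  proof -
    have "R y = (y - f (\<gamma> y)) + d2 (f (s1 (\<gamma> y)))" by (simp add: R_def g_def k2_id[OF y] L)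
    then show ?thesis
      using subspace_add[OF linear_subspace_image[OF lin(2) subspace_UNIV] \<gamma>(3)[OF y]] by simp
  qed
  \<comment> \<open>On a cocycle \<open>R\<close> has exact values, and \<open>s2\<close> picks a
    primitive of such a value.\<close>
  define h2 where "h2 = (\<lambda>y. s2 (R (k2 y)))"
  have h2_deg: "degree_map gr2 gr2 (-1) h2"
    unfolding h2_def using degree_map_compose[OF degree_map_compose[OF k2_deg R_deg] s2(1)] by simp
  have h2: "d2 (h2 y) + h2 (d2 y) = y - f (g y)" for y
  proof -
    obtain w where "R (k2 y) = d2 w" using R_exact[OF k2] by blast
    then have "d2 (h2 y) = R (k2 y)" by (simp add: h2_def)
    moreover have "h2 (d2 y) = s2 (d2 y)" by (simp add: h2_def k2_id R_def gd2 Z)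
    ultimately show ?thesis by (simp add: R_def gk2) (simp add: k2_def)
  qed
  have gs2: "g (s2 (d2 y)) = 0" for y
  proof -
    have "k2 (s2 (d2 y)) = 0" by (simp add: k2_def L)
    then show ?thesis by (simp add: g_def Z)
  qed
  have gfg: "g (f (g y)) = g y" for y
  proof -
    have "f (g y) = y - (d2 (h2 y) + h2 (d2 y))" by (simp add: h2)
    moreover have "h2 (d2 y) = s2 (d2 y)" by (simp add: h2_def k2_id R_def gd2 Z)
    ultimately show ?thesis by (simp add: linear_diff[OF lg] linear_add[OF lg] gd2 gs2)
  qed
  \<comment> \<open>The correction leaves \<open>d1 (s1 u)\<close> unchanged and makes the values of
    \<open>\<sigma>\<close> invisible to \<open>g f\<close>. Hence the projection \<open>k1\<close>
    built from it satisfies \<open>g (f (k1 x)) = g (f x)\<close>, and the homotopy identity extends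
    from cocycles to all \<open>x\<close> with the same \<open>g\<close>.\<close>
  define \<sigma> where "\<sigma> = (\<lambda>u. s1 u - g (f (s1 u)))"
  have \<sigma>_deg: "degree_map gr1 gr1 (-1) \<sigma>"
    unfolding \<sigma>_def using degree_map_compose[OF degree_map_compose[OF s1(1) f] g_deg]
    by (intro degree_map_diff[OF gr(1)] s1(1)) simp
  have d\<sigma>: "d1 (\<sigma> u) = d1 (s1 u)" for u by (simp add: \<sigma>_def L d1g)
  have gf\<sigma>: "g (f (\<sigma> u)) = 0" for u by (simp add: \<sigma>_def L linear_diff[OF lg] gfg)
  define k1 where "k1 = (\<lambda>x. x - \<sigma> (d1 x))"
  have k1_deg: "degree_map gr1 gr1 0 k1"
    unfolding k1_def using degree_map_compose[OF d(1) \<sigma>_deg] by (intro degree_map_diff[OF gr(1)] degree_map_id) simp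
  have k1: "d1 (k1 x) = 0" for x by (simp add: k1_def L d\<sigma>)
  have k1_id: "k1 x = x" if "d1 x = 0" for x using that by (simp add: k1_def linear_0[OF degree_map_linear[OF \<sigma>_deg]])
  define R1 where "R1 = (\<lambda>x. x - g (f x))"
  have R1_deg: "degree_map gr1 gr1 0 R1"
    unfolding R1_def using degree_map_compose[OF f g_deg] by (intro degree_map_diff[OF gr(1)] degree_map_id) simp
  have R1_exact: "R1 x \<in> range d1" if x: "d1 x = 0" for x
  proof (rule inj)
    show "d1 (R1 x) = 0" by (simp add: R1_def L x d1g)
    have "d2 (f x) = 0" using x by (simp add: chain[symmetric] Z)
    then show "f (R1 x) \<in> range d2" using R_exact[of "f x"] by (simp add: R1_def R_def L)
  qed
  define h1 where "h1 = (\<lambda>x. \<sigma> (R1 (k1 x)))"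
  have h1_deg: "degree_map gr1 gr1 (-1) h1"
    unfolding h1_def using degree_map_compose[OF degree_map_compose[OF k1_deg R1_deg] \<sigma>_deg] by simp
  have h1: "d1 (h1 x) + h1 (d1 x) = x - g (f x)" for x
  proof -
    obtain w where "R1 (k1 x) = d1 w" using R1_exact[OF k1] by blast
    then have "d1 (h1 x) = R1 (k1 x)" by (simp add: h1_def d\<sigma>)
    moreover have "h1 (d1 x) = \<sigma> (d1 x)" by (simp add: h1_def k1_id R1_def gd2)
    moreover have "g (f (k1 x)) = g (f x)" by (simp add: k1_def L linear_diff[OF lg] gf\<sigma>)
    ultimately show ?thesis by (simp add: R1_def) (simp add: k1_def)
  qed
  show ?thesis using h1_deg h2_deg g_deg h1 h2 gfg d1g gd2 by blast
qed

section \<open>Derivations and functoriality on tensors\<close>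

definition tensor_functor :: "('a::real_vector \<Rightarrow> 'b::real_vector) \<Rightarrow> 'a tensor \<Rightarrow> 'b tensor" where
  "tensor_functor A = tensor_lift (\<lambda>xs. tword (map A xs))"

lemma linear_tensor_functor: "linear A \<Longrightarrow> linear (tensor_functor A)"
  unfolding tensor_functor_def by (intro linear_tensor_lift multilinear_words_map multilinear_words_tword)

lemma tensor_functor_tword: "linear A \<Longrightarrow> tensor_functor A (tword xs) = tword (map A xs)"
  unfolding tensor_functor_def by (intro tensor_lift_tword multilinear_words_map multilinear_words_tword)

lemma tensor_functor_compose:
  assumes "linear A" "linear B"
  shows "tensor_functor B (tensor_functor A t) = tensor_functor (\<lambda>x. B (A x)) t"
proof (rule linear_eq_on_words[of "\<lambda>t. tensor_functor B (tensor_functor A t)"])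
  have BA: "linear (\<lambda>x. B (A x))" using linear_compose[OF assms] by (simp add: o_def)
  show "linear (\<lambda>t. tensor_functor B (tensor_functor A t))"
    using linear_compose[OF linear_tensor_functor[OF assms(1)] linear_tensor_functor[OF assms(2)]] by (simp add: o_def)
  show "linear (tensor_functor (\<lambda>x. B (A x)))" by (rule linear_tensor_functor[OF BA])
  show "tensor_functor B (tensor_functor A (tword xs)) = tensor_functor (\<lambda>x. B (A x)) (tword xs)" for xs
    by (simp add: tensor_functor_tword assms BA o_def)
qed

lemma tensor_functor_length:
  assumes "linear A" "t \<in> tensor_length n"
  shows "tensor_functor A t \<in> tensor_length n"
proof -
  have "t \<in> {t. tensor_functor A t \<in> tensor_length n}"
    by (rule tensor_length_in_words[OF _ _ assms(2)])
      (use linear_subspace_vimage[OF linear_tensor_functor[OF assms(1)] subspace_tensor_length]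
        tword_tensor_length[of "map A _"] in \<open>auto simp: vimage_def tensor_functor_tword assms(1)\<close>)
  then show ?thesis by simp
qed

lemma tensor_functor_below:
  fixes gr :: "int \<Rightarrow> 'a::real_vector set" and A :: "'a \<Rightarrow> 'b::real_vector"
  assumes "graded_space gr" "linear A" "t \<in> tensor_below n"
  shows "tensor_functor A t \<in> tensor_below n"
  by (rule linear_maps_tensor_below[OF assms(1) linear_tensor_functor[OF assms(2)] subspace_tensor_below assms(3)])
    (simp add: tensor_functor_tword assms(2) tword_tensor_below)

lemma hom_word_map: "degree_map gr1 gr2 0 A \<Longrightarrow> hom_word gr1 ns xs \<Longrightarrow> hom_word gr2 ns (map A xs)"
  unfolding list_all2_map2 by (erule list_all2_mono) (use degree_mapD in fastforce)

lemma tensor_functor_degree: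
  assumes "degree_map gr1 gr2 0 A" "t \<in> tensor_degree gr1 n"
  shows "tensor_functor A t \<in> tensor_degree gr2 n"
  by (rule linear_maps_tensor_degree[OF linear_tensor_functor[OF degree_map_linear[OF assms(1)]] subspace_tensor_degree assms(2)])
    (auto simp: tensor_functor_tword degree_map_linear[OF assms(1)] intro: tword_tensor_degree hom_word_map[OF assms(1)])

lemma tensor_functor_tswap:
  assumes gr: "graded_space gr1" "graded_space gr2" and A: "degree_map gr1 gr2 0 A"
  shows "tensor_functor A (tswap gr1 j t) = tswap gr2 j (tensor_functor A t)"
proof -
  note lA = degree_map_linear[OF A]
  note lT = linear_tensor_functor[OF lA]
  show ?thesis
  proof (rule linear_eq_on_hom_words[OF gr(1) linear_compose[OF linear_tswap[OF gr(1)] lT, unfolded o_def]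
      linear_compose[OF lT linear_tswap[OF gr(2)], unfolded o_def]])
    fix ns xs assume h: "hom_word gr1 ns xs"
    show "tensor_functor A (tswap gr1 j (tword xs)) = tswap gr2 j (tensor_functor A (tword xs))"
    proof (cases "Suc j < length xs")
      case False
      then show ?thesis
        using tswap_short[OF gr(1) h] tswap_short[OF gr(2) hom_word_map[OF A h]] by (simp add: tensor_functor_tword lA)
    next
      case True
      obtain us u k a ws w where 1: "ns = us @ k # ws" "xs = u @ a # w" "length u = j"
        "hom_word gr1 us u" "a \<in> gr1 k" "hom_word gr1 ws w"
        by (rule hom_word_split_nth[OF h, of j]) ((use True in auto)[1], (rule that; assumption))
      then obtain b z l zs where 2: "w = b # z" "ws = l # zs" "b \<in> gr1 l" "hom_word gr1 zs z"
        using True by (cases w) (auto simp: list_all2_Cons2)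
      have "A a \<in> gr2 k" "A b \<in> gr2 l" using degree_mapD[OF A 1(5)] degree_mapD[OF A 2(3)] by simp_all
      from tswap_tword[OF gr(2) hom_word_map[OF A 1(4)] this hom_word_map[OF A 2(4)]]
        tswap_tword[OF gr(1) 1(4,5) 2(3,4)] 1(3)
      show ?thesis by (simp add: 1 2 tensor_functor_tword lA linear_scale[OF lT])
    qed
  qed
qed

context
  fixes gr :: "int \<Rightarrow> 'a::real_vector set" and \<delta> :: "'a \<Rightarrow> 'a" and c :: int
  assumes gr: "graded_space gr" and \<delta>: "degree_map gr gr c \<delta>" and c: "odd c"
begin

private lemma l\<delta>: "linear \<delta>" using \<delta> by (rule degree_map_linear)

private lemma lder: "linear (tensor_derivation gr \<delta>)" by (rule linear_tensor_derivation[OF gr l\<delta>])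

lemma derivation_word_degree:
  "hom_word gr ns xs \<Longrightarrow> derivation_word gr \<delta> xs \<in> tensor_degree gr (sdeg ns + c)"
proof (induction ns xs rule: list_all2_induct)
  case Nil
  then show ?case by (simp add: subspace_0[OF subspace_tensor_degree])
next
  case (Cons n ns x xs)
  have "hom_word gr ((n + c) # ns) (\<delta> x # xs)" using Cons degree_mapD[OF \<delta>] by simp
  then have "tword (\<delta> x # xs) \<in> tensor_degree gr (sdeg (n # ns) + c)" by (rule tword_tensor_degree) simp
  moreover have "tensor_cons (koszul_parity gr x) (derivation_word gr \<delta> xs) \<in> tensor_degree gr (n - 1 + (sdeg ns + c))"
    using Cons by (intro tensor_cons_degree)
      (simp_all add: koszul_parity_homogeneous[OF gr] subspace_scale[OF graded_subspace[OF gr]])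
  ultimately show ?case using subspace_add[OF subspace_tensor_degree] by (simp add: add.assoc)
qed

lemma derivation_word_length: "derivation_word gr \<delta> xs \<in> tensor_length (length xs)"
proof (induction xs)
  case Nil
  then show ?case by (simp add: subspace_0[OF subspace_tensor_length])
next
  case (Cons x xs)
  then show ?case
    using tword_tensor_length[of "\<delta> x # xs"] tensor_cons_length[OF Cons.IH]
    by (simp add: subspace_add[OF subspace_tensor_length])
qed

lemma koszul_parity_anticommute: "koszul_parity gr (\<delta> x) = - \<delta> (koszul_parity gr x)"
proof (rule linear_eq_on_homogeneous[OF gr
      linear_compose[OF l\<delta> linear_koszul_parity[OF gr], unfolded o_def]
      linear_compose_neg[OF linear_compose[OF linear_koszul_parity[OF gr] l\<delta>], unfolded o_def]])
  fix n x assume x: "x \<in> gr n"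
  then show "koszul_parity gr (\<delta> x) = - \<delta> (koszul_parity gr x)"
    using c by (simp add: koszul_parity_homogeneous[OF gr x] koszul_parity_homogeneous[OF gr degree_mapD[OF \<delta> x]]
        linear_scale[OF l\<delta>] neg_one_powi linear_neg[OF l\<delta>])
qed

text \<open>Splitting off first letters reduces to the swap of the first two. There, replacing a
  letter \<open>x\<close> by \<open>\<delta> x\<close> changes its parity, which changes the swap
  sign exactly as the Koszul sign of the derivation requires.\<close>

lemma tensor_derivation_tswap:
  "tensor_derivation gr \<delta> (tswap gr j t) = tswap gr j (tensor_derivation gr \<delta> t)"
proof -
  note lS = linear_tswap[OF gr]
  note dc = tensor_derivation_cons[OF gr l\<delta>]
  have lin: "linear (\<lambda>t. tensor_derivation gr \<delta> (tswap gr j t))" "linear (\<lambda>t. tswap gr j (tensor_derivation gr \<delta> t))" for j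
    using linear_compose[OF lS lder] linear_compose[OF lder lS] by (simp_all add: o_def)
  have word: "tensor_derivation gr \<delta> (tswap gr j (tword xs)) = tswap gr j (tensor_derivation gr \<delta> (tword xs))"
    if "hom_word gr ns xs" for j ns xs
    using that
  proof (induction j arbitrary: ns xs)
    case 0
    have short: ?case if len: "length xs \<le> 1"
    proof -
      have "tensor_derivation gr \<delta> (tword xs) \<in> tensor_length (length xs)"
        using derivation_word_length by (simp add: tensor_derivation_tword[OF gr l\<delta>])
      from tswap_tensor_length_short[OF gr this, of 0] tswap_short[OF gr 0, of 0] len show ?thesis by simp
    qed
    show ?case
    proof (cases "length xs \<le> 1")
      case False
      then obtain x y w where xs: "xs = x # y # w" by (cases xs rule: list.exhaust; cases "tl xs") auto
      then obtain n m ws where h: "x \<in> gr n" "y \<in> gr m" using 0 by (auto simp: list_all2_Cons2)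
      have \<delta>h: "\<delta> x \<in> gr (n + c)" "\<delta> y \<in> gr (m + c)" using degree_mapD[OF \<delta>] h by auto
      note sw = tswap_0_cons[OF gr]
      show ?thesis
        unfolding xs tensor_cons_tword[symmetric]
        using c by (simp add: dc linear_scale[OF lder] linear_add[OF lS] linear_scale[OF lS]
            sw[OF h] sw[OF h(2,1)] sw[OF \<delta>h(1) h(2)] sw[OF h(1) \<delta>h(2)]
            koszul_parity_homogeneous[OF gr h(1)] koszul_parity_homogeneous[OF gr h(2)]
            linear_scale[OF linear_tensor_cons_left] linear_add[OF linear_tensor_cons] linear_scale[OF linear_tensor_cons]
            neg_one_powi linear_neg[OF linear_tensor_cons] linear_neg[OF linear_tensor_cons_left] linear_neg[OF lS]
            linear_neg[OF lder] linear_diff[OF lS] linear_diff[OF linear_tensor_cons])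
    qed (rule short)
  next
    case (Suc j)
    note IH = linear_eq_on_hom_words[OF gr lin[of j] Suc.IH]
    show ?case
    proof (cases xs)
      case Nil
      then show ?thesis
        using tswap_short[OF gr Suc.prems, of "Suc j"] by (simp add: tensor_derivation_tword[OF gr l\<delta>] linear_0[OF lS])
    next
      case (Cons x ys)
      then show ?thesis
        by (simp add: tensor_cons_tword[symmetric] dc tswap_Suc_cons[OF gr] IH linear_add[OF lS])
    qed
  qed
  show ?thesis by (rule linear_eq_on_hom_words[OF gr lin word])
qed

end

section \<open>Contracting the non-harmonic tensors\<close>

text \<open>
  A projection \<open>p\<close> splits the letters into its image (weight 0) and its kernel (weight 1). On words of
  total weight \<open>r\<close> the graded commutator of the derivations induced by \<open>d\<close> and \<open>h\<close> is
  multiplication by \<open>r\<close>, so dividing by the weight gives a contraction that is automatically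
  equivariant under permutations; on weight 0 the convention \<open>1 / 0 = 0\<close> makes it vanish.
\<close>

lemma tensor_length_below: "m < n \<Longrightarrow> tensor_length m \<subseteq> tensor_below n"
  unfolding tensor_length_def tensor_below_def by (intro span_mono) auto

text \<open>Encoded as a grading concentrated in degrees 0 and 1, so that the extension from
  homogeneous words applies to weights just as it does to degrees.\<close>

definition weight_grading :: "('a::real_vector \<Rightarrow> 'a) \<Rightarrow> int \<Rightarrow> 'a set" where
  "weight_grading p n = (if n = 0 then {x. p x = x} else if n = 1 then {x. p x = 0} else {0})"

definition tensor_weight :: "('a::real_vector \<Rightarrow> 'a) \<Rightarrow> int \<Rightarrow> 'a tensor set" where
  "tensor_weight p r = span {tword xs |ls xs. hom_word (weight_grading p) ls xs \<and> sum_list ls = r}"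

definition weighted_homotopy :: "(int \<Rightarrow> 'a::real_vector set) \<Rightarrow> ('a \<Rightarrow> 'a) \<Rightarrow> ('a \<Rightarrow> 'a) \<Rightarrow> 'a tensor \<Rightarrow> 'a tensor" where
  "weighted_homotopy gr h p = hext (weight_grading p)
     (\<lambda>ls xs. (1 / real_of_int (sum_list ls)) *\<^sub>R derivation_word gr h xs)"

lemma graded_space_weight:
  assumes p: "linear p" "\<And>x. p (p x) = p x"
  shows "graded_space (weight_grading p)"
  unfolding graded_space_def
proof (intro conjI allI)
  fix n
  show "subspace (weight_grading p n)"
    by (auto simp: weight_grading_def subspace_def linear_0[OF p(1)] linear_add[OF p(1)] linear_scale[OF p(1)])
next
  fix x
  define u where "u = (\<lambda>n :: int. if n = 0 then p x else if n = 1 then x - p x else 0)"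
  have sub: "{n. u n \<noteq> 0} \<subseteq> {0, 1}" by (auto simp: u_def)
  have "(\<Sum>n | u n \<noteq> 0. u n) = (\<Sum>n\<in>{0, 1}. u n)" by (rule sum.mono_neutral_left) (use sub in auto)
  then have "x = (\<Sum>n | u n \<noteq> 0. u n)" by (simp add: u_def)
  then have u: "finite {n. u n \<noteq> 0} \<and> (\<forall>n. u n \<in> weight_grading p n) \<and> x = (\<Sum>n | u n \<noteq> 0. u n)"
    using finite_subset[OF sub] p by (auto simp: u_def weight_grading_def linear_diff[OF p(1)])
  show "\<exists>!u. finite {n. u n \<noteq> 0} \<and> (\<forall>n. u n \<in> weight_grading p n) \<and> x = (\<Sum>n | u n \<noteq> 0. u n)"
  proof (rule ex1I)
    show "finite {n. u n \<noteq> 0} \<and> (\<forall>n. u n \<in> weight_grading p n) \<and> x = (\<Sum>n | u n \<noteq> 0. u n)" by (rule u)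
  next
    fix v assume v: "finite {n. v n \<noteq> 0} \<and> (\<forall>n. v n \<in> weight_grading p n) \<and> x = (\<Sum>n | v n \<noteq> 0. v n)"
    have vn: "v n \<in> weight_grading p n" for n using v by blast
    have v0: "p (v 0) = v 0" and v1: "p (v 1) = 0" and vo: "n \<noteq> 0 \<Longrightarrow> n \<noteq> 1 \<Longrightarrow> v n = 0" for n
      using vn[of 0] vn[of 1] vn[of n] by (auto simp: weight_grading_def)
    have "(\<Sum>n | v n \<noteq> 0. v n) = (\<Sum>n\<in>{0, 1}. v n)"
      by (rule sum.mono_neutral_left) (use vo in auto)
    then have x: "x = v 0 + v 1" using v by simp
    then have "p x = v 0" by (simp add: linear_add[OF p(1)] v0 v1)
    then show "v = u" using x vo by (auto simp: u_def fun_eq_iff)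
  qed
qed

context
  fixes gr :: "int \<Rightarrow> 'a::real_vector set" and d h p :: "'a \<Rightarrow> 'a"
  assumes gr: "graded_space gr" and d: "degree_map gr gr 1 d" and h: "degree_map gr gr (-1) h"
    and p: "degree_map gr gr 0 p" and pp: "\<And>x. p (p x) = p x"
    and dh: "\<And>x. d (h x) + h (d x) = x - p x" and pd: "\<And>x. p (d x) = 0" and dp: "\<And>x. d (p x) = 0"
begin

private lemmas lin = degree_map_linear[OF d] degree_map_linear[OF h] degree_map_linear[OF p]

private lemma wgr: "graded_space (weight_grading p)"
  by (rule graded_space_weight[OF lin(3) pp])

private lemma odd_one: "odd (1::int)" "odd (-1::int)" by simp_all

private lemma mlh: "multilinear_words (\<lambda>xs. (1 / real_of_int (sum_list ls)) *\<^sub>R derivation_word gr h xs)"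
  by (rule multilinear_words_scale[OF multilinear_derivation_word[OF gr lin(2)]])

lemma linear_weighted_homotopy: "linear (weighted_homotopy gr h p)"
  unfolding weighted_homotopy_def by (rule linear_hext[OF wgr mlh])

lemma weighted_homotopy_tword:
  "hom_word (weight_grading p) ls xs \<Longrightarrow>
    weighted_homotopy gr h p (tword xs) = (1 / real_of_int (sum_list ls)) *\<^sub>R derivation_word gr h xs"
  unfolding weighted_homotopy_def by (rule hext_tword[OF wgr mlh])

lemma weighted_homotopy_weight:
  assumes "t \<in> tensor_weight p r"
  shows "weighted_homotopy gr h p t = (1 / real_of_int r) *\<^sub>R tensor_derivation gr h t"
proof (rule linear_eq_on_span[OF linear_weighted_homotopy _ _ assms[unfolded tensor_weight_def]])
  show "linear (\<lambda>t. (1 / real_of_int r) *\<^sub>R tensor_derivation gr h t)"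
    by (rule linear_compose_scale_right[OF linear_tensor_derivation[OF gr lin(2)]])
qed (auto simp: weighted_homotopy_tword tensor_derivation_tword[OF gr lin(2)])

lemma subspace_tensor_weight: "subspace (tensor_weight p r)"
  by (simp add: tensor_weight_def subspace_span)

lemma tword_tensor_weight: "hom_word (weight_grading p) ls xs \<Longrightarrow> sum_list ls = r \<Longrightarrow> tword xs \<in> tensor_weight p r"
  unfolding tensor_weight_def by (intro span_base) auto

lemma tensor_cons_weight:
  assumes "x \<in> weight_grading p l" "t \<in> tensor_weight p r"
  shows "tensor_cons x t \<in> tensor_weight p (l + r)"
proof -
  have "tensor_cons x ` {tword xs |ls xs. hom_word (weight_grading p) ls xs \<and> sum_list ls = r} \<subseteq> tensor_weight p (l + r)"
  proof clarify
    fix ls xs assume *: "hom_word (weight_grading p) ls xs" "r = sum_list ls"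
    show "tensor_cons x (tword xs) \<in> tensor_weight p (l + sum_list ls)"
      unfolding tensor_cons_tword by (rule tword_tensor_weight[of "l # ls"]) (use * assms(1) in auto)
  qed
  then have "tensor_cons x ` tensor_weight p r \<subseteq> tensor_weight p (l + r)"
    unfolding tensor_weight_def[of p r] linear_span_image[OF linear_tensor_cons, symmetric]
    by (intro span_minimal subspace_tensor_weight)
  then show ?thesis using assms(2) by blast
qed

lemma koszul_parity_involution: "koszul_parity gr (koszul_parity gr x) = x"
proof (rule linear_eq_on_homogeneous[OF gr linear_compose[OF linear_koszul_parity[OF gr] linear_koszul_parity[OF gr], unfolded o_def]
      linear_id[unfolded id_def]])
  fix n x assume x: "x \<in> gr n"
  then show "koszul_parity gr (koszul_parity gr x) = x"
    by (simp add: koszul_parity_homogeneous[OF gr x] linear_scale[OF linear_koszul_parity[OF gr]] neg_one_powi)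
qed

lemma koszul_parity_projection: "koszul_parity gr (p x) = p (koszul_parity gr x)"
proof (rule linear_eq_on_homogeneous[OF gr linear_compose[OF lin(3) linear_koszul_parity[OF gr], unfolded o_def]
      linear_compose[OF linear_koszul_parity[OF gr] lin(3), unfolded o_def]])
  fix n x assume x: "x \<in> gr n"
  have "p x \<in> gr n" using degree_mapD[OF p x] by simp
  then show "koszul_parity gr (p x) = p (koszul_parity gr x)"
    by (simp add: koszul_parity_homogeneous[OF gr x] koszul_parity_homogeneous[OF gr] linear_scale[OF lin(3)])
qed

lemma koszul_parity_weight: "x \<in> weight_grading p l \<Longrightarrow> koszul_parity gr x \<in> weight_grading p l"
  using koszul_parity_projection[of x] linear_0[OF linear_koszul_parity[OF gr]]
  by (auto simp: weight_grading_def split: if_splits)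

lemma differential_weight: "x \<in> weight_grading p l \<Longrightarrow> d x \<in> weight_grading p l"
  using dp[of x] pd linear_0[OF lin(1)] linear_0[OF lin(3)] by (auto simp: weight_grading_def split: if_splits)

lemma derivation_word_weight:
  "hom_word (weight_grading p) ls xs \<Longrightarrow> derivation_word gr d xs \<in> tensor_weight p (sum_list ls)"
proof (induction ls xs rule: list_all2_induct)
  case Nil
  then show ?case by (simp add: subspace_0[OF subspace_tensor_weight])
next
  case (Cons l ls x xs)
  have "tword (d x # xs) \<in> tensor_weight p (sum_list (l # ls))"
    by (rule tword_tensor_weight[of "l # ls"]) (use Cons differential_weight in auto)
  moreover have "tensor_cons (koszul_parity gr x) (derivation_word gr d xs) \<in> tensor_weight p (l + sum_list ls)"
    using Cons koszul_parity_weight by (intro tensor_cons_weight) auto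
  ultimately show ?case by (simp add: subspace_add[OF subspace_tensor_weight])
qed

text \<open>The graded commutator of two odd derivations is an even derivation: the mixed terms
  cancel because \<open>koszul_parity\<close> anticommutes with \<open>d\<close> and with
  \<open>h\<close>. On a letter it is \<open>d h + h d = 1 - p\<close>, that is, multiplication by
  the weight.\<close>

lemma derivation_commutator:
  assumes "hom_word (weight_grading p) ls xs"
  shows "tensor_derivation gr d (tensor_derivation gr h (tword xs)) + tensor_derivation gr h (tensor_derivation gr d (tword xs))
    = real_of_int (sum_list ls) *\<^sub>R tword xs"
  using assms
proof (induction ls xs rule: list_all2_induct)
  case Nil
  then show ?case
    by (simp add: tensor_derivation_tword[OF gr] lin linear_0[OF linear_tensor_derivation[OF gr lin(1)]]
        linear_0[OF linear_tensor_derivation[OF gr lin(2)]])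
next
  case (Cons l ls x xs)
  let ?D = "tensor_derivation gr d" and ?H = "tensor_derivation gr h" and ?t = "tword xs"
  note lD = linear_tensor_derivation[OF gr lin(1)] and lH = linear_tensor_derivation[OF gr lin(2)]
  note cD = tensor_derivation_cons[OF gr lin(1)] and cH = tensor_derivation_cons[OF gr lin(2)]
  note aD = koszul_parity_anticommute[OF gr d odd_one(1)] and aH = koszul_parity_anticommute[OF gr h odd_one(2)]
  have x: "d (h x) + h (d x) = real_of_int l *\<^sub>R x"
    using Cons.hyps(1) dh[of x] by (auto simp: weight_grading_def linear_0[OF lin(1)] linear_0[OF lin(2)] split: if_splits)
  have "?D (?H (tensor_cons x ?t)) + ?H (?D (tensor_cons x ?t)) =
      tensor_cons (d (h x) + h (d x)) ?t + tensor_cons x (?D (?H ?t) + ?H (?D ?t))"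
    by (simp add: cD cH aD aH koszul_parity_involution linear_add[OF lD] linear_add[OF lH]
        linear_add[OF linear_tensor_cons_left] linear_neg[OF linear_tensor_cons_left] linear_add[OF linear_tensor_cons])
  also have "\<dots> = real_of_int (sum_list (l # ls)) *\<^sub>R tensor_cons x ?t"
    unfolding x Cons.IH
    by (simp add: linear_scale[OF linear_tensor_cons_left] linear_scale[OF linear_tensor_cons] scaleR_add_left)
  finally show ?case by (simp add: tensor_cons_tword)
qed

lemma weighted_homotopy_contraction:
  "tensor_derivation gr d (weighted_homotopy gr h p t) + weighted_homotopy gr h p (tensor_derivation gr d t)
    = t - tensor_functor p t"
proof -
  note lD = linear_tensor_derivation[OF gr lin(1)] and lH = linear_weighted_homotopy
  have lin1: "linear (\<lambda>t. tensor_derivation gr d (weighted_homotopy gr h p t) + weighted_homotopy gr h p (tensor_derivation gr d t))"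
    using linear_compose_add[OF linear_compose[OF lH lD] linear_compose[OF lD lH]] by (simp add: o_def)
  have lin2: "linear (\<lambda>t. t - tensor_functor p t)"
    by (intro linear_compose_sub linear_tensor_functor lin) (simp add: linear_iff)
  show ?thesis
  proof (rule linear_eq_on_hom_words[OF wgr lin1 lin2])
    fix ls xs assume xs: "hom_word (weight_grading p) ls xs"
    let ?r = "real_of_int (sum_list ls)"
    have "tensor_derivation gr d (weighted_homotopy gr h p (tword xs)) + weighted_homotopy gr h p (tensor_derivation gr d (tword xs))
      = (1 / ?r) *\<^sub>R (tensor_derivation gr d (tensor_derivation gr h (tword xs)) + tensor_derivation gr h (tensor_derivation gr d (tword xs)))"
      using weighted_homotopy_weight[OF tword_tensor_weight[OF xs refl]]
        weighted_homotopy_weight[OF derivation_word_weight[OF xs]]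
      by (simp add: tensor_derivation_tword[OF gr lin(1)] linear_scale[OF lD] scaleR_add_right)
    also have "\<dots> = (if sum_list ls = 0 then 0 else tword xs)"
      unfolding derivation_commutator[OF xs] by simp
    \<comment> \<open>A letter 0 may carry any weight, but then both words vanish. Without such
      letters all weights are 0 or 1: total weight 0 means that \<open>p\<close> fixes every letter,
      and otherwise \<open>p\<close> kills some letter.\<close>
    also have "\<dots> = tword xs - tword (map p xs)"
    proof (cases "0 \<in> set xs")
      case True
      then have "0 \<in> set (map p xs)" using linear_0[OF lin(3)] by (metis image_eqI set_map)
      then show ?thesis using True by (simp add: multilinear_words_zero[OF multilinear_words_tword])
    next
      case False
      have "0 \<le> sum_list ls \<and> (if sum_list ls = 0 then map p xs = xs else 0 \<in> set (map p xs))"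
        using xs False by (induction ls xs rule: list_all2_induct) (auto simp: weight_grading_def split: if_splits)
      then show ?thesis by (auto simp: multilinear_words_zero[OF multilinear_words_tword] split: if_splits)
    qed
    finally show "tensor_derivation gr d (weighted_homotopy gr h p (tword xs)) +
        weighted_homotopy gr h p (tensor_derivation gr d (tword xs)) = tword xs - tensor_functor p (tword xs)"
      by (simp add: tensor_functor_tword lin)
  qed
qed

lemma weighted_homotopy_length:
  assumes "t \<in> tensor_length n"
  shows "weighted_homotopy gr h p t \<in> tensor_length n"
  by (rule linear_maps_tensor_length[OF wgr linear_weighted_homotopy subspace_tensor_length assms])
    (auto simp: weighted_homotopy_tword intro!: subspace_scale[OF subspace_tensor_length] derivation_word_length[OF gr h])

lemma weighted_homotopy_below:
  assumes "t \<in> tensor_below n"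
  shows "weighted_homotopy gr h p t \<in> tensor_below n"
  by (rule linear_maps_tensor_below[OF wgr linear_weighted_homotopy subspace_tensor_below assms])
    (use weighted_homotopy_length[OF tword_tensor_length] tensor_length_below in blast)

text \<open>As \<open>p\<close> has degree 0, every homogeneous letter splits into two homogeneous
  letters of weights 0 and 1. Statements mixing degree signs with weights can thus be checked on
  letters homogeneous for both.\<close>

lemma mixed_span_degree:
  assumes "hom_word gr ns xs"
  shows "tword xs \<in> span {tword ys |ls ys. hom_word gr ns ys \<and> hom_word (weight_grading p) ls ys}"
proof -
  have "list_all2 (\<lambda>A x. x \<in> span A) (map (\<lambda>n. gr n \<inter> (\<Union>l. weight_grading p l)) ns) xs"
    unfolding list_all2_map1 using assms
  proof (rule list_all2_mono)
    fix n x assume x: "x \<in> gr n"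
    have "p x \<in> gr n" using degree_mapD[OF p x] by simp
    then have "p x \<in> gr n \<inter> weight_grading p 0" "x - p x \<in> gr n \<inter> weight_grading p 1"
      using x pp by (auto simp: weight_grading_def linear_diff[OF lin(3)] intro: subspace_diff[OF graded_subspace[OF gr]])
    then have "p x + (x - p x) \<in> span (gr n \<inter> (\<Union>l. weight_grading p l))"
      by (intro span_add span_base) blast+
    then show "x \<in> span (gr n \<inter> (\<Union>l. weight_grading p l))" by simp
  qed
  from tword_in_span_letters[OF this, of "[]"]
  have "tword xs \<in> span {tword ys |ys. list_all2 (\<lambda>A y. y \<in> A) (map (\<lambda>n. gr n \<inter> (\<Union>l. weight_grading p l)) ns) ys}"
    by simp
  also have "\<dots> \<subseteq> span {tword ys |ls ys. hom_word gr ns ys \<and> hom_word (weight_grading p) ls ys}"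
  proof (rule span_mono, clarify)
    fix ys assume "list_all2 (\<lambda>A y. y \<in> A) (map (\<lambda>n. gr n \<inter> (\<Union>l. weight_grading p l)) ns) ys"
    then have *: "list_all2 (\<lambda>n y. y \<in> gr n \<inter> (\<Union>l. weight_grading p l)) ns ys" by (simp add: list_all2_map1)
    then have "\<forall>y\<in>set ys. \<exists>l. y \<in> weight_grading p l" by (auto simp: list_all2_conv_all_nth in_set_conv_nth)
    then obtain l where "\<forall>y\<in>set ys. y \<in> weight_grading p (l y)" by metis
    then have "hom_word (weight_grading p) (map l ys) ys" by (auto simp: list_all2_conv_all_nth)
    moreover have "hom_word gr ns ys" using * by (rule list_all2_mono) simp
    ultimately show "\<exists>ls zs. tword ys = tword zs \<and> hom_word gr ns zs \<and> hom_word (weight_grading p) ls zs" by blast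
  qed
  finally show ?thesis .
qed

lemma weighted_homotopy_degree:
  assumes "t \<in> tensor_degree gr n"
  shows "weighted_homotopy gr h p t \<in> tensor_degree gr (n - 1)"
proof (rule linear_maps_tensor_degree[OF linear_weighted_homotopy subspace_tensor_degree assms])
  fix ns xs assume xs: "hom_word gr ns xs" "sdeg ns = n"
  have "weighted_homotopy gr h p ` span {tword ys |ls ys. hom_word gr ns ys \<and> hom_word (weight_grading p) ls ys}
      \<subseteq> tensor_degree gr (n - 1)"
    unfolding linear_span_image[OF linear_weighted_homotopy, symmetric]
  proof (rule span_minimal[OF _ subspace_tensor_degree], clarify)
    fix ls ys assume ys: "hom_word gr ns ys" "hom_word (weight_grading p) ls ys"
    show "weighted_homotopy gr h p (tword ys) \<in> tensor_degree gr (n - 1)"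
      using derivation_word_degree[OF gr h odd_one(2) ys(1)] xs(2)
      by (simp add: weighted_homotopy_tword[OF ys(2)] subspace_scale[OF subspace_tensor_degree])
  qed
  then show "weighted_homotopy gr h p (tword xs) \<in> tensor_degree gr (n - 1)"
    using mixed_span_degree[OF xs(1)] by blast
qed

text \<open>A swap commutes with the derivation and preserves the total weight, hence it commutes
  with the quotient of one by the other.\<close>

lemma weighted_homotopy_tswap: "weighted_homotopy gr h p (tswap gr j t) = tswap gr j (weighted_homotopy gr h p t)"
proof -
  note lS = linear_tswap[OF gr] and lH = linear_weighted_homotopy
  note linl = linear_compose[OF lS lH, unfolded o_def] and linr = linear_compose[OF lH lS, unfolded o_def]
  have mixed: "weighted_homotopy gr h p (tswap gr j (tword ys)) = tswap gr j (weighted_homotopy gr h p (tword ys))"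
    if ys: "hom_word gr ns ys" "hom_word (weight_grading p) ls ys" for ns ls ys
  proof -
    have "tswap gr j (tword ys) \<in> tensor_weight p (sum_list ls)"
    proof (cases "Suc j < length ys")
      case False
      then show ?thesis using tswap_short[OF gr ys(1), of j] tword_tensor_weight[OF ys(2) refl] by simp
    next
      case True
      obtain us u k a ws w where 1: "ns = us @ k # ws" "ys = u @ a # w" "length u = j"
        "hom_word gr us u" "a \<in> gr k" "hom_word gr ws w"
        by (rule hom_word_split_nth[OF ys(1), of j]) ((use True in auto)[1], (rule that; assumption))
      then obtain b z m zs where 2: "w = b # z" "ws = m # zs" "b \<in> gr m" "hom_word gr zs z"
        using True by (cases w) (auto simp: list_all2_Cons2)
      obtain l1 la lb l2 where 3: "ls = l1 @ la # lb # l2" "hom_word (weight_grading p) l1 u"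
        "a \<in> weight_grading p la" "b \<in> weight_grading p lb" "hom_word (weight_grading p) l2 z"
        using ys(2) unfolding 1(2) 2(1) by (auto simp: list_all2_append2 list_all2_Cons2)
      have "hom_word (weight_grading p) (l1 @ lb # la # l2) (u @ b # a # z)"
        using 3 by (auto intro!: hom_word_append)
      then have "tword (u @ b # a # z) \<in> tensor_weight p (sum_list ls)"
        by (rule tword_tensor_weight) (simp add: 3)
      then show ?thesis
        using tswap_tword[OF gr 1(4,5) 2(3,4)] 1(3) by (simp add: 1(2) 2(1) subspace_scale[OF subspace_tensor_weight])
    qed
    then show ?thesis
      using weighted_homotopy_weight weighted_homotopy_weight[OF tword_tensor_weight[OF ys(2) refl]]
      by (simp add: tensor_derivation_tswap[OF gr h odd_one(2)] linear_scale[OF lS])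
  qed
  show ?thesis
  proof (rule linear_eq_on_hom_words[OF gr linl linr])
    fix ns xs assume "hom_word gr ns xs"
    from linear_eq_on_span[OF linl linr _ mixed_span_degree[OF this]] mixed
    show "weighted_homotopy gr h p (tswap gr j (tword xs)) = tswap gr j (weighted_homotopy gr h p (tword xs))" by blast
  qed
qed

end

lemma commute_preserves_sym:
  assumes "\<And>j t. A (tswap gr1 j t) = tswap gr2 j (A t)" "t \<in> sym_tensors gr1"
  shows "A t \<in> sym_tensors gr2"
  using assms by (simp add: sym_tensors_def) metis

lemma commute_preserves_cyc:
  assumes "graded_space gr1" "graded_space gr2" "linear A"
    "\<And>n t. t \<in> tensor_length n \<Longrightarrow> A t \<in> tensor_length n"
    "\<And>j t. A (tswap gr1 j t) = tswap gr2 j (A t)" "t \<in> cyc_tensors gr1"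
  shows "A t \<in> cyc_tensors gr2"
  using tensor_permute_commute[OF assms(1-5) cyclic_generator_permutes, of t] assms(6)
  by (simp add: cyc_tensors_def trotate_def)

section \<open>Energy gaps and the linear part\<close>

text \<open>Discreteness isolates 0 among the energies of \<open>G\<close>, which gives the gap; at
  energy 0 itself \<open>(0, 0)\<close> is the only element of \<open>G\<close>, which excludes
  nonzero powers of \<open>e\<close>.\<close>

lemma gapped_low_constant:
  assumes "gapped f"
  shows "\<exists>e>0. \<forall>xs. low_constant e (f (map nov_const xs))"
proof -
  obtain G fb where G: "gapping_monoid G"
    "\<And>xs s q. ncoeff (f (map nov_const xs)) s q = (if (s, 2 * q) \<in> G then fb (s, 2 * q) xs else 0)"
    using assms unfolding gapped_def by blast
  have G': "0 \<in> G" "discrete (fst ` G)" "G \<inter> {0} \<times> UNIV = {(0, 0)}" "\<And>s \<mu>. (s, \<mu>) \<in> G \<Longrightarrow> 0 \<le> s"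
    using G(1) unfolding gapping_monoid_def by auto
  have "0 \<in> fst ` G" using G'(1) by (force intro: image_eqI[of _ _ 0])
  then have "0 isolated_in (fst ` G)" using G'(2) by (rule discreteD[rotated])
  then obtain T where T: "open T" "T \<inter> fst ` G = {0}" by (auto simp: isolated_in_def)
  then have "0 \<in> T" by blast
  then obtain e where e: "e > 0" "ball 0 e \<subseteq> T" using T(1) open_contains_ball by blast
  have "low_constant e (f (map nov_const xs))" for xs
    unfolding low_constant_def
  proof (intro allI impI)
    fix s and q :: int assume s: "s < e" "(s, q) \<noteq> (0, 0)"
    have "(s, 2 * q) \<notin> G"
    proof
      assume sG: "(s, 2 * q) \<in> G"
      then have "s \<in> ball 0 e" using G'(4)[OF sG] s(1) by simp
      then have "s \<in> T \<inter> fst ` G" using e(2) sG by force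
      then have "s = 0" using T(2) by blast
      then have "(s, 2 * q) \<in> G \<inter> {0} \<times> UNIV" using sG by simp
      then show False using G'(3) s(2) by auto
    qed
    then show "ncoeff (f (map nov_const xs)) s q = 0" by (simp add: G(2))
  qed
  then show ?thesis using e(1) by blast
qed

lemma low_constant_mono: "low_constant e a \<Longrightarrow> e' \<le> e \<Longrightarrow> low_constant e' a"
  by (auto simp: low_constant_def)

section \<open>Recovering the identities of the linear parts\<close>

definition single_letter :: "'a::real_vector tensor \<Rightarrow> 'a" where
  "single_letter = tensor_lift (\<lambda>xs. if length xs = 1 then hd xs else 0)"

lemma multilinear_single_letter: "multilinear_words (\<lambda>xs. if length xs = 1 then hd xs else 0)"
  by (auto simp: multilinear_words_def)

lemma linear_single_letter: "linear single_letter"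
  unfolding single_letter_def by (rule linear_tensor_lift[OF multilinear_single_letter])

lemma single_letter_tword: "single_letter (tword xs) = (if length xs = 1 then hd xs else 0)"
  unfolding single_letter_def by (rule tensor_lift_tword[OF multilinear_single_letter])

lemma single_letter_below: "t \<in> tensor_below 1 \<Longrightarrow> single_letter t = 0"
  unfolding tensor_below_def by (rule linear_eq_0_on_span[OF linear_single_letter]) (auto simp: single_letter_tword)

text \<open>On a one-letter word the errors are multiples of the empty word, and these remain so
  under \<open>B\<close> and are killed by \<open>single_letter\<close>.\<close>

lemma single_letter_compose:
  assumes lin: "linear B"
    and A: "A (tword [x]) - tword [a x] \<in> tensor_below 1" and B: "\<And>y. B (tword [y]) - tword [b y] \<in> tensor_below 1"
    and below: "\<And>t. t \<in> tensor_below 1 \<Longrightarrow> B t \<in> tensor_below 1"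
  shows "single_letter (B (A (tword [x]))) = b (a x)"
proof -
  have "B (A (tword [x])) = B (A (tword [x]) - tword [a x]) + (B (tword [a x]) - tword [b (a x)]) + tword [b (a x)]"
    by (simp add: linear_diff[OF lin])
  then have "single_letter (B (A (tword [x]))) = single_letter (B (A (tword [x]) - tword [a x])) +
      single_letter (B (tword [a x]) - tword [b (a x)]) + single_letter (tword [b (a x)])"
    by (simp only: linear_add[OF linear_single_letter])
  then show ?thesis
    using single_letter_below[OF below[OF A]] single_letter_below[OF B] by (simp add: single_letter_tword)
qed

text \<open>Converse of \<open>induces_cohomology_isoI\<close> for the total cohomology: bijectivity
  on classes is turned back into statements about elements, injectivity by comparison with the class
  of 0.\<close>

lemma total_cohomology_iso_cases:
  assumes lin: "linear d1" "linear d2" "linear f"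
    and dd: "\<And>x. d1 (d1 x) = 0" "\<And>y. d2 (d2 y) = 0" and chain: "\<And>x. f (d1 x) = d2 (f x)"
    and iso: "induces_cohomology_iso UNIV UNIV d1 UNIV UNIV d2 f"
  shows "\<And>x. d1 x = 0 \<Longrightarrow> f x \<in> range d2 \<Longrightarrow> x \<in> range d1"
    and "\<And>y. d2 y = 0 \<Longrightarrow> \<exists>x w. d1 x = 0 \<and> y = f x + d2 w"
proof -
  let ?R1 = "cohomologous UNIV UNIV d1" and ?R2 = "cohomologous UNIV UNIV d2"
  have r: "subspace (range d1)" "subspace (range d2)"
    by (intro linear_subspace_image lin subspace_UNIV)+
  obtain \<Phi> where \<Phi>: "bij_betw \<Phi> (cohomology UNIV UNIV d1) (cohomology UNIV UNIV d2)"
    "\<And>x. d1 x = 0 \<Longrightarrow> \<Phi> (?R1 `` {x}) = ?R2 `` {f x}"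
    using iso unfolding induces_cohomology_iso_def cocycles_def by auto
  have cls: "?R1 `` {x} \<in> cohomology UNIV UNIV d1" if "d1 x = 0" for x
    using that by (simp add: cohomology_def quotientI cocycles_def)
  have coc: "d2 (f x) = 0" if "d1 x = 0" for x using chain[of x] that by (simp add: linear_0[OF lin(3)])
  show "x \<in> range d1" if x: "d1 x = 0" "f x \<in> range d2" for x
  proof -
    have "?R2 `` {f x} = ?R2 `` {f 0}"
    proof -
      have "f x - y \<in> range d2 \<longleftrightarrow> - y \<in> range d2" for y
        using subspace_diff[OF r(2), of "f x - y" "f x"] subspace_add[OF r(2), of "- y" "f x"] x(2) by auto
      then show ?thesis
        using coc[OF x(1)] by (auto simp: cohomologous_def cocycles_def linear_0[OF lin(3)] linear_0[OF lin(2)])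
    qed
    then have "\<Phi> (?R1 `` {x}) = \<Phi> (?R1 `` {0})" using \<Phi>(2)[OF x(1)] \<Phi>(2)[of 0] by (simp add: linear_0[OF lin(1)])
    then have "?R1 `` {x} = ?R1 `` {0}"
      using inj_onD[OF bij_betw_imp_inj_on[OF \<Phi>(1)]] cls[OF x(1)] cls[of 0] by (simp add: linear_0[OF lin(1)])
    moreover have "x \<in> ?R1 `` {x}" using x(1) subspace_0[OF r(1)] by (simp add: cohomologous_def cocycles_def)
    ultimately have "0 - x \<in> range d1" by (auto simp: cohomologous_def)
    then show ?thesis using subspace_neg[OF r(1), of "0 - x"] by simp
  qed
  show "\<exists>x w. d1 x = 0 \<and> y = f x + d2 w" if y: "d2 y = 0" for y
  proof -
    have "?R2 `` {y} \<in> cohomology UNIV UNIV d2" using y by (simp add: cohomology_def quotientI cocycles_def)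
    then obtain c where c: "c \<in> cohomology UNIV UNIV d1" "\<Phi> c = ?R2 `` {y}"
      using bij_betw_imp_surj_on[OF \<Phi>(1)] by (metis imageE)
    then obtain x where x: "d1 x = 0" "c = ?R1 `` {x}"
      by (auto simp: cohomology_def cocycles_def elim!: quotientE)
    have "y \<in> ?R2 `` {y}" using y subspace_0[OF r(2)] by (simp add: cohomologous_def cocycles_def)
    then have "y \<in> ?R2 `` {f x}" using c(2) x \<Phi>(2) by simp
    then have "f x - y \<in> range d2" by (auto simp: cohomologous_def)
    then obtain w where "f x - y = d2 w" by blast
    then have "y = f x + d2 (- w)" by (simp add: linear_neg[OF lin(2)] algebra_simps)
    then show ?thesis using x(1) by blast
  qed
qed

lemma tensor_derivation_below:
  fixes gr :: "int \<Rightarrow> 'a::real_vector set"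
  assumes "graded_space gr" "degree_map gr gr c \<delta>" "odd c" "t \<in> tensor_below n"
  shows "tensor_derivation gr \<delta> t \<in> tensor_below n"
proof (rule linear_maps_tensor_below[OF assms(1) linear_tensor_derivation[OF assms(1) degree_map_linear[OF assms(2)]]
      subspace_tensor_below assms(4)])
  fix ns and xs :: "'a list" assume "length xs < n"
  then show "tensor_derivation gr \<delta> (tword xs) \<in> tensor_below n"
    using derivation_word_length[OF assms(1-3)] tensor_length_below
    by (auto simp: tensor_derivation_tword[OF assms(1) degree_map_linear[OF assms(2)]])
qed

lemma leading_below:
  assumes lead: "\<And>n t. t \<in> tensor_below (Suc n) \<Longrightarrow> A t - A0 t \<in> tensor_below n"
    and A0: "\<And>n t. t \<in> tensor_below n \<Longrightarrow> A0 t \<in> tensor_below n" and A: "A 0 = 0" and t: "t \<in> tensor_below n"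
  shows "A t \<in> tensor_below n"
proof (cases n)
  case 0
  then show ?thesis using t A by (simp add: tensor_below_0)
next
  case (Suc m)
  then have "A t - A0 t \<in> tensor_below n" using lead[of t m] t tensor_below_mono[of m n] by auto
  then show ?thesis using subspace_add[OF subspace_tensor_below _ A0[OF t]] by fastforce
qed

theorem proposition3p4:
  fixes gr1 :: "int \<Rightarrow> 'a::real_vector set" and gr2 :: "int \<Rightarrow> 'b::real_vector set"
    and m1 :: "'a nov list \<Rightarrow> 'a nov" and m2 :: "'b nov list \<Rightarrow> 'b nov"
    and f :: "'a nov list \<Rightarrow> 'b nov"
  assumes "filtered_Ainf_algebra gr1 m1" and "gapped m1"
    and "filtered_Ainf_algebra gr2 m2" and "gapped m2"
    and "filtered_Ainf_hom gr1 m1 gr2 m2 f" and "gapped f"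
    and "induces_cohomology_iso UNIV UNIV (\<lambda>x. reduction m1 [x])
           UNIV UNIV (\<lambda>x. reduction m2 [x]) (\<lambda>x. reduction f [x])"
  shows "induces_bar_cohomology_iso gr1 m1 UNIV gr2 m2 UNIV f \<and>
    induces_bar_cohomology_iso gr1 m1 (bar_cyc gr1) gr2 m2 (bar_cyc gr2) f \<and>
    induces_bar_cohomology_iso gr1 m1 (bar_sym gr1) gr2 m2 (bar_sym gr2) f"
proof -
  define D1 D2 F where "D1 = bar_differential gr1 m1" and "D2 = bar_differential gr2 m2" and "F = bar_map f"
  have gr: "graded_space gr1" "graded_space gr2"
    and m1: "filtered_maps gr1 gr1 1 m1" and m2: "filtered_maps gr2 gr2 1 m2" and f: "filtered_maps gr1 gr2 0 f"
    and DD: "D1 (D1 x) = 0" "D2 (D2 y) = 0" and FD: "F (D1 x) = D2 (F x)" for x y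
    using assms(1,3,5) by (auto simp: filtered_Ainf_algebra_def filtered_Ainf_hom_def D1_def D2_def F_def)
  obtain e1 e2 e3 where e: "e1 > 0" "e2 > 0" "e3 > 0" "\<forall>xs. low_constant e1 (m1 (map nov_const xs))"
    "\<forall>xs. low_constant e2 (m2 (map nov_const xs))" "\<forall>xs. low_constant e3 (f (map nov_const xs))"
    using gapped_low_constant[OF assms(2)] gapped_low_constant[OF assms(4)] gapped_low_constant[OF assms(6)] by blast
  define e where "e = min e1 (min e2 e3)"
  have e_pos: "0 < e" using e by (simp add: e_def)
  have low: "low_constant e (m1 (map nov_const xs))" "low_constant e (m2 (map nov_const ys))"
    "low_constant e (f (map nov_const xs))" for xs ys
    by (rule low_constant_mono[OF e(4)[rule_format]] low_constant_mono[OF e(5)[rule_format]]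
        low_constant_mono[OF e(6)[rule_format]]; simp add: e_def)+
  let ?D1 = "tensor_differential gr1 m1" and ?D2 = "tensor_differential gr2 m2" and ?F = "tensor_map f"
  note linD1 = linear_tensor_differential[OF gr(1) m1] and linD2 = linear_tensor_differential[OF gr(2) m2]
    and linF = linear_tensor_map[OF gr f]
  have conv: "D1 = nov_extend ?D1" "D2 = nov_extend ?D2" "F = nov_extend ?F"
    unfolding D1_def D2_def F_def
    by (rule bar_differential_conv[OF gr(1) m1] bar_differential_conv[OF gr(2) m2] bar_map_conv[OF gr f])+
  \<comment> \<open>The coefficients of \<open>T^0 e^0\<close>. By the common gap \<open>e\<close>
    no other coefficient occurs below energy \<open>e\<close>, so these are the leading
    parts.\<close>
  define b1 b2 bf where "b1 = (\<lambda>t. ncoeff (?D1 t) 0 0)" and "b2 = (\<lambda>t. ncoeff (?D2 t) 0 0)" and "bf = (\<lambda>t. ncoeff (?F t) 0 0)"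
  have linb: "linear b1" "linear b2" "linear bf"
    unfolding b1_def b2_def bf_def
    using linear_compose[OF linD1 linear_ncoeff] linear_compose[OF linD2 linear_ncoeff] linear_compose[OF linF linear_ncoeff]
    by (simp_all add: o_def)
  have lin: "linear D1" "linear D2" "linear F"
    unfolding conv by (intro linear_nov_extend linD1 linD2 linF)+
  have lead: "leading_part e D1 b1" "leading_part e D2 b2" "leading_part e F bf"
    unfolding conv b1_def b2_def bf_def
    using low tensor_differential_low[OF gr(1) m1] tensor_differential_low[OF gr(2) m2] tensor_map_low[OF gr f low(3)]
    by (intro leading_part_nov_extend linD1 linD2 linF e_pos; simp add: low_constant_def coeff_map_def)+

  define d1 d2 r where "d1 = (\<lambda>x. reduction m1 [x])" and "d2 = (\<lambda>x. reduction m2 [x])" and "r = (\<lambda>x. reduction f [x])"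
  have deg: "degree_map gr1 gr1 1 d1" "degree_map gr2 gr2 1 d2" "degree_map gr1 gr2 0 r"
  proof -
    have *: "degree_map g g' k (\<lambda>x. reduction \<mu> [x])"
      if \<mu>: "filtered_maps g g' k \<mu>" and g: "graded_space g" and l: "linear (\<lambda>x. reduction \<mu> [x])"
      for g :: "int \<Rightarrow> 'c::real_vector set" and g' :: "int \<Rightarrow> 'd::real_vector set" and k \<mu>
    proof -
      have "reduction \<mu> [x] \<in> g' (n + k)" if "x \<in> g n" for x n
      proof -
        have "hom_word g [n] [x]" using that by simp
        then have "coeff_map \<mu> 0 0 [x] \<in> g' (sdeg [n] + (k - 2 * 0) + 1)"
          using homogeneous_maps_coeff_map[OF \<mu> g, of 0 0] unfolding homogeneous_maps_def by blast
        then show ?thesis by (simp add: coeff_map_def reduction_def)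
      qed
      then show ?thesis using l by (auto simp: degree_map_def)
    qed
    show "degree_map gr1 gr1 1 d1" "degree_map gr2 gr2 1 d2" "degree_map gr1 gr2 0 r"
      unfolding d1_def d2_def r_def
      by (rule * m1 m2 f gr linear_reduction_single[OF gr(1) m1] linear_reduction_single[OF gr(2) m2]
          linear_reduction_single_map[OF gr f])+
  qed
  note lind = deg[THEN degree_map_linear]

  have m0: "coeff_map m1 0 0 [] = 0" "coeff_map m2 0 0 [] = 0"
    using m1 m2 by (auto simp: filtered_maps_def coeff_map_def energy_ge_def)
  let ?T1 = "tensor_derivation gr1 d1" and ?T2 = "tensor_derivation gr2 d2" and ?Tf = "tensor_functor r"
  have lead1: "b1 t - ?T1 t \<in> tensor_below n" if "t \<in> tensor_below (Suc n)" for t n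
    unfolding b1_def d1_def by (rule tensor_differential_leading[OF gr(1) m1 m0(1) that])
  have lead2: "b2 t - ?T2 t \<in> tensor_below n" if "t \<in> tensor_below (Suc n)" for t n
    unfolding b2_def d2_def by (rule tensor_differential_leading[OF gr(2) m2 m0(2) that])
  have leadf: "bf t - ?Tf t \<in> tensor_below n" if "t \<in> tensor_below (Suc n)" for t n
    unfolding bf_def r_def tensor_functor_def by (rule tensor_map_leading[OF gr f low(3) e_pos that])
  have odd_one: "odd (1 :: int)" by simp
  note T_below = tensor_derivation_below[OF gr(1) deg(1) odd_one] tensor_derivation_below[OF gr(2) deg(2) odd_one]
    tensor_functor_below[OF gr(1) lind(3)]
  note linT = linear_tensor_derivation[OF gr(1) lind(1)] linear_tensor_derivation[OF gr(2) lind(2)]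
    linear_tensor_functor[OF lind(3)]
  have b_below: "t \<in> tensor_below n \<Longrightarrow> b1 t \<in> tensor_below n" "u \<in> tensor_below n \<Longrightarrow> b2 u \<in> tensor_below n"
    "t \<in> tensor_below n \<Longrightarrow> bf t \<in> tensor_below n" for t u n
    using leading_below[of b1 ?T1, OF lead1 T_below(1) linear_0[OF linb(1)]]
      leading_below[of b2 ?T2, OF lead2 T_below(2) linear_0[OF linb(2)]]
      leading_below[of bf ?Tf, OF leadf T_below(3) linear_0[OF linb(3)]] by blast+

  \<comment> \<open>The identities for \<open>D1\<close>, \<open>D2\<close>, \<open>F\<close>,
    applied to constants and read off at \<open>T^0 e^0\<close>.\<close>
  have bb: "b1 (b1 t) = 0" "b2 (b2 u) = 0" "bf (b1 t) = b2 (bf t)" for t u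
  proof -
    have c: "ncoeff (A (B (nov_const v))) 0 0 = A0 (B0 v)"
      if "leading_part e A A0" "leading_part e B B0" for A :: "'d::real_vector tensor nov \<Rightarrow> 'f::real_vector tensor nov"
        and A0 and B :: "'c::real_vector tensor nov \<Rightarrow> 'd tensor nov" and B0 v
      using leading_partD[OF that(1) energy_ge_0, of 0 "B (nov_const v)" 0] leading_partD[OF that(2) energy_ge_0, of 0 "nov_const v" 0] e_pos
      by (simp add: ncoeff_nov_const)
    show "b1 (b1 t) = 0" "b2 (b2 u) = 0" "bf (b1 t) = b2 (bf t)"
      using c[OF lead(1,1), of t] c[OF lead(2,2), of u] c[OF lead(3,1), of t] c[OF lead(2,3), of t] DD FD by simp_all
  qed
  have single: "b1 (tword [x]) - tword [d1 x] \<in> tensor_below 1" "b2 (tword [y]) - tword [d2 y] \<in> tensor_below 1"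
    "bf (tword [x]) - tword [r x] \<in> tensor_below 1" for x y
  proof -
    have "tword [x] \<in> tensor_below (Suc 1)" "tword [y] \<in> tensor_below (Suc 1)" by (simp_all add: tword_tensor_below)
    then show "b1 (tword [x]) - tword [d1 x] \<in> tensor_below 1" "b2 (tword [y]) - tword [d2 y] \<in> tensor_below 1"
      "bf (tword [x]) - tword [r x] \<in> tensor_below 1"
      using lead1[of "tword [x]" 1] lead2[of "tword [y]" 1] leadf[of "tword [x]" 1]
      by (simp_all add: tensor_derivation_tword[OF gr(1) lind(1)] tensor_derivation_tword[OF gr(2) lind(2)]
          tensor_functor_tword lind tensor_cons_zero)
  qed
  \<comment> \<open>The one-letter part of these identities: the linear parts form complexes and a
    chain map, which the cohomological hypothesis by itself does not state.\<close>
  have dd: "d1 (d1 x) = 0" "d2 (d2 y) = 0" "r (d1 x) = d2 (r x)" for x y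
    using single_letter_compose[where A = b1 and a = d1 and b = d1, OF linb(1) single(1) single(1) b_below(1), of x]
      single_letter_compose[where A = b2 and a = d2 and b = d2, OF linb(2) single(2) single(2) b_below(2), of y]
      single_letter_compose[where A = b1 and a = d1 and b = r, OF linb(3) single(1) single(3) b_below(3), of x]
      single_letter_compose[where A = bf and a = r and b = d2, OF linb(2) single(3) single(2) b_below(2), of x]
    by (simp_all add: bb linear_0[OF linear_single_letter])
  note quasi = total_cohomology_iso_cases[OF lind dd assms(7)[folded d1_def d2_def r_def]]
  obtain h1 h2 g where h: "degree_map gr1 gr1 (-1) h1" "degree_map gr2 gr2 (-1) h2" "degree_map gr2 gr1 0 g"
      "\<And>x. d1 (h1 x) + h1 (d1 x) = x - g (r x)" "\<And>y. d2 (h2 y) + h2 (d2 y) = y - r (g y)"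
      "\<And>y. g (r (g y)) = g y" "\<And>y. d1 (g y) = 0" "\<And>y. g (d2 y) = 0"
    using quasi_iso_homotopy_inverse[OF gr deg dd quasi] by blast
  \<comment> \<open>Both are idempotent because \<open>g r g = g\<close>, and
    \<open>d1 g = 0\<close>, \<open>g d2 = 0\<close> make them annihilate, and be annihilated by,
    the differentials of letters.\<close>
  define p1 p2 where "p1 = (\<lambda>x. g (r x))" and "p2 = (\<lambda>y. r (g y))"
  note ling = degree_map_linear[OF h(3)]
  have p_deg: "degree_map gr1 gr1 0 p1" "degree_map gr2 gr2 0 p2"
    unfolding p1_def p2_def using degree_map_compose[OF deg(3) h(3)] degree_map_compose[OF h(3) deg(3)] by simp_all
  define H1 H2 where "H1 = weighted_homotopy gr1 h1 p1" and "H2 = weighted_homotopy gr2 h2 p2"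
  let ?G = "tensor_functor g"
  have c1: "p1 (p1 x) = p1 x" "d1 (h1 x) + h1 (d1 x) = x - p1 x" "p1 (d1 x) = 0" "d1 (p1 x) = 0" for x
    by (simp_all add: p1_def h dd)
  have c2: "p2 (p2 y) = p2 y" "d2 (h2 y) + h2 (d2 y) = y - p2 y" "p2 (d2 y) = 0" "d2 (p2 y) = 0" for y
    by (simp_all add: p2_def h linear_0[OF lind(3)] dd(3)[symmetric])
  note con1 = gr(1) deg(1) h(1) p_deg(1) c1 and con2 = gr(2) deg(2) h(2) p_deg(2) c2
  have linH: "linear H1" "linear H2" "linear ?G"
    unfolding H1_def H2_def
    by (rule linear_weighted_homotopy[OF con1] linear_weighted_homotopy[OF con2] linear_tensor_functor[OF ling])+
  have H_below: "t \<in> tensor_below n \<Longrightarrow> H1 t \<in> tensor_below n" "u \<in> tensor_below n \<Longrightarrow> H2 u \<in> tensor_below n"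
    "u \<in> tensor_below n \<Longrightarrow> ?G u \<in> tensor_below n" for t u n
    unfolding H1_def H2_def
    using weighted_homotopy_below[OF con1] weighted_homotopy_below[OF con2] tensor_functor_below[OF gr(2) ling] by blast+
  have contract: "?T1 (H1 t) + H1 (?T1 t) = t - ?G (?Tf t)" "?T2 (H2 u) + H2 (?T2 u) = u - ?Tf (?G u)" for t u
    using weighted_homotopy_contraction[OF con1, of t] weighted_homotopy_contraction[OF con2, of u]
    by (simp_all add: H1_def H2_def tensor_functor_compose lind ling p1_def p2_def)
  \<comment> \<open>Harmonic letters have zero differential and \<open>g\<close> kills exact ones,
    so both composites vanish term by term in the Leibniz rule. In particular the tensor power of
    \<open>g\<close> is a chain map for the leading derivations.\<close>
  have GT: "?G (?T2 u) = 0" "?T1 (?G u) = 0" for u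
  proof -
    have z: "tword (x # xs) = 0" if "x = 0" for x :: 'a and xs
      using multilinear_words_zero[OF multilinear_words_tword, of "x # xs"] that by simp
    have cons: "?G (tensor_cons y t) = tensor_cons (g y) (?G t)" for y t
    proof (rule linear_eq_on_words[of "\<lambda>t. ?G (tensor_cons y t)"])
      show "linear (\<lambda>t. ?G (tensor_cons y t))" "linear (\<lambda>t. tensor_cons (g y) (?G t))"
        using linear_compose[OF linear_tensor_cons linH(3)] linear_compose[OF linH(3) linear_tensor_cons]
        by (simp_all add: o_def)
    qed (simp add: tensor_cons_tword tensor_functor_tword ling)
    have w: "?G (derivation_word gr2 d2 ys) = 0" "derivation_word gr1 d1 (map g ys) = 0" for ys
    proof (induction ys)
      case Nil
      { case 1 show ?case by (simp add: linear_0[OF linH(3)]) }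
      { case 2 show ?case by simp }
    next
      case (Cons y ys)
      { case 1 show ?case
          using Cons(1) by (simp add: linear_add[OF linH(3)] tensor_functor_tword ling z h(8) cons tensor_cons_zero) }
      { case 2 show ?case using Cons(2) by (simp add: z h(7) tensor_cons_zero) }
    qed
    have "?G (?T2 u) = (\<lambda>u. 0) u"
      by (rule linear_eq_on_words[OF linear_compose[OF linT(2) linH(3), unfolded o_def]])
        (simp_all add: linear_iff tensor_derivation_tword[OF gr(2) lind(2)] w)
    moreover have "?T1 (?G u) = (\<lambda>u. 0) u"
      by (rule linear_eq_on_words[OF linear_compose[OF linH(3) linT(1), unfolded o_def]])
        (simp add: linear_iff, simp add: tensor_derivation_tword[OF gr(1) lind(1)] tensor_functor_tword ling w)
    ultimately show "?G (?T2 u) = 0" "?T1 (?G u) = 0" by simp_all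
  qed
  note add_below = subspace_add[OF subspace_tensor_below] and diff_below = subspace_diff[OF subspace_tensor_below]
  \<comment> \<open>Each leading part is replaced by its derivation or functorial extension. The
    main terms cancel by \<open>contract\<close>, and every remaining difference loses a unit of
    length.\<close>
  have n1: "b1 (H1 v) + H1 (b1 v) + ?G (bf v) - v \<in> tensor_below n" if v: "v \<in> tensor_below (Suc n)" for v n
  proof -
    have "b1 (H1 v) + H1 (b1 v) + ?G (bf v) - v =
        (b1 (H1 v) - ?T1 (H1 v)) + H1 (b1 v - ?T1 v) + ?G (bf v - ?Tf v)"
      using contract(1)[of v] by (simp add: linear_diff[OF linH(1)] linear_diff[OF linH(3)] algebra_simps)
    also have "\<dots> \<in> tensor_below n"
      by (intro add_below lead1[OF H_below(1)[OF v]] H_below(1)[OF lead1[OF v]] H_below(3)[OF leadf[OF v]])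
    finally show ?thesis .
  qed
  have n2: "b2 (H2 v) + H2 (b2 v) + bf (?G v) - v \<in> tensor_below n" if v: "v \<in> tensor_below (Suc n)" for v n
  proof -
    have "b2 (H2 v) + H2 (b2 v) + bf (?G v) - v =
        (b2 (H2 v) - ?T2 (H2 v)) + H2 (b2 v - ?T2 v) + (bf (?G v) - ?Tf (?G v))"
      using contract(2)[of v] by (simp add: linear_diff[OF linH(2)] algebra_simps)
    also have "\<dots> \<in> tensor_below n"
      by (intro add_below lead2[OF H_below(2)[OF v]] H_below(2)[OF lead2[OF v]] leadf[OF H_below(3)[OF v]])
    finally show ?thesis .
  qed
  have n3: "?G (b2 v) - b1 (?G v) \<in> tensor_below n" if v: "v \<in> tensor_below (Suc n)" for v n
  proof -
    have "?G (b2 v) - b1 (?G v) = ?G (b2 v - ?T2 v) - (b1 (?G v) - ?T1 (?G v))"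
      by (simp add: linear_diff[OF linH(3)] GT)
    also have "\<dots> \<in> tensor_below n"
      by (intro diff_below H_below(3)[OF lead2[OF v]] lead1[OF H_below(3)[OF v]])
    finally show ?thesis .
  qed
  \<comment> \<open>The homotopies \<open>H1\<close> and \<open>H2\<close> are unrelated, so nothing
    cancels here and only the length bound is preserved.\<close>
  have n4: "H2 (bf v) - bf (H1 v) \<in> tensor_below n" if v: "v \<in> tensor_below n" for v n
    using H_below(2)[OF b_below(3)[OF v]] b_below(3)[OF H_below(1)[OF v]] by (rule diff_below)

  \<comment> \<open>One statement for all cases: \<open>W n q\<close> is the space allowed for
    coefficients of \<open>e^q\<close> in degree \<open>n\<close>. Families constant in
    \<open>n\<close> give the total cohomology.\<close>
  have iso: "induces_cohomology_iso (coeffs_in (W1 n)) (coeffs_in (W1 (n - 1))) D1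
      (coeffs_in (W2 n)) (coeffs_in (W2 (n - 1))) D2 F"
    if sub: "\<And>n q. subspace (W1 n q)" "\<And>n q. subspace (W2 n q)"
      and D: "\<And>n q v. v \<in> W1 n q \<Longrightarrow> ?D1 v \<in> coeffs_in (\<lambda>q'. W1 (n + 1) (q + q'))"
        "\<And>n q v. v \<in> W2 n q \<Longrightarrow> ?D2 v \<in> coeffs_in (\<lambda>q'. W2 (n + 1) (q + q'))"
        "\<And>n q v. v \<in> W1 n q \<Longrightarrow> ?F v \<in> coeffs_in (\<lambda>q'. W2 n (q + q'))"
      and H: "\<And>n q v. v \<in> W1 n q \<Longrightarrow> H1 v \<in> W1 (n - 1) q" "\<And>n q v. v \<in> W2 n q \<Longrightarrow> H2 v \<in> W2 (n - 1) q"
        "\<And>n q v. v \<in> W2 n q \<Longrightarrow> ?G v \<in> W1 n q"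
    for W1 :: "int \<Rightarrow> int \<Rightarrow> 'a tensor set" and W2 :: "int \<Rightarrow> int \<Rightarrow> 'b tensor set" and n
  proof -
    have DW: "D1 ` coeffs_in (W1 n) \<subseteq> coeffs_in (W1 (n + 1))" "D2 ` coeffs_in (W2 n) \<subseteq> coeffs_in (W2 (n + 1))"
      "F ` coeffs_in (W1 n) \<subseteq> coeffs_in (W2 n)" for n
      unfolding conv by (intro image_subsetI; erule nov_extend_coeffs_in[rotated 2]; fact sub D)+
    \<comment> \<open>The component over the first algebra is shifted by one: a cone element of
      degree \<open>k\<close> has \<open>y\<close> in degree \<open>k\<close> and \<open>x\<close>
      in degree \<open>k + 1\<close>, and its primitive has components in degrees
      \<open>k - 1\<close> and \<open>k\<close>.\<close>
    have acyclic: "\<exists>w2\<in>coeffs_in (W2 (k - 1)). \<exists>w1\<in>coeffs_in (W1 k). y = D2 w2 + F w1 \<and> x = - D1 w1"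
      if "y \<in> coeffs_in (W2 k)" "x \<in> coeffs_in (W1 (k + 1))" "D1 x = 0" "D2 y + F x = 0" for y x k
    proof (rule filtered_cone_acyclic[OF lin linb linH e_pos lead DD FD, of tensor_below tensor_below "W1 (k + 1)" "W2 k"])
      show "\<And>n. subspace (tensor_below n :: 'a tensor set)" "\<And>n. subspace (tensor_below n :: 'b tensor set)"
        by (rule subspace_tensor_below)+
      show "\<And>n. tensor_below n \<subseteq> (tensor_below (Suc n) :: 'a tensor set)"
        "\<And>n. tensor_below n \<subseteq> (tensor_below (Suc n) :: 'b tensor set)" by (intro tensor_below_mono; simp)+
      show "\<And>v :: 'a tensor. \<exists>n. v \<in> tensor_below n" "\<And>v :: 'b tensor. \<exists>n. v \<in> tensor_below n"
        by (rule tensor_below_exhaust)+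
      show "D2 ` coeffs_in (W2 (k - 1)) \<subseteq> coeffs_in (W2 k)" using DW(2)[of "k - 1"] by simp
      show "h \<in> W1 (k + 1) q \<Longrightarrow> H1 h \<in> W1 k q" for h q using H(1)[of h "k + 1" q] by simp
    qed (use that n1 n2 n3 n4 sub H DW in \<open>auto simp: tensor_below_0\<close>)
    show ?thesis
    proof (rule induces_cohomology_isoI)
      show "D1 ` coeffs_in (W1 (n - 1)) \<subseteq> coeffs_in (W1 n)" "D2 ` coeffs_in (W2 (n - 1)) \<subseteq> coeffs_in (W2 n)"
        using DW(1,2)[of "n - 1"] by simp_all
      show "x \<in> D1 ` coeffs_in (W1 (n - 1))"
        if x: "x \<in> coeffs_in (W1 n)" "D1 x = 0" and y: "y \<in> coeffs_in (W2 (n - 1))" "F x = D2 y" for x y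
      proof -
        \<comment> \<open>Injectivity: \<open>(- y, x)\<close> is a cocycle of the cone, and the
          second component of its primitive exhibits \<open>x\<close> as a coboundary.\<close>
        have "- y \<in> coeffs_in (W2 (n - 1))" by (rule subspace_neg[OF subspace_coeffs_in[OF sub(2)] y(1)])
        moreover have "D2 (- y) + F x = 0" by (simp add: linear_neg[OF lin(2)] y(2))
        ultimately obtain w where "w \<in> coeffs_in (W1 (n - 1))" "x = - D1 w"
          using acyclic[of "- y" "n - 1" x] x by auto
        then show ?thesis
          using subspace_neg[OF subspace_coeffs_in[OF sub(1)]] by (intro image_eqI[of _ _ "- w"]) (simp_all add: linear_neg[OF lin(1)])
      qed
      show "\<exists>x\<in>coeffs_in (W1 n). \<exists>w\<in>coeffs_in (W2 (n - 1)). D1 x = 0 \<and> y = F x + D2 w"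
        if y: "y \<in> coeffs_in (W2 n)" "D2 y = 0" for y
      proof -
        \<comment> \<open>Surjectivity: \<open>(y, 0)\<close> is a cocycle of the cone, and the
          second component of its primitive is a cocycle mapping to the class of
          \<open>y\<close>.\<close>
        have "0 \<in> coeffs_in (W1 (n + 1))" by (rule subspace_0[OF subspace_coeffs_in[OF sub(1)]])
        then obtain w x where "w \<in> coeffs_in (W2 (n - 1))" "x \<in> coeffs_in (W1 n)" "y = D2 w + F x" "0 = - D1 x"
          using acyclic[OF y(1), of 0] y(2) by (auto simp: linear_0[OF lin(1)] linear_0[OF lin(3)])
        then show ?thesis by (intro bexI[of _ x] bexI[of _ w]) auto
      qed
    qed (use DW(3) subspace_coeffs_in[OF sub(1)] subspace_coeffs_in[OF sub(2)] lin FD in auto)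
  qed

  have bar_iso: "induces_bar_cohomology_iso gr1 m1 (coeffs_in (\<lambda>q. U1)) gr2 m2 (coeffs_in (\<lambda>q. U2)) f"
    if U: "subspace U1" "subspace U2"
      and D: "\<And>v. v \<in> U1 \<Longrightarrow> ?D1 v \<in> coeffs_in (\<lambda>q. U1)" "\<And>v. v \<in> U2 \<Longrightarrow> ?D2 v \<in> coeffs_in (\<lambda>q. U2)"
        "\<And>v. v \<in> U1 \<Longrightarrow> ?F v \<in> coeffs_in (\<lambda>q. U2)"
      and H: "\<And>v. v \<in> U1 \<Longrightarrow> H1 v \<in> U1" "\<And>v. v \<in> U2 \<Longrightarrow> H2 v \<in> U2" "\<And>v. v \<in> U2 \<Longrightarrow> ?G v \<in> U1"
    for U1 U2
    unfolding induces_bar_cohomology_iso_def D1_def[symmetric] D2_def[symmetric] F_def[symmetric]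
  proof (intro conjI allI)
    show "induces_cohomology_iso (coeffs_in (\<lambda>q. U1)) (coeffs_in (\<lambda>q. U1)) D1 (coeffs_in (\<lambda>q. U2)) (coeffs_in (\<lambda>q. U2)) D2 F"
      by (rule iso[of "\<lambda>n q. U1" "\<lambda>n q. U2"]) (use U D H in auto)
    fix n
    let ?W1 = "\<lambda>n q. U1 \<inter> tensor_degree gr1 (n - 2 * q)" and ?W2 = "\<lambda>n q. U2 \<inter> tensor_degree gr2 (n - 2 * q)"
    show "induces_cohomology_iso (coeffs_in (\<lambda>q. U1) \<inter> bar_degree gr1 n) (coeffs_in (\<lambda>q. U1) \<inter> bar_degree gr1 (n - 1)) D1
        (coeffs_in (\<lambda>q. U2) \<inter> bar_degree gr2 n) (coeffs_in (\<lambda>q. U2) \<inter> bar_degree gr2 (n - 1)) D2 F"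
      unfolding bar_degree_conv coeffs_in_Int
    proof (rule iso[of ?W1 ?W2])
      show "subspace (?W1 n q)" "subspace (?W2 n q)" for n q
        by (intro subspace_inter U subspace_tensor_degree)+
      fix n q
      show "?D1 v \<in> coeffs_in (\<lambda>q'. ?W1 (n + 1) (q + q'))" if "v \<in> ?W1 n q" for v
        using that D(1)[of v] tensor_differential_degree[OF gr(1) m1, of v "n - 2 * q"]
        by (simp add: coeffs_in_def algebra_simps)
      show "?D2 v \<in> coeffs_in (\<lambda>q'. ?W2 (n + 1) (q + q'))" if "v \<in> ?W2 n q" for v
        using that D(2)[of v] tensor_differential_degree[OF gr(2) m2, of v "n - 2 * q"]
        by (simp add: coeffs_in_def algebra_simps)
      show "?F v \<in> coeffs_in (\<lambda>q'. ?W2 n (q + q'))" if "v \<in> ?W1 n q" for v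
        using that D(3)[of v] tensor_map_degree[OF gr f, of v "n - 2 * q"]
        by (simp add: coeffs_in_def algebra_simps)
      show "H1 v \<in> ?W1 (n - 1) q" if "v \<in> ?W1 n q" for v
        using that H(1)[of v] weighted_homotopy_degree[OF con1, of v "n - 2 * q"] by (simp add: H1_def algebra_simps)
      show "H2 v \<in> ?W2 (n - 1) q" if "v \<in> ?W2 n q" for v
        using that H(2)[of v] weighted_homotopy_degree[OF con2, of v "n - 2 * q"] by (simp add: H2_def algebra_simps)
      show "?G v \<in> ?W1 n q" if "v \<in> ?W2 n q" for v
        using that H(3)[of v] tensor_functor_degree[OF h(3), of v "n - 2 * q"] by simp
    qed
  qed
  note swaps = weighted_homotopy_tswap[OF con1, folded H1_def] weighted_homotopy_tswap[OF con2, folded H2_def]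
    tensor_functor_tswap[OF gr(2,1) h(3)]
  note lengths = weighted_homotopy_length[OF con1, folded H1_def] weighted_homotopy_length[OF con2, folded H2_def]
    tensor_functor_length[OF ling]
  show ?thesis
    unfolding bar_cyc_conv[OF gr(1)] bar_cyc_conv[OF gr(2)] bar_sym_conv[OF gr(1)] bar_sym_conv[OF gr(2)]
  proof (intro conjI)
    show "induces_bar_cohomology_iso gr1 m1 UNIV gr2 m2 UNIV f"
      unfolding UNIV_conv by (rule bar_iso) (auto simp: UNIV_conv[symmetric])
    show "induces_bar_cohomology_iso gr1 m1 (coeffs_in (\<lambda>q. cyc_tensors gr1)) gr2 m2 (coeffs_in (\<lambda>q. cyc_tensors gr2)) f"
      by (rule bar_iso)
        (use subspace_cyc_tensors gr tensor_differential_cyc[OF gr(1) m1] tensor_differential_cyc[OF gr(2) m2]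
          tensor_map_cyc[OF gr f] commute_preserves_cyc[OF gr(1,1) linH(1) lengths(1) swaps(1)]
          commute_preserves_cyc[OF gr(2,2) linH(2) lengths(2) swaps(2)]
          commute_preserves_cyc[OF gr(2,1) linH(3) lengths(3) swaps(3)] in blast)+
    show "induces_bar_cohomology_iso gr1 m1 (coeffs_in (\<lambda>q. sym_tensors gr1)) gr2 m2 (coeffs_in (\<lambda>q. sym_tensors gr2)) f"
      by (rule bar_iso)
        (use subspace_sym_tensors gr tensor_differential_sym[OF gr(1) m1] tensor_differential_sym[OF gr(2) m2]
          tensor_map_sym[OF gr f] commute_preserves_sym[OF swaps(1)] commute_preserves_sym[OF swaps(2)]
          commute_preserves_sym[OF swaps(3)] in blast)+
  qed
qed

end
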